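(* Let $B_1=\{x\in\mathbb{R}^3:|x|<1\}$, let $a,b>0$ be constants, and let $f:(0,\infty)\to(0,\infty)$ be continuous and non-increasing. Let $v$ be a positive $W^{2,2}$ weak solution of \[ \begin{cases} \Delta^2 v(x) = -f(v(x)), & x\in B_1,\\ v(x)=a, & x\in\partial B_1,\\ \partial_\nu v(x)=b, & x\in\partial B_1, \end{cases} \] with $\inf_{B_1}|v|\ge\epsilon$ for some $\epsilon>0$. Then $v$ is radially symmetric with respect to the origin, and $v$ is strictly increasing as a function of $r=|x|$.
   Context: $\nu$ denotes the outward unit normal on $\partial B_1$. *)

theory Defs
  imports "HOL-Analysis.Analysis"
begin

definition partial :: "3 \<Rightarrow> (real^3 \<Rightarrow> real) \<Rightarrow> real^3 \<Rightarrow> real" where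
  "partial i \<phi> x = deriv (\<lambda>t. \<phi> (x + t *\<^sub>R axis i 1)) 0"

definition smooth3 :: "(real^3 \<Rightarrow> real) \<Rightarrow> bool" where
  "smooth3 \<phi> \<longleftrightarrow> (\<forall>is :: 3 list.
      continuous_on UNIV (foldr partial is \<phi>) \<and>
      (\<forall>i x. (\<lambda>t. foldr partial is \<phi> (x + t *\<^sub>R axis i 1)) differentiable (at 0)))"

definition test_fun :: "(real^3) set \<Rightarrow> (real^3 \<Rightarrow> real) \<Rightarrow> bool" where
  "test_fun U \<phi> \<longleftrightarrow> smooth3 \<phi> \<and> compact (closure {x. \<phi> x \<noteq> 0})
      \<and> closure {x. \<phi> x \<noteq> 0} \<subseteq> U"

definition L2 :: "(real^3) set \<Rightarrow> (real^3 \<Rightarrow> real) \<Rightarrow> bool" where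
  "L2 U g \<longleftrightarrow> set_borel_measurable lebesgue U g \<and> set_integrable lebesgue U (\<lambda>x. (g x)^2)"

definition weak_deriv :: "(real^3) set \<Rightarrow> 3 list \<Rightarrow> (real^3 \<Rightarrow> real) \<Rightarrow> (real^3 \<Rightarrow> real) \<Rightarrow> bool" where
  "weak_deriv U is v g \<longleftrightarrow> (\<forall>\<phi>. test_fun U \<phi> \<longrightarrow>
     set_lebesgue_integral lebesgue U (\<lambda>x. v x * foldr partial is \<phi> x)
       = (-1) ^ length is * set_lebesgue_integral lebesgue U (\<lambda>x. g x * \<phi> x))"

definition W22 :: "(real^3) set \<Rightarrow> (real^3 \<Rightarrow> real) \<Rightarrow> bool" where
  "W22 U v \<longleftrightarrow> L2 U v \<and> (\<forall>is :: 3 list. length is \<le> 2 \<longrightarrow> (\<exists>g. L2 U g \<and> weak_deriv U is v g))"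

definition W022 :: "(real^3) set \<Rightarrow> (real^3 \<Rightarrow> real) \<Rightarrow> bool" where
  "W022 U u \<longleftrightarrow> W22 U u \<and> (\<exists>\<phi> :: nat \<Rightarrow> real^3 \<Rightarrow> real. (\<forall>n. test_fun U (\<phi> n)) \<and>
     (\<forall>(is :: 3 list) g. length is \<le> 2 \<longrightarrow> L2 U g \<longrightarrow> weak_deriv U is u g \<longrightarrow>
        (\<lambda>n. set_lebesgue_integral lebesgue U (\<lambda>x. (foldr partial is (\<phi> n) x - g x)^2))
          \<longlonglongrightarrow> 0))"

end

theory Submission
  imports Defs "HOL-Computational_Algebra.Polynomial"
begin

text \<open>
  Put \<open>u = a + b * (norm x^2 - 1) / 2 - v\<close>. Then \<open>u\<close> has zero Dirichlet data and
  \<open>\<Delta>\<^sup>2 u = F\<close> with \<open>F = f (a + b * (norm x^2 - 1) / 2 - u)\<close>, so \<open>u\<close> is a positive multiple of the integral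
  of \<open>F\<close> against Boggio's Green function, which in dimension three is
  \<open>(A - d)^2 / A\<close> with \<open>d = norm (x - y)\<close> and \<open>A^2 = d^2 + (1 - norm x^2) * (1 - norm y^2)\<close>.
  The value of the multiplicative constant is irrelevant.

  \<open>F\<close> increases with \<open>u\<close> and decreases with \<open>norm x\<close>. The method of moving planes, applied to the
  integral equation, shows that \<open>u\<close> does not decrease under reflection of a cap into the rest of the
  ball. As \<open>f\<close> is only continuous, the plane is moved by steps whose length depends on the modulus of
  continuity of \<open>F\<close> alone. Hence \<open>u\<close> is radial and non-increasing in \<open>norm x\<close>, and \<open>v\<close> is strictly
  increasing because \<open>a + b * (norm x^2 - 1) / 2\<close> is.
\<close>

text \<open>The biharmonic operator has no maximum principle, so all comparisons are made on the
  kernel of the integral equation. A kernel difference under reflection has a sign on one side of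
  the plane only; on the other side it is controlled through the sum with its mirror image, and the
  values of \<open>F\<close> at the two points must then be compared.

  The integral equation has to hold at every point of the ball although \<open>v\<close> is only a
  weak solution. The boundary data enter through the test functions that approximate
  \<open>v - h\<close> in the sense of \<open>W022\<close>: each of them satisfies the
  representation formula \<open>dker_test_fun\<close>, which survives the limit at each fixed
  \<open>x\<close> because \<open>dker x\<close> is square integrable in dimension three. The
  differential equation enters through the test functions \<open>psi s x\<close>: they converge to
  \<open>green x\<close>, and their Laplacians converge to \<open>dker x\<close> under a common
  square integrable bound. The normalising constant \<open>12 * bump_mass\<close> comes from the
  Laplacian of \<open>dreg\<close>, a smooth regularisation of \<open>dker\<close>, which contains
  12 times an approximate identity of mass \<open>bump_mass\<close>.\<close>

section \<open>Smooth functions on three-dimensional space\<close>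

text \<open>\<open>partial\<close> rests on \<open>deriv\<close>, which has an arbitrary value where
  no derivative exists. This relation also records existence; calculus rules are proved for it and
  carried over by \<open>partial_eqI\<close>.\<close>

definition has_partial :: "3 \<Rightarrow> (real^3 \<Rightarrow> real) \<Rightarrow> (real^3 \<Rightarrow> real) \<Rightarrow> bool" where
  "has_partial i \<phi> \<phi>' \<longleftrightarrow>
     (\<forall>x. ((\<lambda>t. \<phi> (x + t *\<^sub>R axis i 1)) has_real_derivative \<phi>' x) (at 0))"

lemma partial_eqI: "has_partial i \<phi> \<phi>' \<Longrightarrow> partial i \<phi> = \<phi>'"
  unfolding has_partial_def partial_def by (auto simp: fun_eq_iff intro!: DERIV_imp_deriv)

text \<open>Finite order makes smoothness accessible to induction: the product and chain rules at
  one order use only the same rules one order lower, applied to first derivatives.\<close>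

fun Ck :: "nat \<Rightarrow> (real^3 \<Rightarrow> real) \<Rightarrow> bool" where
  "Ck 0 \<phi> \<longleftrightarrow> continuous_on UNIV \<phi>"
| "Ck (Suc n) \<phi> \<longleftrightarrow> continuous_on UNIV \<phi> \<and>
     (\<forall>i. has_partial i \<phi> (partial i \<phi>)) \<and> (\<forall>i. Ck n (partial i \<phi>))"

lemma Ck_continuous: "Ck n \<phi> \<Longrightarrow> continuous_on UNIV \<phi>"
  by (cases n) auto

lemma CkI:
  assumes "continuous_on UNIV \<phi>" "\<And>i. has_partial i \<phi> (D i)" "\<And>i. Ck n (D i)"
  shows "Ck (Suc n) \<phi>"
proof -
  have "partial i \<phi> = D i" for i using assms(2) by (rule partial_eqI)
  then show ?thesis using assms by simp
qed

lemma Ck_Suc: "Ck (Suc n) \<phi> \<Longrightarrow> Ck n \<phi>"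
proof (induction n arbitrary: \<phi>)
  case (Suc n)
  then show ?case by (metis Ck.simps(2))
qed auto

lemma foldr_partial_snoc: "foldr partial (is @ [i]) \<phi> = foldr partial is (partial i \<phi>)"
  by simp

text \<open>\<open>foldr partial\<close> acts with the last entry of the list innermost, so a list
  ending in \<open>i\<close> describes derivatives of \<open>partial i \<phi>\<close>. Lists are
  therefore split at their end.\<close>

lemma smooth3_iff:
  "smooth3 \<phi> \<longleftrightarrow> continuous_on UNIV \<phi> \<and> (\<forall>i. has_partial i \<phi> (partial i \<phi>)) \<and>
     (\<forall>i. smooth3 (partial i \<phi>))"
proof
  assume s: "smooth3 \<phi>"
  have "continuous_on UNIV \<phi>" "\<forall>i x. (\<lambda>t. \<phi> (x + t *\<^sub>R axis i 1)) differentiable (at 0)"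
    using s[unfolded smooth3_def, rule_format, of "[]"] by auto
  moreover have "smooth3 (partial i \<phi>)" for i
    unfolding smooth3_def
  proof
    fix "is" show "continuous_on UNIV (foldr partial is (partial i \<phi>)) \<and>
      (\<forall>j x. (\<lambda>t. foldr partial is (partial i \<phi>) (x + t *\<^sub>R axis j 1)) differentiable (at 0))"
      using s[unfolded smooth3_def, rule_format, of "is @ [i]"] by simp
  qed
  ultimately show "continuous_on UNIV \<phi> \<and> (\<forall>i. has_partial i \<phi> (partial i \<phi>)) \<and>
     (\<forall>i. smooth3 (partial i \<phi>))"
    unfolding has_partial_def partial_def
    by (auto simp: DERIV_deriv_iff_real_differentiable)
next
  assume A: "continuous_on UNIV \<phi> \<and> (\<forall>i. has_partial i \<phi> (partial i \<phi>)) \<and>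
     (\<forall>i. smooth3 (partial i \<phi>))"
  show "smooth3 \<phi>"
    unfolding smooth3_def
  proof
    fix js :: "3 list"
    show "continuous_on UNIV (foldr partial js \<phi>) \<and>
      (\<forall>j x. (\<lambda>t. foldr partial js \<phi> (x + t *\<^sub>R axis j 1)) differentiable (at 0))"
    proof (cases js rule: rev_cases)
      case Nil
      then show ?thesis using A by (auto simp: has_partial_def real_differentiable_def)
    next
      case (snoc ks i)
      have "smooth3 (partial i \<phi>)" using A by blast
      then show ?thesis unfolding snoc foldr_partial_snoc smooth3_def by blast
    qed
  qed
qed

lemma smooth3_iff_Ck: "smooth3 \<phi> \<longleftrightarrow> (\<forall>n. Ck n \<phi>)"
proof
  show "\<forall>n. Ck n \<phi>" if "smooth3 \<phi>"
  proof
    fix n show "Ck n \<phi>" using that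
    proof (induction n arbitrary: \<phi>)
      case 0
      then show ?case by (simp add: smooth3_iff[THEN iffD1])
    next
      case (Suc n)
      then show ?case by (simp add: smooth3_iff[THEN iffD1])
    qed
  qed
next
  assume C: "\<forall>n. Ck n \<phi>"
  have "(\<forall>n. Ck n \<phi>) \<Longrightarrow> continuous_on UNIV (foldr partial js \<phi>) \<and>
      (\<forall>j x. (\<lambda>t. foldr partial js \<phi> (x + t *\<^sub>R axis j 1)) differentiable (at 0))" for js
  proof (induction js arbitrary: \<phi> rule: rev_induct)
    case Nil
    then have "Ck (Suc 0) \<phi>" by blast
    then show ?case by (auto simp: has_partial_def real_differentiable_def)
  next
    case (snoc i js)
    have "\<forall>n. Ck n (partial i \<phi>)" using snoc.prems Ck.simps(2) by blast
    then show ?case using snoc.IH unfolding foldr_partial_snoc by blast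
  qed
  then show "smooth3 \<phi>" using C unfolding smooth3_def by blast
qed

lemma smooth3_continuous: "smooth3 \<phi> \<Longrightarrow> continuous_on UNIV \<phi>"
  using smooth3_iff by blast

lemma smooth3_has_partial: "smooth3 \<phi> \<Longrightarrow> has_partial i \<phi> (partial i \<phi>)"
  using smooth3_iff by blast

lemma smooth3_partial [intro]: "smooth3 \<phi> \<Longrightarrow> smooth3 (partial i \<phi>)"
  using smooth3_iff by blast

lemma has_partial_const: "has_partial i (\<lambda>_. c) (\<lambda>_. 0)"
  by (simp add: has_partial_def)

lemma has_partial_nth: "has_partial i (\<lambda>y. y $ j) (\<lambda>_. if i = j then 1 else 0)"
  by (auto simp: has_partial_def axis_def intro!: derivative_eq_intros)

lemma has_partial_add:
  "has_partial i f f' \<Longrightarrow> has_partial i g g' \<Longrightarrow> has_partial i (\<lambda>y. f y + g y) (\<lambda>y. f' y + g' y)"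
  unfolding has_partial_def by (auto intro!: derivative_eq_intros)

lemma has_partial_mult:
  "has_partial i f f' \<Longrightarrow> has_partial i g g' \<Longrightarrow>
    has_partial i (\<lambda>y. f y * g y) (\<lambda>y. f y * g' y + f' y * g y)"
  unfolding has_partial_def by (auto intro!: derivative_eq_intros)

lemma has_partial_comp:
  assumes "has_partial i f f'" and "\<And>y. (g has_real_derivative g' (f y)) (at (f y))"
  shows "has_partial i (\<lambda>y. g (f y)) (\<lambda>y. g' (f y) * f' y)"
  unfolding has_partial_def
proof
  fix x
  have "((\<lambda>t. f (x + t *\<^sub>R axis i 1)) has_real_derivative f' x) (at 0)"
    using assms(1) by (simp add: has_partial_def)
  moreover have "(g has_real_derivative g' (f x)) (at (f (x + 0 *\<^sub>R axis i 1)))"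
    using assms(2) by simp
  ultimately show "((\<lambda>t. g (f (x + t *\<^sub>R axis i 1))) has_real_derivative g' (f x) * f' x) (at 0)"
    by (rule DERIV_chain2[rotated])
qed

lemma Ck_const: "Ck n (\<lambda>_. c)"
proof (induction n arbitrary: c)
  case (Suc n)
  show ?case by (rule CkI[OF _ has_partial_const]) (auto simp: Suc)
qed auto

lemma Ck_nth: "Ck n (\<lambda>y. y $ j)"
proof (cases n)
  case (Suc m)
  have "Ck m (\<lambda>_. if i = j then 1 else 0)" for i by (rule Ck_const)
  then show ?thesis unfolding Suc
    by (intro CkI[OF _ has_partial_nth]) (auto intro!: continuous_intros)
qed (auto intro!: continuous_intros)

lemma Ck_add: "Ck n f \<Longrightarrow> Ck n g \<Longrightarrow> Ck n (\<lambda>y. f y + g y)"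
proof (induction n arbitrary: f g)
  case (Suc n)
  then show ?case
    by (intro CkI[where D = "\<lambda>i y. partial i f y + partial i g y"] has_partial_add continuous_intros)
       auto
qed (auto intro!: continuous_intros)

lemma Ck_mult: "Ck n f \<Longrightarrow> Ck n g \<Longrightarrow> Ck n (\<lambda>y. f y * g y)"
proof (induction n arbitrary: f g)
  case (Suc n)
  have "Ck n f" "Ck n g" using Suc.prems Ck_Suc by blast+
  then have "Ck n (\<lambda>y. f y * partial i g y + partial i f y * g y)" for i
    using Suc by (intro Ck_add Suc.IH) auto
  then show ?case using Suc.prems
    by (intro CkI[where D = "\<lambda>i y. f y * partial i g y + partial i f y * g y"]
          has_partial_mult continuous_intros) auto
qed (auto intro!: continuous_intros)

text \<open>The outer function ranges over a family \<open>\<G>\<close> closed under differentiation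
  on \<open>S\<close>, so the induction passes from \<open>g\<close> to \<open>g'\<close> without
  formulas for higher derivatives. It is applied to multiples of powers and to the functions
  \<open>flat c p\<close>.\<close>

lemma Ck_comp:
  assumes "\<And>g. g \<in> \<G> \<Longrightarrow> \<exists>g'\<in>\<G>. \<forall>t\<in>S. (g has_real_derivative g' t) (at t)"
    and "\<And>y. f y \<in> S"
  shows "g \<in> \<G> \<Longrightarrow> Ck n f \<Longrightarrow> Ck n (\<lambda>y. g (f y))"
proof (induction n arbitrary: g)
  case 0
  obtain g' where "\<forall>t\<in>S. (g has_real_derivative g' t) (at t)" using assms(1)[OF 0(1)] by blast
  then have "continuous_on S g"
    using DERIV_isCont continuous_at_imp_continuous_on by blast
  then show ?case using 0 assms(2)
    by (auto intro!: continuous_on_compose2[of S g])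
next
  case (Suc n)
  obtain g' where g': "g' \<in> \<G>" "\<forall>t\<in>S. (g has_real_derivative g' t) (at t)"
    using assms(1)[OF Suc.prems(1)] by blast
  then have "continuous_on S g"
    using DERIV_isCont continuous_at_imp_continuous_on by blast
  moreover have "Ck n (\<lambda>y. g' (f y) * partial i f y)" for i
    using Suc.prems(2) by (intro Ck_mult[OF Suc.IH[OF g'(1) Ck_Suc[OF Suc.prems(2)]]]) simp
  moreover have "has_partial i (\<lambda>y. g (f y)) (\<lambda>y. g' (f y) * partial i f y)" for i
    using Suc.prems(2) g'(2) assms(2) by (intro has_partial_comp) auto
  moreover have "continuous_on UNIV (\<lambda>y. g (f y))"
    using continuous_on_compose2[OF \<open>continuous_on S g\<close> Ck_continuous[OF Suc.prems(2)]] assms(2)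
    by blast
  ultimately show ?case by (intro CkI)
qed

lemma smooth3_const: "smooth3 (\<lambda>_. c)"
  and smooth3_nth: "smooth3 (\<lambda>y. y $ j)"
  and smooth3_add: "smooth3 f \<Longrightarrow> smooth3 g \<Longrightarrow> smooth3 (\<lambda>y. f y + g y)"
  and smooth3_mult: "smooth3 f \<Longrightarrow> smooth3 g \<Longrightarrow> smooth3 (\<lambda>y. f y * g y)"
  by (auto simp: smooth3_iff_Ck Ck_const Ck_nth Ck_add Ck_mult)

lemma smooth3_comp:
  assumes "\<And>g. g \<in> \<G> \<Longrightarrow> \<exists>g'\<in>\<G>. \<forall>t\<in>S. (g has_real_derivative g' t) (at t)"
    and "\<And>y. f y \<in> S" "g \<in> \<G>" "smooth3 f"
  shows "smooth3 (\<lambda>y. g (f y))"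
  using assms Ck_comp[of \<G> S f] by (simp add: smooth3_iff_Ck)

lemma smooth3_diff: "smooth3 f \<Longrightarrow> smooth3 g \<Longrightarrow> smooth3 (\<lambda>y. f y - g y)"
  using smooth3_add[OF _ smooth3_mult[OF smooth3_const[of "-1"]], of f g] by simp

lemma smooth3_sum: "(\<And>i. i \<in> I \<Longrightarrow> smooth3 (f i)) \<Longrightarrow> smooth3 (\<lambda>y. \<Sum>i\<in>I. f i y)"
  by (induction I rule: infinite_finite_induct) (auto intro: smooth3_add smooth3_const)

lemma smooth3_inner: "smooth3 (\<lambda>y. \<beta> \<bullet> y)"
  unfolding inner_vec_def by (auto intro!: smooth3_sum smooth3_mult smooth3_const smooth3_nth)

lemma smooth3_norm_sq: "smooth3 (\<lambda>y. (norm y)\<^sup>2)"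
  unfolding power2_norm_eq_inner inner_vec_def inner_real_def
  by (auto intro!: smooth3_sum smooth3_mult smooth3_nth)

lemma smooth3_powr:
  assumes f: "smooth3 f" "\<And>y. f y > 0"
  shows "smooth3 (\<lambda>y. f y powr \<sigma>)"
proof (rule smooth3_comp[where g = "\<lambda>t. t powr \<sigma>" and f = f and \<G> = "{\<lambda>t. a * t powr b |a b. True}" and S = "{0<..}"])
  fix g :: "real \<Rightarrow> real" assume "g \<in> {\<lambda>t. a * t powr b |a b. True}"
  then obtain a b where g: "g = (\<lambda>t. a * t powr b)" by blast
  have "\<forall>t\<in>{0<..}. (g has_real_derivative (a * b) * t powr (b - 1)) (at t)"
    unfolding g by (auto intro!: derivative_eq_intros simp: powr_diff field_simps)
  then show "\<exists>g'\<in>{\<lambda>t. a * t powr b |a b. True}. \<forall>t\<in>{0<..}. (g has_real_derivative g' t) (at t)"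
    by (intro bexI[of _ "\<lambda>t. (a * b) * t powr (b - 1)"]) auto
next
  show "(\<lambda>t. t powr \<sigma>) \<in> {\<lambda>t. a * t powr b |a b. True}"
    by (rule CollectI, rule exI[of _ 1], rule exI[of _ \<sigma>]) simp
qed (use f in simp_all)

definition lap :: "(real^3 \<Rightarrow> real) \<Rightarrow> real^3 \<Rightarrow> real" where
  "lap \<phi> y = (\<Sum>i\<in>UNIV. partial i (partial i \<phi>) y)"

definition gradp :: "(real^3 \<Rightarrow> real) \<Rightarrow> (real^3 \<Rightarrow> real) \<Rightarrow> real^3 \<Rightarrow> real" where
  "gradp f g y = (\<Sum>i\<in>UNIV. partial i f y * partial i g y)"

lemma smooth3_lap: "smooth3 \<phi> \<Longrightarrow> smooth3 (lap \<phi>)"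
  unfolding lap_def[abs_def] by (intro smooth3_sum smooth3_partial)

lemma partial_add:
  "smooth3 f \<Longrightarrow> smooth3 g \<Longrightarrow> partial i (\<lambda>y. f y + g y) = (\<lambda>y. partial i f y + partial i g y)"
  by (intro partial_eqI has_partial_add smooth3_has_partial)

lemma partial_mult:
  "smooth3 f \<Longrightarrow> smooth3 g \<Longrightarrow>
    partial i (\<lambda>y. f y * g y) = (\<lambda>y. f y * partial i g y + partial i f y * g y)"
  by (intro partial_eqI has_partial_mult smooth3_has_partial)

lemma partial_const: "partial i (\<lambda>_. c) = (\<lambda>_. 0)"
  by (intro partial_eqI has_partial_const)

lemma partial_cmult: "smooth3 f \<Longrightarrow> partial i (\<lambda>y. c * f y) = (\<lambda>y. c * partial i f y)"
  by (simp add: partial_mult smooth3_const partial_const)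

lemma partial_diff:
  "smooth3 f \<Longrightarrow> smooth3 g \<Longrightarrow> partial i (\<lambda>y. f y - g y) = (\<lambda>y. partial i f y - partial i g y)"
  using partial_add[of f "\<lambda>y. -1 * g y" i] partial_cmult[of g i "-1"]
    smooth3_mult[OF smooth3_const[of "-1"], of g] by simp

lemma partial_comp:
  assumes "smooth3 f" and "\<And>y. (g has_real_derivative g' (f y)) (at (f y))"
  shows "partial i (\<lambda>y. g (f y)) = (\<lambda>y. g' (f y) * partial i f y)"
  using assms by (intro partial_eqI has_partial_comp smooth3_has_partial)

lemma lap_add: "smooth3 f \<Longrightarrow> smooth3 g \<Longrightarrow> lap (\<lambda>y. f y + g y) y = lap f y + lap g y"
  by (simp add: lap_def partial_add smooth3_partial sum.distrib)

lemma lap_diff: "smooth3 f \<Longrightarrow> smooth3 g \<Longrightarrow> lap (\<lambda>y. f y - g y) y = lap f y - lap g y"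
  by (simp add: lap_def partial_diff smooth3_partial sum_subtractf)

lemma lap_cmult: "smooth3 f \<Longrightarrow> lap (\<lambda>y. c * f y) y = c * lap f y"
  by (simp add: lap_def partial_cmult smooth3_partial sum_distrib_left)

lemma lap_mult:
  assumes f: "smooth3 f" and g: "smooth3 g"
  shows "lap (\<lambda>y. f y * g y) y = f y * lap g y + 2 * gradp f g y + g y * lap f y"
proof -
  have "partial i (partial i (\<lambda>y. f y * g y)) y =
     f y * partial i (partial i g) y + 2 * (partial i f y * partial i g y)
     + g y * partial i (partial i f) y" for i
    using f g by (simp add: partial_mult partial_add smooth3_mult smooth3_partial algebra_simps)
  then show ?thesis
    by (simp add: lap_def gradp_def sum.distrib sum_distrib_left)
qed

lemma partial_partial_comp:
  assumes f: "smooth3 f"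
    and "\<And>y. (g has_real_derivative g' (f y)) (at (f y))"
    and "\<And>y. (g' has_real_derivative g'' (f y)) (at (f y))"
  shows "partial i (partial i (\<lambda>y. g (f y))) y =
    g'' (f y) * (partial i f y * partial i f y) + g' (f y) * partial i (partial i f) y"
proof -
  have "has_partial i (partial i (\<lambda>y. g (f y)))
     (\<lambda>y. g' (f y) * partial i (partial i f) y + (g'' (f y) * partial i f y) * partial i f y)"
    unfolding partial_comp[OF f assms(2)] using assms(3) f
    by (intro has_partial_mult has_partial_comp smooth3_has_partial smooth3_partial)
  from partial_eqI[OF this] show ?thesis by (simp add: algebra_simps)
qed

lemma lap_comp:
  assumes f: "smooth3 f"
    and "\<And>y. (g has_real_derivative g' (f y)) (at (f y))"
    and "\<And>y. (g' has_real_derivative g'' (f y)) (at (f y))"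
  shows "lap (\<lambda>y. g (f y)) y = g'' (f y) * gradp f f y + g' (f y) * lap f y"
  unfolding lap_def gradp_def partial_partial_comp[OF assms]
  by (simp add: sum.distrib sum_distrib_left)

lemma gradp_comp_left:
  assumes "smooth3 f" and "\<And>y. (g has_real_derivative g' (f y)) (at (f y))"
  shows "gradp (\<lambda>y. g (f y)) h y = g' (f y) * gradp f h y"
  by (simp add: gradp_def partial_comp[OF assms] sum_distrib_left algebra_simps)

lemma gradp_commute: "gradp f g y = gradp g f y"
  by (simp add: gradp_def mult.commute)

section \<open>Integration over three-dimensional space\<close>

definition bdd_support :: "(real^3 \<Rightarrow> real) \<Rightarrow> bool" where
  "bdd_support \<phi> \<longleftrightarrow> (\<exists>R. \<forall>y. norm y > R \<longrightarrow> \<phi> y = 0)"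

lemma bdd_support_mult: "bdd_support f \<Longrightarrow> bdd_support (\<lambda>y. g y * f y)"
  unfolding bdd_support_def by (metis mult_zero_right)

lemma bdd_support_add:
  assumes "bdd_support f" "bdd_support g" shows "bdd_support (\<lambda>y. f y + g y)"
proof -
  obtain R S where "\<forall>y. norm y > R \<longrightarrow> f y = 0" "\<forall>y. norm y > S \<longrightarrow> g y = 0"
    using assms unfolding bdd_support_def by blast
  then show ?thesis unfolding bdd_support_def by (intro exI[of _ "max R S"]) simp
qed

lemma partial_zero_on_open:
  assumes "open S" "\<And>y. y \<in> S \<Longrightarrow> \<phi> y = 0" "x \<in> S"
  shows "partial i \<phi> x = 0"
proof -
  have "((\<lambda>t. x + t *\<^sub>R axis i 1) \<longlongrightarrow> x + 0 *\<^sub>R axis i 1) (at (0::real))"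
    by (intro tendsto_intros)
  then have "eventually (\<lambda>t. x + t *\<^sub>R axis i 1 \<in> S) (at (0::real))"
    using assms(1,3) by (auto simp: tendsto_def)
  then have "eventually (\<lambda>t. \<phi> (x + t *\<^sub>R axis i 1) = 0) (nhds (0::real))"
    using assms by (auto simp: eventually_at_filter elim!: eventually_mono)
  then have "((\<lambda>t. \<phi> (x + t *\<^sub>R axis i 1)) has_real_derivative 0) (at 0)"
    by (subst DERIV_cong_ev[OF refl _ refl, of _ "\<lambda>_. 0"]) auto
  then show ?thesis unfolding partial_def by (rule DERIV_imp_deriv)
qed

lemma partial_zero_outside:
  assumes "\<And>y. norm y > R \<Longrightarrow> \<phi> y = 0" "norm x > R"
  shows "partial i \<phi> x = 0"
proof (rule partial_zero_on_open)
  show "open {y::real^3. R < norm y}" by (intro open_Collect_less continuous_intros)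
qed (use assms in auto)

lemma bdd_support_partial: "bdd_support f \<Longrightarrow> bdd_support (partial i f)"
  unfolding bdd_support_def using partial_zero_outside by metis

lemma bdd_support_integrable:
  assumes "continuous_on UNIV f" "bdd_support f"
  shows "integrable lborel f"
proof -
  obtain R where R: "\<And>y. norm y > R \<Longrightarrow> f y = 0" using assms(2) unfolding bdd_support_def by blast
  have "integrable lborel (\<lambda>x. indicator (cball 0 R) x *\<^sub>R f x)"
    using assms(1) by (intro borel_integrable_compact) (auto intro: continuous_on_subset)
  also have "(\<lambda>x. indicator (cball 0 R) x *\<^sub>R f x) = f"
    using R by (auto simp: fun_eq_iff indicator_def not_le)
  finally show ?thesis .
qed

lemma bdd_support_bounded:
  assumes "continuous_on UNIV f" "bdd_support f"
  obtains M where "M \<ge> 0" "\<And>y. \<bar>f y\<bar> \<le> M"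
proof -
  obtain R where R: "\<And>y. norm y > R \<Longrightarrow> f y = 0" using assms(2) unfolding bdd_support_def by blast
  have "compact (f ` cball 0 R)" using assms(1)
    by (intro compact_continuous_image) (auto intro: continuous_on_subset)
  then have "bounded (f ` cball 0 R)" by (rule compact_imp_bounded)
  then obtain M where M: "\<forall>y\<in>cball 0 R. \<bar>f y\<bar> \<le> M"
    unfolding bounded_iff by auto
  have "\<bar>f y\<bar> \<le> max M 0" for y
    using M R[of y] by (cases "norm y \<le> R") force+
  then show ?thesis using that[of "max M 0"] by auto
qed

lemma lborel_integral_translation:
  fixes f :: "'a::euclidean_space \<Rightarrow> real"
  assumes "f \<in> borel_measurable borel"
  shows "(\<integral>y. f (c + y) \<partial>lborel) = (\<integral>y. f y \<partial>lborel)"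
  using integral_distr[of "(+) c" lborel borel f] assms by (simp add: lborel_distr_plus)

text \<open>Translation invariance makes the integral of every difference quotient vanish. The mean
  value theorem bounds the quotients uniformly, and dominated convergence passes to the
  derivative.\<close>

lemma integral_partial_eq_0:
  assumes s: "smooth3 \<phi>" and b: "bdd_support \<phi>"
  shows "(\<integral>y. partial i \<phi> y \<partial>lborel) = 0"
proof -
  obtain R where R: "\<And>y. norm y > R \<Longrightarrow> \<phi> y = 0" using b unfolding bdd_support_def by blast
  define e :: "real^3" where "e = axis i 1"
  have ne: "norm e = 1" by (simp add: e_def)
  have cp: "continuous_on UNIV (partial i \<phi>)" "continuous_on UNIV \<phi>"
    using s by (auto intro: smooth3_continuous)
  obtain M where M: "M \<ge> 0" "\<And>y. \<bar>partial i \<phi> y\<bar> \<le> M"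
    using bdd_support_bounded[OF cp(1) bdd_support_partial[OF b]] by blast
  define q where "q n y = (\<phi> (y + inverse (Suc n) *\<^sub>R e) - \<phi> y) / inverse (Suc n)" for n y
  have [measurable]: "\<phi> \<in> borel_measurable borel" "partial i \<phi> \<in> borel_measurable borel"
    using cp by (auto intro: borel_measurable_continuous_onI)
  have der: "((\<lambda>t. \<phi> (y + t *\<^sub>R e)) has_real_derivative partial i \<phi> (y + t *\<^sub>R e)) (at t)" for y t
  proof -
    have "((\<lambda>r. \<phi> ((y + t *\<^sub>R e) + r *\<^sub>R e)) has_real_derivative partial i \<phi> (y + t *\<^sub>R e)) (at 0)"
      using smooth3_has_partial[OF s, of i] unfolding has_partial_def e_def by blast
    then have "((\<lambda>r. \<phi> (y + (r + t) *\<^sub>R e)) has_real_derivative partial i \<phi> (y + t *\<^sub>R e)) (at 0)"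
      by (simp add: algebra_simps)
    then show ?thesis
      using DERIV_shift[of "\<lambda>r. \<phi> (y + r *\<^sub>R e)" _ 0 t] by simp
  qed
  have lim: "(\<lambda>n. q n y) \<longlonglongrightarrow> partial i \<phi> y" for y
  proof -
    have "((\<lambda>t. (\<phi> (y + t *\<^sub>R e) - \<phi> y) / t) \<longlongrightarrow> partial i \<phi> y) (at 0)"
      using der[of y 0] by (simp add: DERIV_def)
    moreover have "filterlim (\<lambda>n. inverse (real (Suc n))) (at 0) sequentially"
      using LIMSEQ_inverse_real_of_nat by (auto simp: filterlim_at)
    ultimately show ?thesis unfolding q_def by (rule filterlim_compose)
  qed
  \<comment> \<open>The increments have length at most 1, so every quotient vanishes outside the
    ball of radius \<open>R + 1\<close>.\<close>
  have bound: "\<bar>q n y\<bar> \<le> indicator (cball 0 (R + 1)) y * M" for n y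
  proof (cases "norm y \<le> R + 1")
    case True
    define t where "t = inverse (real (Suc n))"
    have t: "t > 0" by (simp add: t_def)
    obtain z where "\<phi> (y + t *\<^sub>R e) - \<phi> (y + 0 *\<^sub>R e) = (t - 0) * partial i \<phi> (y + z *\<^sub>R e)"
      using MVT2[OF t der] by blast
    then have "q n y = partial i \<phi> (y + z *\<^sub>R e)"
      using t by (simp add: q_def t_def[symmetric] del: of_nat_Suc)
    then show ?thesis using True M by (simp add: indicator_def)
  next
    case False
    have t: "inverse (real (Suc n)) \<le> 1" by (simp add: field_simps)
    have "norm (y + inverse (Suc n) *\<^sub>R e) \<ge> norm y - norm (inverse (Suc n) *\<^sub>R e)"
      by (rule norm_diff_ineq)
    then have "norm (y + inverse (Suc n) *\<^sub>R e) > R" using False t ne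
      by (simp del: of_nat_Suc add: not_le)
    then show ?thesis using False R unfolding q_def by (simp add: indicator_def not_le)
  qed
  have i\<phi>: "integrable lborel \<phi>" by (rule bdd_support_integrable[OF cp(2) b])
  have "(\<lambda>n. \<integral>y. q n y \<partial>lborel) \<longlonglongrightarrow> (\<integral>y. partial i \<phi> y \<partial>lborel)"
  proof (rule integral_dominated_convergence)
    show "integrable lborel (\<lambda>y. indicator (cball 0 (R + 1)) y * M)"
      using borel_integrable_compact[OF compact_cball continuous_on_const, of 0 "R + 1" M]
      unfolding real_scaleR_def .
  qed (use lim bound in \<open>auto simp: q_def\<close>)
  moreover have "(\<integral>y. q n y \<partial>lborel) = 0" for n
  proof -
    have "integrable lborel (\<lambda>y. \<phi> (c + y))" for c
      using i\<phi> integrable_distr_eq[of "(+) c" lborel borel \<phi>] by (simp add: lborel_distr_plus)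
    from this[of "inverse (Suc n) *\<^sub>R e"]
    have "integrable lborel (\<lambda>y. \<phi> (y + inverse (Suc n) *\<^sub>R e))" by (simp add: add.commute)
    moreover have "(\<integral>y. \<phi> (y + inverse (Suc n) *\<^sub>R e) \<partial>lborel) = (\<integral>y. \<phi> y \<partial>lborel)"
      using lborel_integral_translation[of \<phi> "inverse (Suc n) *\<^sub>R e"] by (simp add: add.commute)
    ultimately show ?thesis using i\<phi> unfolding q_def by simp
  qed
  ultimately show ?thesis by (simp add: LIMSEQ_const_iff)
qed

lemma bdd_support_diff:
  "bdd_support f \<Longrightarrow> bdd_support g \<Longrightarrow> bdd_support (\<lambda>y. f y - g y)"
  using bdd_support_add[of f "\<lambda>y. -1 * g y"] bdd_support_mult[of g "\<lambda>_. -1"] by simp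

lemma smooth3_borel: "smooth3 f \<Longrightarrow> f \<in> borel_measurable borel"
  by (intro borel_measurable_continuous_onI smooth3_continuous)

lemma bdd_support_lap: "bdd_support f \<Longrightarrow> bdd_support (lap f)"
  unfolding lap_def[abs_def] UNIV_3
  by (simp add: bdd_support_add bdd_support_partial)

lemma smooth3_integrable: "smooth3 f \<Longrightarrow> bdd_support f \<Longrightarrow> integrable lborel f"
  by (intro bdd_support_integrable smooth3_continuous)

text \<open>The two integrands differ by the derivative of a single function \<open>X\<close> of
  bounded support, so both integrations by parts collapse into one vanishing integral.\<close>

lemma integral_by_parts_twice:
  assumes f: "smooth3 f" "bdd_support f" and g: "smooth3 g"
  shows "(\<integral>y. g y * partial i (partial i f) y \<partial>lborel) = (\<integral>y. partial i (partial i g) y * f y \<partial>lborel)"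
proof -
  define X where "X y = g y * partial i f y - partial i g y * f y" for y
  have X: "smooth3 X" "bdd_support X"
    unfolding X_def[abs_def] using f g
    by (auto intro!: smooth3_diff smooth3_mult bdd_support_diff bdd_support_mult bdd_support_partial)
  have "partial i X y = g y * partial i (partial i f) y - partial i (partial i g) y * f y" for y
    unfolding X_def[abs_def] using f g
    by (simp add: partial_diff partial_mult smooth3_mult smooth3_partial algebra_simps)
  then have "(\<integral>y. g y * partial i (partial i f) y - partial i (partial i g) y * f y \<partial>lborel) = 0"
    using integral_partial_eq_0[OF X, of i] by simp
  moreover have "integrable lborel (\<lambda>y. g y * partial i (partial i f) y)"
      "integrable lborel (\<lambda>y. partial i (partial i g) y * f y)"
    using f g by (auto intro!: smooth3_integrable smooth3_mult bdd_support_mult bdd_support_partial)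
  ultimately show ?thesis by simp
qed

theorem green_identity:
  assumes f: "smooth3 f" "bdd_support f" and g: "smooth3 g"
  shows "(\<integral>y. g y * lap f y \<partial>lborel) = (\<integral>y. lap g y * f y \<partial>lborel)"
proof -
  have "integrable lborel (\<lambda>y. g y * partial i (partial i f) y)"
      "integrable lborel (\<lambda>y. partial i (partial i g) y * f y)" for i
    using f g by (auto intro!: smooth3_integrable smooth3_mult bdd_support_mult bdd_support_partial)
  then show ?thesis
    using integral_by_parts_twice[OF f g]
    by (simp add: lap_def sum_distrib_left sum_distrib_right)
qed

subsection \<open>Reflections\<close>

text \<open>For a unit vector \<open>e\<close> this is the reflection in the plane
  \<open>y \<bullet> e = \<mu>\<close>.\<close>

definition mirror :: "real^3 \<Rightarrow> real \<Rightarrow> real^3 \<Rightarrow> real^3" where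
  "mirror e \<mu> y = y - (2 * (y \<bullet> e - \<mu>)) *\<^sub>R e"

lemma mirror_inner: "norm e = 1 \<Longrightarrow> mirror e \<mu> y \<bullet> e = 2 * \<mu> - y \<bullet> e"
  unfolding mirror_def by (simp add: inner_diff_left power2_norm_eq_inner[symmetric])

lemma mirror_mirror: "norm e = 1 \<Longrightarrow> mirror e \<mu> (mirror e \<mu> y) = y"
  by (simp add: mirror_def[of e \<mu> "mirror e \<mu> y"] mirror_inner) (simp add: mirror_def algebra_simps)

lemma norm_mirror_sq:
  assumes "norm e = 1"
  shows "(norm (mirror e \<mu> y))\<^sup>2 = (norm y)\<^sup>2 - 4 * \<mu> * (y \<bullet> e - \<mu>)"
proof -
  have "e \<bullet> e = 1" using assms by (simp add: power2_norm_eq_inner[symmetric])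
  then show ?thesis
    unfolding mirror_def power2_norm_eq_inner
    by (simp add: inner_diff_left inner_diff_right inner_commute[of e y] algebra_simps power2_eq_square)
qed

lemma norm_diff_mirror: "norm e = 1 \<Longrightarrow> norm (y - mirror e \<mu> y) = 2 * \<bar>y \<bullet> e - \<mu>\<bar>"
  by (simp add: mirror_def abs_if)

text \<open>The sign of the added product tells whether \<open>x\<close> and \<open>y\<close> lie on
  the same side of the plane, and hence whether reflecting \<open>x\<close> moves it away from
  \<open>y\<close> or towards it.\<close>

lemma dist_mirror_sq:
  assumes "norm e = 1"
  shows "(norm (mirror e \<mu> x - y))\<^sup>2 = (norm (x - y))\<^sup>2 + 4 * (x \<bullet> e - \<mu>) * (y \<bullet> e - \<mu>)"
proof -
  have "e \<bullet> e = 1" using assms by (simp add: power2_norm_eq_inner[symmetric])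
  then show ?thesis
    unfolding mirror_def power2_norm_eq_inner
    by (simp add: inner_diff_left inner_diff_right inner_commute[of e x] inner_commute[of e y]
        inner_commute[of y x] algebra_simps power2_eq_square)
qed

lemma dist_mirror_mirror:
  assumes "norm e = 1"
  shows "norm (mirror e \<mu> x - mirror e \<mu> y) = norm (x - y)"
proof -
  have "(norm (mirror e \<mu> x - mirror e \<mu> y))\<^sup>2 = (norm (x - y))\<^sup>2"
    using dist_mirror_sq[OF assms, of \<mu> x "mirror e \<mu> y"] dist_mirror_sq[OF assms, of \<mu> y x] assms
    by (simp add: mirror_inner norm_minus_commute[of _ x] algebra_simps)
  then show ?thesis by simp
qed

text \<open>The reflection in the parallel plane through the origin is orthogonal and preserves the
  measure of boxes, which determines \<open>lborel\<close>. A translation accounts for a general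
  \<open>\<mu>\<close>.\<close>

lemma lborel_distr_mirror:
  assumes e: "norm e = 1"
  shows "distr lborel borel (mirror e \<mu>) = lborel"
proof -
  define L where "L = mirror e 0"
  have L: "orthogonal_transformation L"
    unfolding orthogonal_transformation_def
  proof
    show "linear L" unfolding L_def mirror_def
      by (rule linearI) (simp_all add: algebra_simps inner_add_left)
    have "e \<bullet> e = 1" using e by (simp add: power2_norm_eq_inner[symmetric])
    then have "L v \<bullet> L w = v \<bullet> w" for v w
      unfolding L_def mirror_def
      by (simp add: inner_diff_left inner_diff_right inner_commute[of e w] algebra_simps)
    then show "\<forall>v w. L v \<bullet> L w = v \<bullet> w" by blast
  qed
  have LL: "L (L y) = y" for y unfolding L_def by (rule mirror_mirror[OF e])
  have [measurable]: "L \<in> borel_measurable borel"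
    using L by (intro borel_measurable_continuous_onI linear_continuous_on)
      (simp add: orthogonal_transformation_linear linear_conv_bounded_linear[symmetric])
  have D: "lborel = distr lborel borel L"
  proof (rule lborel_eqI)
    fix l u :: "real^3" assume le: "\<And>b. b \<in> Basis \<Longrightarrow> l \<bullet> b \<le> u \<bullet> b"
    have pre: "L -` box l u = L ` box l u"
    proof (intro equalityI subsetI)
      fix y assume "y \<in> L -` box l u"
      then have "L y \<in> box l u" by simp
      then have "L (L y) \<in> L ` box l u" by (rule imageI)
      then show "y \<in> L ` box l u" by (simp add: LL)
    next
      fix y assume "y \<in> L ` box l u"
      then show "y \<in> L -` box l u" by (auto simp: LL)
    qed
    have LM: "L ` box l u \<in> lmeasurable" "measure lebesgue (L ` box l u) = measure lebesgue (box l u)"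
      using measurable_orthogonal_image[OF L] measure_orthogonal_image[OF L] by auto
    have bor: "L ` box l u \<in> sets borel" unfolding pre[symmetric]
      using measurable_sets[of L borel borel "box l u"] by simp
    have "emeasure (distr lborel borel L) (box l u) = emeasure lborel (L ` box l u)"
      by (simp add: emeasure_distr pre)
    also have "\<dots> = emeasure lebesgue (L ` box l u)" using bor by simp
    also have "\<dots> = ennreal (measure lebesgue (box l u))"
      using LM by (simp add: emeasure_eq_measure2)
    also have "\<dots> = emeasure lborel (box l u)"
      by (simp add: emeasure_eq_measure2)
    also have "\<dots> = ennreal (\<Prod>b\<in>Basis. (u - l) \<bullet> b)"
      using le by (simp add: emeasure_lborel_box)
    finally show "emeasure (distr lborel borel L) (box l u) = ennreal (\<Prod>b\<in>Basis. (u - l) \<bullet> b)" .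
  qed simp
  have "mirror e \<mu> = (+) ((2 * \<mu>) *\<^sub>R e) \<circ> L"
    by (auto simp: fun_eq_iff L_def mirror_def algebra_simps)
  then have "distr lborel borel (mirror e \<mu>) = distr (distr lborel borel L) borel ((+) ((2 * \<mu>) *\<^sub>R e))"
    by (simp add: distr_distr)
  also have "\<dots> = lborel" unfolding D[symmetric] by (rule lborel_distr_plus)
  finally show ?thesis .
qed

lemma mirror_borel [measurable]: "mirror e \<mu> \<in> borel_measurable borel"
  unfolding mirror_def[abs_def] by measurable

lemma integral_mirror:
  fixes f :: "real^3 \<Rightarrow> real"
  assumes "norm e = 1" "f \<in> borel_measurable borel"
  shows "(\<integral>y. f (mirror e \<mu> y) \<partial>lborel) = (\<integral>y. f y \<partial>lborel)"
    and "integrable lborel (\<lambda>y. f (mirror e \<mu> y)) \<longleftrightarrow> integrable lborel f"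
  using integral_distr[of "mirror e \<mu>" lborel borel f] integrable_distr_eq[of "mirror e \<mu>" lborel borel f]
    assms by (simp_all add: lborel_distr_mirror)

lemma ball_pred_borel [measurable]: "Measurable.pred borel (\<lambda>y::real^3. y \<in> ball c r)"
  by (simp add: pred_def)

section \<open>Integrability of radial kernels by comparison with dyadic balls\<close>

lemma nn_integral_weighted_balls:
  fixes c r :: "nat \<Rightarrow> real"
  assumes "\<And>k. c k \<ge> 0" "\<And>k. r k \<ge> 0" and s: "summable (\<lambda>k. c k * r k ^ 3)"
  shows "(\<integral>\<^sup>+z. (\<Sum>k. ennreal (c k) * indicator (ball (0::real^3) (r k)) z) \<partial>lborel) < \<infinity>"
proof -
  let ?V = "unit_ball_vol (real DIM(real^3))"
  have V: "?V \<ge> 0" by simp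
  have "(\<integral>\<^sup>+z. (\<Sum>k. ennreal (c k) * indicator (ball (0::real^3) (r k)) z) \<partial>lborel) =
     (\<Sum>k. \<integral>\<^sup>+z. ennreal (c k) * indicator (ball (0::real^3) (r k)) z \<partial>lborel)"
    by (intro nn_integral_suminf) measurable
  also have "\<dots> = (\<Sum>k. ennreal (?V * (c k * r k ^ 3)))"
  proof (rule suminf_cong)
    fix k
    have "(\<integral>\<^sup>+z. ennreal (c k) * indicator (ball (0::real^3) (r k)) z \<partial>lborel) =
       ennreal (c k) * emeasure lborel (ball (0::real^3) (r k))"
      by (simp add: nn_integral_cmult)
    also have "\<dots> = ennreal (?V * (c k * r k ^ 3))"
      using assms(1,2) V
      by (simp add: emeasure_ball ennreal_mult'[symmetric] mult_ac)
    finally show "(\<integral>\<^sup>+z. ennreal (c k) * indicator (ball (0::real^3) (r k)) z \<partial>lborel) =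
       ennreal (?V * (c k * r k ^ 3))" .
  qed
  also have "\<dots> = ennreal (\<Sum>k. ?V * (c k * r k ^ 3))"
    using assms V by (intro suminf_ennreal2 summable_mult) auto
  finally show ?thesis by simp
qed

text \<open>A discrete counterpart of polar coordinates: \<open>c k\<close> bounds \<open>f\<close>
  on the part of space attributed to the ball of radius \<open>r k\<close>, and the volume of that
  ball is proportional to \<open>r k ^ 3\<close>.\<close>

lemma integrable_weighted_balls:
  fixes c r :: "nat \<Rightarrow> real" and f :: "real^3 \<Rightarrow> real"
  assumes "\<And>k. c k \<ge> 0" "\<And>k. r k \<ge> 0" "summable (\<lambda>k. c k * r k ^ 3)"
    and f: "f \<in> borel_measurable borel" "\<And>z. f z \<ge> 0"
    and le: "\<And>z. f z > 0 \<Longrightarrow> \<exists>k. norm z < r k \<and> f z \<le> c k"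
  shows "integrable lborel f"
proof (rule integrableI_nonneg)
  have "ennreal (f z) \<le> (\<Sum>k. ennreal (c k) * indicator (ball (0::real^3) (r k)) z)" for z
  proof (cases "f z > 0")
    case True
    then obtain k where k: "norm z < r k" "f z \<le> c k" using le by blast
    then have "ennreal (f z) \<le> ennreal (c k) * indicator (ball (0::real^3) (r k)) z"
      by (simp add: ennreal_leI)
    also have "\<dots> = (\<Sum>j\<in>{k}. ennreal (c j) * indicator (ball (0::real^3) (r j)) z)"
      by (simp only: sum.insert finite.emptyI empty_iff not_False_eq_True sum.empty add_0_right)
    also have "\<dots> \<le> (\<Sum>k. ennreal (c k) * indicator (ball (0::real^3) (r k)) z)"
      by (rule sum_le_suminf) auto
    finally show ?thesis .
  qed (use f(2)[of z] in simp)
  then have "(\<integral>\<^sup>+z. ennreal (f z) \<partial>lborel) \<le>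
     (\<integral>\<^sup>+z. (\<Sum>k. ennreal (c k) * indicator (ball (0::real^3) (r k)) z) \<partial>lborel)"
    by (intro nn_integral_mono)
  also have "\<dots> < \<infinity>" using assms by (intro nn_integral_weighted_balls)
  finally show "(\<integral>\<^sup>+z. ennreal (f z) \<partial>lborel) < \<infinity>" .
qed (use f in auto)

text \<open>In dimension three it is integrable over the ball. Up to constants it controls both the
  increments of \<open>hker\<close> and the square of \<open>dker x\<close>.\<close>

definition invsq :: "real^3 \<Rightarrow> real^3 \<Rightarrow> real" where
  "invsq x y = 1 / (norm (x - y))\<^sup>2"

lemma invsq_nonneg [simp]: "invsq x y \<ge> 0"
  by (simp add: invsq_def)

lemma invsq_borel [measurable]: "invsq x \<in> borel_measurable borel"
  unfolding invsq_def[abs_def] by measurable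

lemma ball_borel_mult: "(\<lambda>y. indicator (ball (0::real^3) r) y * invsq x y) \<in> borel_measurable borel"
  by measurable

lemma invsq_integrable_ball2: "integrable lborel (\<lambda>y. indicator (ball 0 2) y * invsq 0 y)"
\<comment> \<open>On the shell between the radii \<open>(1/2) ^ k\<close> and
  \<open>2 * (1/2) ^ k\<close> the kernel is at most \<open>4 ^ k\<close>, while the volume decays
  like \<open>(1/8) ^ k\<close>; the series is geometric with ratio 1/2.\<close>
proof (rule integrable_weighted_balls[where c = "\<lambda>k. 4 ^ k" and r = "\<lambda>k. 2 * (1/2) ^ k"])
  have "(\<lambda>k. 4 ^ k * (2 * (1/2) ^ k) ^ 3) = (\<lambda>k. 8 * (1/2::real) ^ k)"
  proof
    fix k :: nat
    have "4 ^ k * ((1/2::real) ^ k) ^ 3 = 4 ^ k * ((1/2) ^ 3) ^ k"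
      by (simp add: power_mult[symmetric] mult.commute)
    also have "\<dots> = (4 * (1/2) ^ 3) ^ k" by (simp only: power_mult_distrib)
    also have "4 * (1/2::real) ^ 3 = 1/2" by (simp add: power3_eq_cube)
    finally show "4 ^ k * (2 * (1/2) ^ k) ^ 3 = 8 * (1/2::real) ^ k"
      by (simp add: power_mult_distrib)
  qed
  then show "summable (\<lambda>k. 4 ^ k * (2 * (1/2::real) ^ k) ^ 3)"
    by (simp add: summable_mult summable_geometric)
  fix z :: "real^3" assume z: "indicator (ball 0 2) z * invsq 0 z > 0"
  then have n: "norm z > 0" "norm z < 2"
    by (cases "norm z < 2"; auto simp: invsq_def)+
  define P where "P k \<longleftrightarrow> 2 * (1/2) ^ Suc k \<le> norm z" for k
  obtain k0 where "(1/2::real) ^ k0 < norm z / 2"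
    using real_arch_pow_inv[of "norm z / 2" "1/2"] n by auto
  moreover have "(0::real) \<le> (1/2) ^ k0" by simp
  moreover have "2 * (1/2::real) ^ Suc k0 = (1/2) ^ k0" by simp
  ultimately have "P k0" unfolding P_def by linarith
  define k where "k = (LEAST k. P k)"
  have Pk: "P k" unfolding k_def by (rule LeastI) fact
  have lt: "norm z < 2 * (1/2) ^ k"
  proof (cases k)
    case (Suc j)
    have "j < k" using Suc by simp
    then have "\<not> P j" unfolding k_def by (rule not_less_Least)
    then show ?thesis unfolding P_def Suc by simp
  qed (use n in simp)
  have "invsq 0 z \<le> 4 ^ k"
  proof -
    have le: "(1/2) ^ k \<le> norm z" using Pk by (simp add: P_def)
    have "((1/2) ^ k)\<^sup>2 \<le> (norm z)\<^sup>2" using le by (rule power_mono) simp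
    then have "1 / (norm z)\<^sup>2 \<le> 1 / ((1/2) ^ k)\<^sup>2"
      using n by (intro divide_left_mono) simp_all
    also have "\<dots> = 4 ^ k"
      by (simp add: power_divide power2_eq_square power_mult_distrib[symmetric])
    finally show ?thesis by (simp add: invsq_def)
  qed
  then show "\<exists>k. norm z < 2 * (1/2) ^ k \<and> indicator (ball 0 2) z * invsq 0 z \<le> 4 ^ k"
    using lt n by (intro exI[of _ k]) simp
qed auto

text \<open>The ball of radius 2 contains every translate of the unit ball by one of its points, so
  this number bounds the integral of \<open>invsq x\<close> uniformly in \<open>x\<close>.\<close>

definition invsq_bound :: real where
  "invsq_bound = (\<integral>y. indicator (ball (0::real^3) 2) y * invsq 0 y \<partial>lborel)"

lemma invsq_integrable:
  assumes "norm x < 1"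
  shows "integrable lborel (\<lambda>y. indicator (ball 0 1) y * invsq x y)"
    and "(\<integral>y. indicator (ball 0 1) y * invsq x y \<partial>lborel) \<le> invsq_bound"
proof -
  let ?f = "\<lambda>z. indicator (ball (0::real^3) 2) z * invsq 0 z"
  have fm: "?f \<in> borel_measurable borel" by (rule ball_borel_mult)
  have t: "integrable lborel (\<lambda>y. ?f (- x + y))"
    using integrable_distr_eq[of "(+) (- x)" lborel borel ?f] fm invsq_integrable_ball2
    unfolding lborel_distr_plus by simp
  have le: "indicator (ball 0 1) y * invsq x y \<le> ?f (- x + y)" for y
  proof (cases "norm y < 1")
    case True
    have "norm (y - x) \<le> norm y + norm x" by (rule norm_triangle_ineq4)
    then have "norm (- x + y) < 2" using True assms by simp
    then show ?thesis using True by (simp add: invsq_def norm_minus_commute)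
  qed simp
  show i: "integrable lborel (\<lambda>y. indicator (ball 0 1) y * invsq x y)"
  proof (rule Bochner_Integration.integrable_bound[OF t])
    show "AE y in lborel. norm (indicator (ball 0 1) y * invsq x y) \<le> norm (?f (- x + y))"
      using le by (intro AE_I2) (simp only: real_norm_def abs_mult abs_indicator abs_of_nonneg invsq_nonneg)
  qed measurable
  have "(\<integral>y. indicator (ball 0 1) y * invsq x y \<partial>lborel) \<le> (\<integral>y. ?f (- x + y) \<partial>lborel)"
    by (rule integral_mono[OF i t le])
  also have "\<dots> = invsq_bound" unfolding invsq_bound_def by (rule lborel_integral_translation[OF fm])
  finally show "(\<integral>y. indicator (ball 0 1) y * invsq x y \<partial>lborel) \<le> invsq_bound" .
qed

lemma invsq_bound_nonneg: "invsq_bound \<ge> 0"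
  unfolding invsq_bound_def by (intro Bochner_Integration.integral_nonneg) auto

text \<open>The Laplacian of the regularised Newton kernel
  \<open>(1 + (norm z)\<^sup>2) powr (-1/2)\<close> is -3 times this function.\<close>

definition bump :: "real^3 \<Rightarrow> real" where
  "bump z = (1 + (norm z)\<^sup>2) powr (-5/2)"

lemma bump_pos: "bump z > 0"
  using zero_le_power2[of "norm z"] by (simp add: bump_def add_nonneg_eq_0_iff)

lemma bump_borel [measurable]: "bump \<in> borel_measurable borel"
  unfolding bump_def[abs_def] by measurable

lemma bump_integrable: "integrable lborel bump"
\<comment> \<open>Where \<open>norm z\<close> is at least \<open>2 ^ j\<close> the bump is at most
  \<open>(1/32) ^ j\<close>. The index in use is \<open>k = j + 1\<close>, which explains the factor
  32.\<close>
proof (rule integrable_weighted_balls[where c = "\<lambda>k. 32 * (1/32) ^ k" and r = "\<lambda>k. 2 ^ k"])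
  have "(\<lambda>k. 32 * (1/32) ^ k * (2 ^ k) ^ 3) = (\<lambda>k. 32 * (1/4::real) ^ k)"
  proof
    fix k :: nat
    have "((2::real) ^ k) ^ 3 = (2 ^ 3) ^ k" by (metis power_mult mult.commute)
    then have "(1/32::real) ^ k * (2 ^ k) ^ 3 = (1/32) ^ k * (2 ^ 3) ^ k" by (simp only:)
    also have "\<dots> = ((1/32) * 2 ^ 3) ^ k" by (simp only: power_mult_distrib)
    finally show "32 * (1/32) ^ k * (2 ^ k) ^ 3 = 32 * (1/4::real) ^ k" by simp
  qed
  then show "summable (\<lambda>k. 32 * (1/32) ^ k * (2 ^ k) ^ 3 :: real)"
    by (simp add: summable_mult summable_geometric)
  fix z :: "real^3"
  obtain k0 where k0: "norm z < 2 ^ k0" using real_arch_pow[of 2 "norm z"] by auto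
  define k where "k = (LEAST k. norm z < 2 ^ k)"
  have lt: "norm z < 2 ^ k" unfolding k_def by (rule LeastI) fact
  have "bump z \<le> 32 * (1/32) ^ k"
  proof (cases k)
    case 0
    have "bump z \<le> 1 powr (-5/2)" unfolding bump_def by (intro powr_mono2') auto
    then show ?thesis using 0 by simp
  next
    case (Suc j)
    have "j < k" using Suc by simp
    then have "\<not> norm z < 2 ^ j" unfolding k_def by (rule not_less_Least)
    then have "(2 ^ j)\<^sup>2 \<le> (norm z)\<^sup>2" by (intro power_mono) simp_all
    then have "(2 ^ j)\<^sup>2 \<le> 1 + (norm z)\<^sup>2" by linarith
    then have "bump z \<le> ((2 ^ j)\<^sup>2) powr (-5/2)"
      unfolding bump_def by (intro powr_mono2') auto
    also have "((2::real) ^ j)\<^sup>2 = 2 powr (2 * real j)"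
    proof -
      have "(2::real) powr (2 * real j) = (2 powr real j)\<^sup>2"
        unfolding power2_eq_square powr_add[symmetric] by simp
      then show ?thesis by (simp add: powr_realpow)
    qed
    also have "(2 powr (2 * real j)) powr (-5/2) = (2 powr (-5)) powr real j"
      unfolding powr_powr by simp
    also have "(2::real) powr (-5) = 1/32" by (simp add: powr_minus_divide)
    also have "(1/32) powr real j = (1/32::real) ^ j" by (simp add: powr_realpow)
    finally show ?thesis using Suc by simp
  qed
  then show "\<exists>k. norm z < 2 ^ k \<and> bump z \<le> 32 * (1/32) ^ k" using lt by blast
qed (use bump_pos in \<open>auto intro: less_imp_le\<close>)

definition bump_mass :: real where "bump_mass = (\<integral>z. bump z \<partial>lborel)"

lemma bump_mass_pos: "bump_mass > 0"
proof -
  have "bump_mass \<noteq> 0"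
  proof
    assume "bump_mass = 0"
    then have "AE z in lborel. bump z = 0"
      unfolding bump_mass_def using bump_pos
      by (subst (asm) integral_nonneg_eq_0_iff_AE[OF bump_integrable]) (auto intro: less_imp_le)
    then have "AE z in (lborel :: (real^3) measure). False"
      by (rule eventually_mono) (use bump_pos less_irrefl in metis)
    then show False
      using emeasure_lborel_UNIV[where 'a = "real^3"] by (simp add: eventually_False ae_filter_eq_bot_iff)
  qed
  moreover have "bump_mass \<ge> 0" unfolding bump_mass_def using bump_pos by (intro Bochner_Integration.integral_nonneg) (auto intro: less_imp_le)
  ultimately show ?thesis by simp
qed

lemma lborel_integral_affine:
  fixes f :: "real^3 \<Rightarrow> real"
  assumes "s > 0" "f \<in> borel_measurable borel"
  shows "(\<integral>y. f y \<partial>lborel) = s ^ 3 * (\<integral>z. f (x + s *\<^sub>R z) \<partial>lborel)"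
proof -
  have "(\<integral>y. f y \<partial>lborel) =
     (\<integral>y. f y \<partial>density (distr lborel borel (\<lambda>z. x + s *\<^sub>R z)) (\<lambda>_. ennreal (s ^ 3)))"
    using lborel_affine[of s x] assms(1) by (simp add: ennreal_power)
  also have "\<dots> = (\<integral>y. s ^ 3 *\<^sub>R f y \<partial>distr lborel borel (\<lambda>z. x + s *\<^sub>R z))"
    using assms by (subst integral_density) auto
  also have "\<dots> = (\<integral>z. s ^ 3 *\<^sub>R f (x + s *\<^sub>R z) \<partial>lborel)"
    using assms by (subst integral_distr) auto
  finally show ?thesis by simp
qed

text \<open>Under the substitution \<open>y = x + s n *\<^sub>R z\<close> the cube of
  \<open>s n\<close> from the volume and the square in front cancel the fifth power from the kernel.
  What remains is \<open>bump\<close>, which is independent of \<open>n\<close> and serves as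
  dominating function.\<close>

lemma approximate_identity:
  fixes \<phi> :: "real^3 \<Rightarrow> real"
  assumes c: "continuous_on UNIV \<phi>" and M: "\<And>y. \<bar>\<phi> y\<bar> \<le> M"
    and s: "\<And>n. s n > 0" "s \<longlonglongrightarrow> (0::real)"
  shows "(\<lambda>n. \<integral>y. (s n)\<^sup>2 * ((s n)\<^sup>2 + (norm (x - y))\<^sup>2) powr (-5/2) * \<phi> y \<partial>lborel)
    \<longlonglongrightarrow> bump_mass * \<phi> x"
proof -
  have [measurable]: "\<phi> \<in> borel_measurable borel" using c by (rule borel_measurable_continuous_onI)
  have "(\<integral>y. (s n)\<^sup>2 * ((s n)\<^sup>2 + (norm (x - y))\<^sup>2) powr (-5/2) * \<phi> y \<partial>lborel) =
     (\<integral>z. bump z * \<phi> (x + s n *\<^sub>R z) \<partial>lborel)" (is "?l = _") for n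
  proof -
    have sn: "s n > 0" by (rule s)
    have "?l = s n ^ 3 * (\<integral>z. (s n)\<^sup>2 * ((s n)\<^sup>2 + (norm (s n *\<^sub>R z))\<^sup>2) powr (-5/2)
        * \<phi> (x + s n *\<^sub>R z) \<partial>lborel)"
      by (subst lborel_integral_affine[OF sn, of _ x]) (auto simp: norm_minus_commute)
    also have "\<dots> = (\<integral>z. bump z * \<phi> (x + s n *\<^sub>R z) \<partial>lborel)"
    proof (subst integral_mult_right_zero[symmetric], rule Bochner_Integration.integral_cong[OF refl])
      fix z :: "real^3"
      have "(s n)\<^sup>2 + (norm (s n *\<^sub>R z))\<^sup>2 = (s n)\<^sup>2 * (1 + (norm z)\<^sup>2)"
        by (simp add: power_mult_distrib algebra_simps)
      then have "((s n)\<^sup>2 + (norm (s n *\<^sub>R z))\<^sup>2) powr (-5/2) = ((s n)\<^sup>2) powr (-5/2) * bump z"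
        unfolding bump_def by (simp add: powr_mult)
      moreover have "((s n)\<^sup>2) powr (-5/2) = 1 / s n ^ 5"
      proof -
        have "((s n)\<^sup>2) powr (-5/2) = (s n powr 2) powr (-5/2)" using sn by simp
        also have "\<dots> = s n powr (-5)" unfolding powr_powr by simp
        finally show ?thesis using sn by (simp add: powr_minus_divide)
      qed
      moreover have "s n ^ 3 * (s n)\<^sup>2 = s n ^ 5" by (simp flip: power_add)
      ultimately show "s n ^ 3 * ((s n)\<^sup>2 * ((s n)\<^sup>2 + (norm (s n *\<^sub>R z))\<^sup>2) powr (-5/2)
          * \<phi> (x + s n *\<^sub>R z)) = bump z * \<phi> (x + s n *\<^sub>R z)"
        using sn by (simp add: mult.assoc[symmetric])
    qed
    finally show ?thesis .
  qed
  moreover have "(\<lambda>n. \<integral>z. bump z * \<phi> (x + s n *\<^sub>R z) \<partial>lborel) \<longlonglongrightarrow> (\<integral>z. bump z * \<phi> x \<partial>lborel)"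
  proof (rule integral_dominated_convergence)
    show "integrable lborel (\<lambda>z. bump z * M)" using bump_integrable by simp
    show "AE z in lborel. (\<lambda>n. bump z * \<phi> (x + s n *\<^sub>R z)) \<longlonglongrightarrow> bump z * \<phi> x"
    proof (intro AE_I2 tendsto_intros)
      fix z :: "real^3"
      have "(\<lambda>n. x + s n *\<^sub>R z) \<longlonglongrightarrow> x + 0 *\<^sub>R z" using s(2) by (intro tendsto_intros)
      then show "(\<lambda>n. \<phi> (x + s n *\<^sub>R z)) \<longlonglongrightarrow> \<phi> x"
        using c by (intro isCont_tendsto_compose[of x \<phi>]) (auto simp: continuous_on_eq_continuous_at)
    qed
    show "AE z in lborel. norm (bump z * \<phi> (x + s n *\<^sub>R z)) \<le> bump z * M" for n
      using M bump_pos by (intro AE_I2) (simp add: abs_mult less_imp_le abs_of_pos)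
  qed auto
  ultimately show ?thesis by (simp add: bump_mass_def)
qed

section \<open>The Green function of the ball\<close>

definition wt :: "real^3 \<Rightarrow> real" where
  "wt x = 1 - (norm x)\<^sup>2"

text \<open>For \<open>x\<close> and \<open>y\<close> in the ball with \<open>y\<close> other than
  0, this is \<open>norm y\<close> times the distance from \<open>x\<close> to the inverse point of
  \<open>y\<close> in the unit sphere; see \<open>conj_dist_norm\<close>.\<close>

definition conj_dist :: "real^3 \<Rightarrow> real^3 \<Rightarrow> real" where
  "conj_dist x y = sqrt ((norm (x - y))\<^sup>2 + wt x * wt y)"

text \<open>The Green function in the variables squared distance and product of weights. A
  reflection changes both in a controlled direction, so its effect is read off from monotonicity in
  each variable.\<close>

definition gfun :: "real \<Rightarrow> real \<Rightarrow> real" where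
  "gfun s P = (sqrt (s + P) - sqrt s)\<^sup>2 / sqrt (s + P)"

definition green :: "real^3 \<Rightarrow> real^3 \<Rightarrow> real" where
  "green x y = (conj_dist x y - norm (x - y))\<^sup>2 / conj_dist x y"

lemma green_gfun: "green x y = gfun ((norm (x - y))\<^sup>2) (wt x * wt y)"
  by (simp add: green_def gfun_def conj_dist_def)

lemma gfun_expand:
  assumes "s \<ge> 0" "P > 0"
  shows "gfun s P = sqrt (s + P) + s / sqrt (s + P) - 2 * sqrt s"
proof -
  have "sqrt (s + P) > 0" "(sqrt s)\<^sup>2 = s" using assms by auto
  then show ?thesis unfolding gfun_def by (simp add: power2_diff divide_simps power2_eq_square algebra_simps)
qed

lemma gfun_quotient:
  assumes "s \<ge> 0" "P > 0"
  shows "gfun s P = P\<^sup>2 / (sqrt (s + P) * (sqrt (s + P) + sqrt s)\<^sup>2)"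
proof -
  have "(sqrt (s + P) - sqrt s) * (sqrt (s + P) + sqrt s) = P"
    using assms by (simp add: algebra_simps flip: power2_eq_square)
  then have "P\<^sup>2 = (sqrt (s + P) - sqrt s)\<^sup>2 * (sqrt (s + P) + sqrt s)\<^sup>2"
    by (metis power_mult_distrib)
  moreover have "sqrt (s + P) > 0" "sqrt s \<ge> 0" using assms by auto
  then have "sqrt (s + P) + sqrt s \<noteq> 0" by linarith
  ultimately show ?thesis unfolding gfun_def by simp
qed

lemma gfun_antimono:
  assumes "0 \<le> s" "s \<le> S" "P > 0"
  shows "gfun S P \<le> gfun s P"
proof -
  have "sqrt (s + P) * (sqrt (s + P) + sqrt s)\<^sup>2 \<le> sqrt (S + P) * (sqrt (S + P) + sqrt S)\<^sup>2"
    using assms by (intro mult_mono power_mono add_mono) auto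
  moreover have "sqrt (s + P) * (sqrt (s + P) + sqrt s)\<^sup>2 > 0"
    using assms by (intro mult_pos_pos zero_less_power add_pos_nonneg) auto
  moreover have "sqrt (S + P) * (sqrt (S + P) + sqrt S)\<^sup>2 > 0"
    using assms by (intro mult_pos_pos zero_less_power add_pos_nonneg) auto
  ultimately have "P\<^sup>2 / (sqrt (S + P) * (sqrt (S + P) + sqrt S)\<^sup>2)
      \<le> P\<^sup>2 / (sqrt (s + P) * (sqrt (s + P) + sqrt s)\<^sup>2)"
    using divide_left_mono[OF _ zero_le_power2 mult_pos_pos] by blast
  then show ?thesis using assms by (simp add: gfun_quotient)
qed

lemma gfun_deriv:
  assumes "s \<ge> 0" "P > 0"
  shows "((\<lambda>P. sqrt (s + P) + s / sqrt (s + P) - 2 * sqrt s) has_real_derivative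
     P / (2 * (s + P) * sqrt (s + P))) (at P)"
proof -
  have p: "s + P > 0" using assms by simp
  have e: "inverse (sqrt (s + P)) / 2 + - (s * (inverse (sqrt (s + P)) / 2)) / (sqrt (s + P) * sqrt (s + P))
    = P / (2 * (s + P) * sqrt (s + P))"
    using p by (simp add: divide_simps)
  show ?thesis
    by (rule derivative_eq_intros refl | use p in force)+ (use e p in simp)
qed

text \<open>The derivative in \<open>P\<close> given by \<open>gfun_deriv\<close> decreases in
  \<open>s\<close>, so the difference of the expressions at \<open>s\<close> and at \<open>S\<close>
  is non-decreasing in \<open>P\<close>.\<close>

lemma gfun_mono_mixed:
  assumes "0 \<le> s" "s \<le> S" "0 < P" "P \<le> P'"
  shows "gfun S P' - gfun S P \<le> gfun s P' - gfun s P"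
proof -
  define D where "D t = (sqrt (s + t) + s / sqrt (s + t) - 2 * sqrt s)
     - (sqrt (S + t) + S / sqrt (S + t) - 2 * sqrt S)" for t
  have "D P \<le> D P'"
  proof (rule DERIV_nonneg_imp_nondecreasing[OF assms(4)])
    fix t assume "P \<le> t" "t \<le> P'"
    then have t: "t > 0" using assms by simp
    have "(D has_real_derivative t / (2 * (s + t) * sqrt (s + t)) - t / (2 * (S + t) * sqrt (S + t))) (at t)"
      unfolding D_def[abs_def] using assms t by (intro DERIV_diff gfun_deriv) auto
    moreover have "t / (2 * (S + t) * sqrt (S + t)) \<le> t / (2 * (s + t) * sqrt (s + t))"
      using assms t by (intro divide_left_mono mult_mono mult_pos_pos) auto
    ultimately show "\<exists>y. (D has_real_derivative y) (at t) \<and> 0 \<le> y" by (metis diff_ge_0_iff_ge)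
  qed
  then show ?thesis using assms by (simp add: D_def gfun_expand)
qed

lemma gfun_mono:
  assumes "0 \<le> s" "0 < P" "P \<le> P'"
  shows "gfun s P \<le> gfun s P'"
proof -
  have "(sqrt (s + P) + s / sqrt (s + P) - 2 * sqrt s) \<le> (sqrt (s + P') + s / sqrt (s + P') - 2 * sqrt s)"
  proof (rule DERIV_nonneg_imp_nondecreasing[OF assms(3)])
    fix t assume "P \<le> t" "t \<le> P'"
    then have t: "t > 0" using assms by simp
    have "t / (2 * (s + t) * sqrt (s + t)) \<ge> 0" using assms t by simp
    then show "\<exists>y. ((\<lambda>P. sqrt (s + P) + s / sqrt (s + P) - 2 * sqrt s) has_real_derivative y) (at t) \<and> 0 \<le> y"
      using gfun_deriv[OF assms(1) t] by blast
  qed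
  then show ?thesis using assms by (simp add: gfun_expand)
qed

lemma wt_pos: "norm x < 1 \<Longrightarrow> wt x > 0"
  unfolding wt_def using power_strict_mono[of "norm x" 1 2] by simp

lemma wt_le_1: "wt x \<le> 1"
  by (simp add: wt_def)

lemma wt_mirror: "norm e = 1 \<Longrightarrow> wt (mirror e \<mu> x) = wt x + 4 * \<mu> * (x \<bullet> e - \<mu>)"
  unfolding wt_def norm_mirror_sq by linarith

lemma green_nonneg: "green x y \<ge> 0" if "norm x < 1" "norm y < 1"
  using wt_pos[OF that(1)] wt_pos[OF that(2)] by (simp add: green_def conj_dist_def)

text \<open>Reflecting \<open>x\<close> to the side of \<open>y\<close> enlarges \<open>wt x\<close>
  and shortens the distance; \<open>gfun\<close> grows under both changes.\<close>

lemma green_mirror_mono: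
  assumes e: "norm e = 1" and "0 \<le> \<mu>" "norm x < 1" "norm y < 1" "x \<bullet> e > \<mu>" "y \<bullet> e \<le> \<mu>"
  shows "green x y \<le> green (mirror e \<mu> x) y"
proof -
  have p: "wt x > 0" "wt y > 0" "wt x \<le> wt (mirror e \<mu> x)"
    using assms by (auto simp: wt_pos wt_mirror)
  have "gfun ((norm (x - y))\<^sup>2) (wt x * wt y) \<le> gfun ((norm (x - y))\<^sup>2) (wt (mirror e \<mu> x) * wt y)"
    using p by (intro gfun_mono mult_right_mono) auto
  also have "\<dots> \<le> gfun ((norm (mirror e \<mu> x - y))\<^sup>2) (wt (mirror e \<mu> x) * wt y)"
  proof (rule gfun_antimono[OF zero_le_power2])
    have "4 * (x \<bullet> e - \<mu>) * (y \<bullet> e - \<mu>) \<le> 0" using assms by (intro mult_nonneg_nonpos) auto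
    then show "(norm (mirror e \<mu> x - y))\<^sup>2 \<le> (norm (x - y))\<^sup>2" unfolding dist_mirror_sq[OF e] by simp
  qed (use p in simp)
  finally show ?thesis by (simp add: green_gfun)
qed

text \<open>When \<open>y\<close> lies beyond the plane, reflecting \<open>x\<close> takes it away
  from \<open>y\<close> and the difference at \<open>y\<close> alone may be negative. The gain at
  the mirror image of \<open>y\<close> makes up for it.\<close>

lemma green_mirror_sum:
  assumes e: "norm e = 1" and "0 \<le> \<mu>" "norm x < 1" "norm y < 1" "x \<bullet> e > \<mu>" "y \<bullet> e \<ge> \<mu>"
  shows "green x y + green x (mirror e \<mu> y) \<le> green (mirror e \<mu> x) y + green (mirror e \<mu> x) (mirror e \<mu> y)"
proof -
  define p q p' q' s S where d: "p = wt x" "q = wt y" "p' = wt (mirror e \<mu> x)" "q' = wt (mirror e \<mu> y)"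
    "s = (norm (x - y))\<^sup>2" "S = (norm (mirror e \<mu> x - y))\<^sup>2"
  have p: "p > 0" "q > 0" "p \<le> p'" "q \<le> q'"
    using assms unfolding d by (auto simp: wt_pos wt_mirror)
  have s: "0 \<le> s" "s \<le> S" using assms unfolding d by (auto simp: dist_mirror_sq)
  have S2: "(norm (x - mirror e \<mu> y))\<^sup>2 = S"
    unfolding d using dist_mirror_mirror[OF e, of \<mu> x "mirror e \<mu> y"] by (simp add: mirror_mirror[OF e])
  have s2: "(norm (mirror e \<mu> x - mirror e \<mu> y))\<^sup>2 = s" unfolding d by (simp add: dist_mirror_mirror[OF e])
  have o: "p * q \<le> p * q'" "p * q \<le> p' * q" "p * q' \<le> p' * q'" "p' * q \<le> p' * q'" "p * q > 0"
    "p * q' > 0" "p' * q > 0"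
    using p by (auto intro!: mult_mono mult_pos_pos)
  have "gfun S (p * q') + gfun s (p * q) \<le> gfun s (p' * q') + gfun S (p' * q)"
  \<comment> \<open>Either of the two mixed products may be the larger. If \<open>p * q'\<close>
    exceeds \<open>p' * q\<close>, the loss at distance \<open>S\<close> is at most the
    corresponding gain at \<open>s\<close>, by \<open>gfun_mono_mixed\<close>.\<close>
  proof (cases "p * q' \<le> p' * q")
    case True
    then have "gfun S (p * q') \<le> gfun S (p' * q)" using s o by (intro gfun_mono) auto
    moreover have "gfun s (p * q) \<le> gfun s (p' * q')" using s o by (intro gfun_mono) auto
    ultimately show ?thesis by simp
  next
    case False
    then have "gfun S (p * q') - gfun S (p' * q) \<le> gfun s (p * q') - gfun s (p' * q)"
      using s o by (intro gfun_mono_mixed) auto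
    moreover have "gfun s (p * q') \<le> gfun s (p' * q')" "gfun s (p * q) \<le> gfun s (p' * q)"
      using s o by (auto intro!: gfun_mono)
    ultimately show ?thesis by simp
  qed
  then show ?thesis unfolding green_gfun S2 s2 unfolding d[symmetric] by simp
qed

section \<open>Bounds for \<open>conj_dist\<close> and Lipschitz estimates for the Green
  function\<close>

lemma conj_dist_sq:
  assumes "norm x < 1" "norm y < 1"
  shows "(conj_dist x y)\<^sup>2 = 1 - 2 * (x \<bullet> y) + (norm x)\<^sup>2 * (norm y)\<^sup>2"
proof -
  have "wt x * wt y \<ge> 0" using assms[THEN wt_pos] by simp
  then have "(conj_dist x y)\<^sup>2 = (norm (x - y))\<^sup>2 + wt x * wt y"
    unfolding conj_dist_def by simp
  also have "(norm (x - y))\<^sup>2 = (norm x)\<^sup>2 - 2 * (x \<bullet> y) + (norm y)\<^sup>2"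
    by (simp add: power2_norm_eq_inner inner_diff_left inner_diff_right inner_commute[of y x])
  finally show ?thesis by (simp add: wt_def algebra_simps)
qed

lemma conj_dist_pos: "norm x < 1 \<Longrightarrow> norm y < 1 \<Longrightarrow> conj_dist x y > 0"
  unfolding conj_dist_def using wt_pos[of x] wt_pos[of y] by (simp add: add_nonneg_pos)

lemma conj_dist_ge_norm: "norm x < 1 \<Longrightarrow> norm y < 1 \<Longrightarrow> norm (x - y) \<le> conj_dist x y"
  unfolding conj_dist_def by (intro real_le_rsqrt) (simp add: wt_pos less_imp_le)

lemma conj_dist_ge:
  assumes "norm x < 1" "norm y < 1"
  shows "1 - norm x * norm y \<le> conj_dist x y"
proof -
  have "x \<bullet> y \<le> norm x * norm y" by (rule norm_cauchy_schwarz)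
  then have "(1 - norm x * norm y)\<^sup>2 \<le> (conj_dist x y)\<^sup>2"
    unfolding conj_dist_sq[OF assms] by (simp add: power2_diff power_mult_distrib)
  then show ?thesis using conj_dist_pos[OF assms] by (meson less_imp_le power2_le_imp_le)
qed

text \<open>\<open>conj_dist x y\<close> is at least \<open>1 - norm y\<close>, however close
  \<open>x\<close> is to the sphere. This keeps the quotients in \<open>hker\<close> under control
  up to the boundary.\<close>

lemma wt_le_conj_dist:
  assumes "norm x < 1" "norm y < 1"
  shows "wt y \<le> 2 * conj_dist x y"
proof -
  have "norm x * norm y \<le> 1 * norm y" using assms by (intro mult_right_mono) auto
  then have "1 - norm y \<le> conj_dist x y" using conj_dist_ge[OF assms] by linarith
  moreover have "wt y \<le> 2 - 2 * norm y"
  proof -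
    have "wt y = (1 - norm y) * (1 + norm y)" by (simp add: wt_def algebra_simps power2_eq_square)
    also have "\<dots> \<le> (1 - norm y) * 2" using assms by (intro mult_left_mono) auto
    finally show ?thesis by simp
  qed
  ultimately show ?thesis by linarith
qed

lemma conj_dist_le_2:
  assumes "norm x < 1" "norm y < 1"
  shows "conj_dist x y \<le> 2"
proof -
  have "- (x \<bullet> y) \<le> norm x * norm y" using norm_cauchy_schwarz[of "- x" y] by simp
  moreover have "norm x * norm y \<le> 1 * 1" using assms by (intro mult_mono) auto
  moreover have "(norm x)\<^sup>2 * (norm y)\<^sup>2 \<le> 1 * 1"
    using assms by (intro mult_mono power_le_one) auto
  ultimately have "(conj_dist x y)\<^sup>2 \<le> 2\<^sup>2" unfolding conj_dist_sq[OF assms] by simp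
  then show ?thesis by (rule power2_le_imp_le) simp
qed

lemma conj_dist_norm:
  assumes "norm x < 1" "norm y < 1" "y \<noteq> 0"
  shows "conj_dist x y = norm (norm y *\<^sub>R x - sgn y)"
proof (rule power2_eq_imp_eq)
  have "norm y * (x \<bullet> sgn y) = x \<bullet> y"
    using assms by (simp add: sgn_div_norm)
  then show "(conj_dist x y)\<^sup>2 = (norm (norm y *\<^sub>R x - sgn y))\<^sup>2"
    unfolding conj_dist_sq[OF assms(1,2)] power2_norm_eq_inner[of "norm y *\<^sub>R x - sgn y"]
    using assms(3) dot_square_norm[of x] dot_square_norm[of "sgn y"]
    by (simp add: inner_diff_left inner_diff_right inner_commute[of "sgn y" x]
         norm_sgn algebra_simps power2_eq_square)
qed (use conj_dist_pos[OF assms(1,2)] in auto)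

lemma conj_dist_lipschitz:
  assumes "norm x < 1" "norm x' < 1" "norm y < 1"
  shows "\<bar>conj_dist x y - conj_dist x' y\<bar> \<le> norm (x - x')"
proof (cases "y = 0")
  case True
  then show ?thesis by (simp add: conj_dist_def wt_def)
next
  case False
  have "\<bar>conj_dist x y - conj_dist x' y\<bar> \<le> norm ((norm y *\<^sub>R x - sgn y) - (norm y *\<^sub>R x' - sgn y))"
    unfolding conj_dist_norm[OF assms(1,3) False] conj_dist_norm[OF assms(2,3) False]
    by (rule norm_triangle_ineq3)
  also have "\<dots> = norm y * norm (x - x')" by (simp flip: scaleR_diff_right)
  also have "\<dots> \<le> 1 * norm (x - x')" using assms by (intro mult_right_mono) auto
  finally show ?thesis by simp
qed

text \<open>
  Splitting off \<open>(wt x)\<^sup>2\<close> exhibits the vanishing of \<open>green\<close> to second order at the sphere; the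
  remaining factor has an integrable Lipschitz bound up to the boundary.
\<close>

definition hker :: "real^3 \<Rightarrow> real^3 \<Rightarrow> real" where
  "hker x y = (wt y)\<^sup>2 / (conj_dist x y * (conj_dist x y + norm (x - y))\<^sup>2)"

lemma green_hker: "norm x < 1 \<Longrightarrow> norm y < 1 \<Longrightarrow> green x y = (wt x)\<^sup>2 * hker x y"
  unfolding green_gfun hker_def conj_dist_def
  by (subst gfun_quotient) (simp_all add: wt_pos power_mult_distrib)

lemma kernel_lipschitz_aux:
  fixes A A' d d' q \<delta> :: real
  assumes "0 < d" "d \<le> A" "0 < d'" "d' \<le> A'" "0 \<le> q" "q \<le> 2 * A" "q \<le> 2 * A'"
    and "\<bar>A - A'\<bar> \<le> \<delta>" "\<bar>d - d'\<bar> \<le> \<delta>"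
  shows "\<bar>q\<^sup>2 / (A * (A + d)\<^sup>2) - q\<^sup>2 / (A' * (A' + d')\<^sup>2)\<bar> \<le> 12 * \<delta> * (1 / d\<^sup>2 + 1 / d'\<^sup>2)"
proof -
  define B B' where "B = A + d" and "B' = A' + d'"
  have pos: "A > 0" "A' > 0" "B > 0" "B' > 0" "\<delta> \<ge> 0" "d \<le> B" "d' \<le> B'" "A \<le> B" "A' \<le> B'"
    using assms by (auto simp: B_def B'_def)
  have qq: "q\<^sup>2 / (X * Y) \<le> 4" if "q \<le> 2 * X" "q \<le> 2 * Y" "X > 0" "Y > 0" for X Y
  proof -
    have "q * q \<le> (2 * X) * (2 * Y)" using that assms by (intro mult_mono) auto
    then show ?thesis using that by (simp add: divide_simps power2_eq_square)
  qed
  have bb: "1 / B\<^sup>2 \<le> 1 / d\<^sup>2" "1 / B'\<^sup>2 \<le> 1 / d'\<^sup>2"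
    using assms pos by (auto intro!: divide_left_mono power_mono mult_pos_pos)
  \<comment> \<open>A telescoping sum that exchanges one factor of the denominator at a time. Each
    term contains \<open>q\<^sup>2\<close> over two of the factors, which is at most 4, and one
    inverse square, which is at most that of \<open>d\<close> or \<open>d'\<close>.\<close>
  have eq: "q\<^sup>2 / (A * B\<^sup>2) - q\<^sup>2 / (A' * B'\<^sup>2) =
     (q\<^sup>2 / (A * A')) * (A' - A) * (1 / B\<^sup>2) + (q\<^sup>2 / (A' * B)) * (B' - B) * (1 / B'\<^sup>2)
     + (q\<^sup>2 / (A' * B')) * (B' - B) * (1 / B\<^sup>2)"
    using pos by (simp add: divide_simps) (simp add: algebra_simps power2_eq_square)
  have t1: "\<bar>(q\<^sup>2 / (A * A')) * (A' - A) * (1 / B\<^sup>2)\<bar> \<le> 4 * \<delta> * (1 / d\<^sup>2)"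
    unfolding abs_mult using assms pos bb qq[of A A']
    by (intro mult_mono) (auto simp: abs_mult)
  have BB: "\<bar>B' - B\<bar> \<le> 2 * \<delta>" using assms by (auto simp: B_def B'_def)
  have t2: "\<bar>(q\<^sup>2 / (A' * B)) * (B' - B) * (1 / B'\<^sup>2)\<bar> \<le> 4 * (2 * \<delta>) * (1 / d'\<^sup>2)"
    unfolding abs_mult using assms pos bb qq[of A' B] BB
    by (intro mult_mono) (auto simp: abs_mult)
  have t3: "\<bar>(q\<^sup>2 / (A' * B')) * (B' - B) * (1 / B\<^sup>2)\<bar> \<le> 4 * (2 * \<delta>) * (1 / d\<^sup>2)"
    unfolding abs_mult using assms pos bb qq[of A' B'] BB
    by (intro mult_mono) (auto simp: abs_mult)
  have "0 \<le> \<delta> * (1 / d'\<^sup>2)" using pos by simp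
  have "\<bar>q\<^sup>2 / (A * B\<^sup>2) - q\<^sup>2 / (A' * B'\<^sup>2)\<bar> \<le>
    4 * \<delta> * (1 / d\<^sup>2) + 4 * (2 * \<delta>) * (1 / d'\<^sup>2) + 4 * (2 * \<delta>) * (1 / d\<^sup>2)"
    unfolding eq by (intro order_trans[OF abs_triangle_ineq] add_mono t1 t2 t3)
  also have "\<dots> = 12 * (\<delta> * (1 / d\<^sup>2)) + 8 * (\<delta> * (1 / d'\<^sup>2))" by simp
  also have "\<dots> \<le> 12 * (\<delta> * (1 / d\<^sup>2)) + 12 * (\<delta> * (1 / d'\<^sup>2))"
    using \<open>0 \<le> \<delta> * (1 / d'\<^sup>2)\<close> by linarith
  also have "\<dots> = 12 * \<delta> * (1 / d\<^sup>2 + 1 / d'\<^sup>2)" by (simp add: algebra_simps)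
  finally show ?thesis unfolding B_def B'_def .
qed

lemma hker_lipschitz:
  assumes "norm x < 1" "norm x' < 1" "norm y < 1" "y \<noteq> x" "y \<noteq> x'"
  shows "\<bar>hker x y - hker x' y\<bar> \<le> 12 * norm (x - x') * (invsq x y + invsq x' y)"
  unfolding hker_def invsq_def
proof (rule kernel_lipschitz_aux)
  show "\<bar>norm (x - y) - norm (x' - y)\<bar> \<le> norm (x - x')"
    using norm_triangle_ineq3[of "x - y" "x' - y"] by simp
qed (use assms in \<open>auto simp: conj_dist_ge_norm wt_le_conj_dist conj_dist_lipschitz wt_pos less_imp_le\<close>)

lemma hker_nonneg: "norm x < 1 \<Longrightarrow> norm y < 1 \<Longrightarrow> hker x y \<ge> 0"
  unfolding hker_def using conj_dist_pos[of x y] by simp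

lemma hker_le:
  assumes "norm x < 1" "norm y < 1" "y \<noteq> x"
  shows "hker x y \<le> 8 * invsq x y"
proof -
  define A d q where "A = conj_dist x y" and "d = norm (x - y)" and "q = wt y"
  have A: "A > 0" "d \<le> A" "q \<le> 2 * A" "q \<ge> 0" "d > 0" "d \<le> 2" "A \<le> 2"
    using assms conj_dist_ge_norm[of x y] conj_dist_le_2[of x y]
    by (auto simp: A_def d_def q_def conj_dist_pos wt_le_conj_dist wt_pos less_imp_le)
  have "q\<^sup>2 / (A * (A + d)\<^sup>2) \<le> (2 * A)\<^sup>2 / (A * (A + d)\<^sup>2)"
    using A by (intro divide_right_mono power_mono) auto
  also have "\<dots> = 4 * A / (A + d)\<^sup>2" using A by (simp add: power2_eq_square)
  also have "\<dots> \<le> 4 * 2 / d\<^sup>2"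
    using A by (intro frac_le power_mono mult_mono) auto
  finally show ?thesis by (simp add: hker_def invsq_def A_def d_def q_def)
qed

text \<open>Both distances are at most 2, so the denominator is at most
  \<open>2 * (2 + 2)\<^sup>2\<close>. Uniformity in \<open>x\<close> up to the sphere is what
  \<open>green_cap_ge\<close> draws on.\<close>

lemma hker_ge:
  assumes "norm x < 1" "norm y < 1"
  shows "(wt y)\<^sup>2 / 32 \<le> hker x y"
proof -
  have "conj_dist x y * (conj_dist x y + norm (x - y))\<^sup>2 \<le> 2 * (2 + 2)\<^sup>2"
    using assms conj_dist_ge_norm[of x y] conj_dist_le_2[of x y] conj_dist_pos[of x y]
    by (intro mult_mono power_mono add_mono) auto
  moreover have "conj_dist x y * (conj_dist x y + norm (x - y))\<^sup>2 > 0"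
    using assms conj_dist_pos[of x y] by (intro mult_pos_pos zero_less_power add_pos_nonneg) auto
  ultimately show ?thesis unfolding hker_def by (intro divide_left_mono) auto
qed

lemma wt_lipschitz:
  assumes "norm x < 1" "norm x' < 1"
  shows "\<bar>wt x - wt x'\<bar> \<le> 2 * norm (x - x')"
proof -
  have "wt x - wt x' = (norm x' - norm x) * (norm x' + norm x)"
    by (simp add: wt_def algebra_simps power2_eq_square)
  then have "\<bar>wt x - wt x'\<bar> = \<bar>norm x' - norm x\<bar> * (norm x' + norm x)" by (simp add: abs_mult)
  also have "\<dots> \<le> norm (x - x') * 2"
    using assms norm_triangle_ineq3[of x' x] by (intro mult_mono) (auto simp: norm_minus_commute)
  finally show ?thesis by simp
qed

text \<open>The factor \<open>m\<close> is kept because the loss in the moving plane step has to be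
  compared with a gain that also vanishes at the sphere. In 44, the part 32 comes from the
  difference of the squared weights and 12 from \<open>hker_lipschitz\<close>.\<close>

lemma green_lipschitz:
  assumes xy: "norm x < 1" "norm x' < 1" "norm y < 1" "y \<noteq> x" "y \<noteq> x'"
    and m: "wt x \<le> m" "wt x' \<le> m" "m \<le> 1"
  shows "\<bar>green x y - green x' y\<bar> \<le> 44 * m * norm (x - x') * (invsq x y + invsq x' y)"
proof -
  define \<delta> where "\<delta> = norm (x - x')"
  have p: "wt x > 0" "wt x' > 0" "\<delta> \<ge> 0" using xy by (auto simp: wt_pos \<delta>_def)
  have "green x y - green x' y = (wt x + wt x') * (wt x - wt x') * hker x y + (wt x')\<^sup>2 * (hker x y - hker x' y)"
    using xy by (simp add: green_hker algebra_simps power2_eq_square)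
  then have "\<bar>green x y - green x' y\<bar> \<le>
     \<bar>(wt x + wt x') * (wt x - wt x') * hker x y\<bar> + \<bar>(wt x')\<^sup>2 * (hker x y - hker x' y)\<bar>" by linarith
  moreover have "\<bar>(wt x + wt x') * (wt x - wt x') * hker x y\<bar> \<le> (2 * m) * (2 * \<delta>) * (8 * invsq x y)"
    unfolding abs_mult \<delta>_def using xy m p wt_lipschitz[of x x'] hker_le[of x y] hker_nonneg[of x y]
    by (intro mult_mono) auto
  moreover have "\<bar>(wt x')\<^sup>2 * (hker x y - hker x' y)\<bar> \<le> m * (12 * \<delta> * (invsq x y + invsq x' y))"
  proof -
    have "(wt x')\<^sup>2 \<le> m * 1" unfolding power2_eq_square using m p by (intro mult_mono) auto
    then show ?thesis unfolding abs_mult using hker_lipschitz[OF xy] m p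
      by (intro mult_mono) (auto simp: \<delta>_def)
  qed
  moreover have "0 \<le> m * \<delta> * invsq x' y" using m p by simp
  ultimately show ?thesis unfolding \<delta>_def[symmetric] by (simp add: algebra_simps)
qed

lemma wt_borel [measurable]: "wt \<in> borel_measurable borel"
  unfolding wt_def[abs_def] by measurable

lemma conj_dist_borel [measurable]: "conj_dist x \<in> borel_measurable borel"
  unfolding conj_dist_def[abs_def] by measurable

lemma green_borel [measurable]: "green x \<in> borel_measurable borel"
  unfolding green_def[abs_def] by measurable

lemma green_le_2:
  assumes "norm x < 1" "norm y < 1" shows "green x y \<le> 2"
proof -
  have A: "conj_dist x y > 0" "norm (x - y) \<le> conj_dist x y" "conj_dist x y \<le> 2"
    using assms by (auto simp: conj_dist_pos conj_dist_ge_norm conj_dist_le_2)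
  then have "(conj_dist x y - norm (x - y))\<^sup>2 \<le> (conj_dist x y)\<^sup>2" by (intro power_mono) auto
  then have "green x y \<le> (conj_dist x y)\<^sup>2 / conj_dist x y"
    unfolding green_def using A by (intro divide_right_mono) auto
  also have "\<dots> = conj_dist x y" by (simp add: power2_eq_square)
  finally show ?thesis using A by linarith
qed

lemma integral_abs_bound_mono:
  fixes f g :: "'a \<Rightarrow> real"
  assumes "\<And>y. \<bar>f y\<bar> \<le> g y" "integrable M f" "integrable M g"
  shows "\<bar>\<integral>y. f y \<partial>M\<bar> \<le> (\<integral>y. g y \<partial>M)"
proof -
  have "\<bar>\<integral>y. f y \<partial>M\<bar> \<le> (\<integral>y. \<bar>f y\<bar> \<partial>M)" by (rule integral_abs_bound)
  also have "\<dots> \<le> (\<integral>y. g y \<partial>M)" using assms by (intro integral_mono) auto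
  finally show ?thesis .
qed

lemma AE_lborel_neq: "AE y in lborel. y \<noteq> (x::real^3)"
  by (rule AE_lborel_singleton)

lemma ball_bounded_integrable:
  fixes f :: "real^3 \<Rightarrow> real"
  assumes "f \<in> borel_measurable borel" "\<And>y. norm y < 1 \<Longrightarrow> \<bar>f y\<bar> \<le> M"
  shows "integrable lborel (\<lambda>y. indicator (ball 0 1) y * f y)"
proof (rule Bochner_Integration.integrable_bound)
  have "integrable lborel (indicator (ball (0::real^3) 1) :: _ \<Rightarrow> real)"
    by (rule integrable_real_indicator) (use emeasure_lborel_ball_finite[of "0::real^3" 1] in simp_all)
  then show "integrable lborel (\<lambda>y. indicator (ball (0::real^3) 1) y * M)" by simp
  show "AE y in lborel. norm (indicator (ball 0 1) y * f y) \<le> norm (indicator (ball (0::real^3) 1) y * M)"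
    using assms(2) by (intro AE_I2) (auto simp: indicator_def abs_mult intro: order_trans[OF _ abs_ge_self])
qed (use assms in measurable)

lemma green_mult_integrable:
  assumes "norm x < 1" "F \<in> borel_measurable borel" "\<And>y. norm y < 1 \<Longrightarrow> \<bar>F y\<bar> \<le> M"
  shows "integrable lborel (\<lambda>y. indicator (ball 0 1) y * (green x y * F y))"
proof (rule ball_bounded_integrable)
  fix y :: "real^3" assume y: "norm y < 1"
  show "\<bar>green x y * F y\<bar> \<le> 2 * M" unfolding abs_mult
    using green_nonneg[OF assms(1) y] green_le_2[OF assms(1) y] assms(3)[OF y] by (intro mult_mono) auto
qed (use assms in measurable)

lemma green_diff_integral:
  assumes x: "norm x < 1" "norm x' < 1" and m: "wt x \<le> m" "wt x' \<le> m" "m \<le> 1"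
  shows "(\<integral>y. indicator (ball 0 1) y * \<bar>green x y - green x' y\<bar> \<partial>lborel)
     \<le> 88 * invsq_bound * m * norm (x - x')"
proof -
  let ?w = "\<lambda>y. 44 * m * norm (x - x') * (indicator (ball 0 1) y * invsq x y + indicator (ball 0 1) y * invsq x' y)"
  have i: "integrable lborel ?w"
    using x by (intro integrable_mult_right Bochner_Integration.integrable_add invsq_integrable)
  have "(\<integral>y. indicator (ball 0 1) y * \<bar>green x y - green x' y\<bar> \<partial>lborel) \<le> (\<integral>y. ?w y \<partial>lborel)"
  proof (rule integral_mono_AE[OF _ i])
    show "integrable lborel (\<lambda>y. indicator (ball 0 1) y * \<bar>green x y - green x' y\<bar>)"
    proof (rule ball_bounded_integrable)
      fix y :: "real^3" assume "norm y < 1"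
      then show "\<bar>\<bar>green x y - green x' y\<bar>\<bar> \<le> 2"
        using green_nonneg[of x y] green_nonneg[of x' y] green_le_2[of x y] green_le_2[of x' y] x by simp
    qed measurable
    show "AE y in lborel. indicator (ball 0 1) y * \<bar>green x y - green x' y\<bar> \<le> ?w y"
      using AE_lborel_neq[of x] AE_lborel_neq[of x']
    proof eventually_elim
      case (elim y)
      then show ?case using green_lipschitz[OF x(1) x(2) _ elim m] by (simp add: indicator_def)
    qed
  qed
  also have "\<dots> = 44 * m * norm (x - x') * ((\<integral>y. indicator (ball 0 1) y * invsq x y \<partial>lborel)
      + (\<integral>y. indicator (ball 0 1) y * invsq x' y \<partial>lborel))"
    using x by (simp add: invsq_integrable)
  also have "\<dots> \<le> 44 * m * norm (x - x') * (invsq_bound + invsq_bound)"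
    using x m wt_pos[of x] by (intro mult_left_mono add_mono invsq_integrable) auto
  finally show ?thesis by (simp add: algebra_simps)
qed

lemma green_potential_lipschitz:
  assumes x: "norm x < 1" "norm x' < 1"
    and F: "F \<in> borel_measurable borel" "\<And>y. norm y < 1 \<Longrightarrow> \<bar>F y\<bar> \<le> M"
  shows "\<bar>(\<integral>y. indicator (ball 0 1) y * (green x y * F y) \<partial>lborel) -
      (\<integral>y. indicator (ball 0 1) y * (green x' y * F y) \<partial>lborel)\<bar> \<le> 88 * invsq_bound * M * norm (x - x')"
proof -
  have M: "M \<ge> 0" using F(2)[of 0] by simp
  have fm: "F \<in> borel_measurable lborel" using F by simp
  note I = green_mult_integrable[OF x(1) F] green_mult_integrable[OF x(2) F]
  have iK: "integrable lborel (\<lambda>y. indicator (ball 0 1) y * \<bar>green x y - green x' y\<bar>)"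
  proof (rule ball_bounded_integrable)
    fix y :: "real^3" assume "norm y < 1"
    then show "\<bar>\<bar>green x y - green x' y\<bar>\<bar> \<le> 2"
      using green_nonneg[of x y] green_nonneg[of x' y] green_le_2[of x y] green_le_2[of x' y] x by simp
  qed measurable
  have "(\<integral>y. indicator (ball 0 1) y * (green x y * F y) \<partial>lborel) -
      (\<integral>y. indicator (ball 0 1) y * (green x' y * F y) \<partial>lborel) =
      (\<integral>y. indicator (ball 0 1) y * (green x y * F y) - indicator (ball 0 1) y * (green x' y * F y) \<partial>lborel)"
    using I by simp
  also have "\<bar>\<dots>\<bar> \<le> (\<integral>y. M * (indicator (ball 0 1) y * \<bar>green x y - green x' y\<bar>) \<partial>lborel)"
  proof (rule integral_abs_bound_mono)
    fix y
    show "\<bar>indicator (ball 0 1) y * (green x y * F y) - indicator (ball 0 1) y * (green x' y * F y)\<bar>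
       \<le> M * (indicator (ball 0 1) y * \<bar>green x y - green x' y\<bar>)"
    proof (cases "norm y < 1")
      case True
      then have "\<bar>green x y * F y - green x' y * F y\<bar> \<le> \<bar>green x y - green x' y\<bar> * M"
        unfolding left_diff_distrib[symmetric] abs_mult using F by (intro mult_left_mono) auto
      then show ?thesis using True by (simp add: mult.commute)
    qed simp
  qed (use I iK in auto)
  also have "\<dots> \<le> M * (88 * invsq_bound * 1 * norm (x - x'))"
    unfolding integral_mult_right_zero
    using M x by (intro mult_left_mono green_diff_integral wt_le_1) auto
  finally show ?thesis by (simp add: algebra_simps)
qed

section \<open>Moving planes\<close>

lemma norm_mirror_le:
  assumes "norm e = 1" "0 \<le> \<mu>" "\<mu> \<le> x \<bullet> e"
  shows "norm (mirror e \<mu> x) \<le> norm x"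
proof -
  have "(norm (mirror e \<mu> x))\<^sup>2 \<le> (norm x)\<^sup>2"
    using assms by (simp add: norm_mirror_sq)
  then show ?thesis by (rule power2_le_imp_le) simp
qed

lemma mirror_diff_levels: "norm e = 1 \<Longrightarrow> norm (mirror e \<mu> y - mirror e \<nu> y) = 2 * \<bar>\<mu> - \<nu>\<bar>"
proof -
  assume e: "norm e = 1"
  have "mirror e \<mu> y - mirror e \<nu> y = (2 * (\<mu> - \<nu>)) *\<^sub>R e"
    by (simp add: mirror_def algebra_simps)
  then show ?thesis using e by (simp add: abs_if)
qed

text \<open>The integral equation carries both the differential equation and the boundary data.
  \<open>ft\<close> stands for \<open>f\<close> continued below \<open>\<epsilon>\<close> by its
  value there, which makes the integrand bounded and defined for every value of
  \<open>h - u\<close>; \<open>k\<close> is the reciprocal of the normalising constant.\<close>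

locale green_fixed_point =
  fixes k a b M :: real and ft :: "real \<Rightarrow> real" and u :: "real^3 \<Rightarrow> real"
  assumes k_pos: "k > 0" and b_pos: "b > 0"
    and ft_cont: "continuous_on UNIV ft"
    and ft_antimono: "\<And>s t. s \<le> t \<Longrightarrow> ft t \<le> ft s"
    and ft_pos: "\<And>t. ft t > 0" and ft_le: "\<And>t. ft t \<le> M"
    and u_cont: "continuous_on (ball 0 1) u"
    and u_eq: "\<And>x. norm x < 1 \<Longrightarrow> u x = k * (\<integral>y. indicator (ball 0 1) y *
        (green x y * ft (a + b * ((norm y)\<^sup>2 - 1) / 2 - u y)) \<partial>lborel)"
begin

definition h :: "real^3 \<Rightarrow> real" where "h y = a + b * ((norm y)\<^sup>2 - 1) / 2"

definition F :: "real^3 \<Rightarrow> real" where "F y = indicator (ball 0 1) y * ft (h y - u y)"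

lemma F_eq: "norm y < 1 \<Longrightarrow> F y = ft (h y - u y)"
  by (simp add: F_def)

lemma F_borel [measurable]: "F \<in> borel_measurable borel"
proof -
  have "continuous_on (ball 0 1) (\<lambda>y. ft (h y - u y))"
    unfolding h_def by (intro continuous_on_compose2[OF ft_cont] continuous_intros u_cont) auto
  then have "(\<lambda>y. indicator (ball 0 1) y *\<^sub>R ft (h y - u y)) \<in> borel_measurable borel"
    by (intro borel_measurable_continuous_on_indicator) auto
  then show ?thesis unfolding F_def[abs_def] by simp
qed

lemma M_pos: "M > 0"
  using ft_pos[of 0] ft_le[of 0] by linarith

lemma F_nonneg: "F y \<ge> 0" and F_le: "F y \<le> M"
  using ft_pos[of "h y - u y"] ft_le[of "h y - u y"] M_pos
  by (auto simp: F_def indicator_def less_imp_le)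

lemma F_abs: "\<bar>F y\<bar> \<le> M"
  using F_nonneg F_le by simp

lemma u_F: "norm x < 1 \<Longrightarrow> u x = k * (\<integral>y. indicator (ball 0 1) y * (green x y * F y) \<partial>lborel)"
  unfolding u_eq F_def h_def
  by (intro arg_cong[where f = "(*) k"] Bochner_Integration.integral_cong) (auto simp: indicator_def)

lemma u_nonneg:
  assumes "norm x < 1"
  shows "u x \<ge> 0"
proof -
  have "0 \<le> indicator (ball 0 1) y * (green x y * F y)" for y
    using assms by (cases "norm y < 1") (auto simp: green_nonneg F_nonneg)
  then have "0 \<le> (\<integral>y. indicator (ball 0 1) y * (green x y * F y) \<partial>lborel)"
    by (intro Bochner_Integration.integral_nonneg)
  then show ?thesis unfolding u_F[OF assms] using k_pos by simp
qed

lemma u_lipschitz: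
  assumes "norm x < 1" "norm x' < 1"
  shows "\<bar>u x - u x'\<bar> \<le> k * (88 * invsq_bound * M) * norm (x - x')"
proof -
  have "\<bar>u x - u x'\<bar> = k * \<bar>(\<integral>y. indicator (ball 0 1) y * (green x y * F y) \<partial>lborel) -
      (\<integral>y. indicator (ball 0 1) y * (green x' y * F y) \<partial>lborel)\<bar>"
    using k_pos unfolding u_F[OF assms(1)] u_F[OF assms(2)]
    by (simp add: abs_mult flip: right_diff_distrib)
  also have "\<dots> \<le> k * (88 * invsq_bound * M * norm (x - x'))"
    using k_pos F_abs assms by (intro mult_left_mono green_potential_lipschitz) auto
  finally show ?thesis by simp
qed

lemma h_eq_wt: "h y = a - b * wt y / 2"
  by (simp add: h_def wt_def field_simps)

text \<open>In the ball \<open>h\<close> lies below \<open>a\<close> and \<open>u\<close> is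
  non-negative. The resulting positive lower bound turns the kernel gain over the cap into a gain
  for \<open>u\<close>.\<close>

lemma F_ge: "norm y < 1 \<Longrightarrow> ft a \<le> F y"
  unfolding F_eq using u_nonneg[of y] mult_pos_pos[OF b_pos wt_pos[of y]]
  by (intro ft_antimono) (simp add: h_eq_wt)

text \<open>The Lipschitz bound for \<open>u\<close> is uniform over the open ball, so
  \<open>h - u\<close> is Lipschitz with values in a compact interval, on which \<open>ft\<close> is
  uniformly continuous.\<close>

lemma F_unif_cont:
  assumes "\<eta> > 0"
  obtains \<delta> where "\<delta> > 0"
    "\<And>y y'. norm y < 1 \<Longrightarrow> norm y' < 1 \<Longrightarrow> norm (y - y') < \<delta> \<Longrightarrow> \<bar>F y - F y'\<bar> < \<eta>"
proof -
  define L where "L = b + k * (88 * invsq_bound * M) + 1"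
  have L: "L > 0" using b_pos k_pos invsq_bound_nonneg M_pos by (simp add: L_def add_pos_pos add_pos_nonneg)
  define c where "c = \<bar>a\<bar> + 2 * L + \<bar>u 0\<bar>"
  have lip: "\<bar>(h y - u y) - (h y' - u y')\<bar> \<le> L * norm (y - y')" if "norm y < 1" "norm y' < 1" for y y'
  proof -
    have "h y - h y' = b * (wt y' - wt y) / 2" by (simp add: h_eq_wt field_simps)
    then have "\<bar>h y - h y'\<bar> = \<bar>b * (wt y' - wt y) / 2\<bar>" by (rule arg_cong)
    also have "\<dots> = b * \<bar>wt y' - wt y\<bar> / 2" using b_pos by (simp add: abs_mult)
    also have "\<dots> \<le> b * (2 * norm (y' - y)) / 2"
      using b_pos wt_lipschitz[OF that(2) that(1)] by (intro divide_right_mono mult_left_mono) simp_all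
    finally have "\<bar>h y - h y'\<bar> \<le> b * norm (y - y')" by (simp add: norm_minus_commute)
    moreover have "\<bar>u y - u y'\<bar> \<le> k * (88 * invsq_bound * M) * norm (y - y')"
      by (rule u_lipschitz[OF that])
    moreover have "L * norm (y - y') = b * norm (y - y') + k * (88 * invsq_bound * M) * norm (y - y') + norm (y - y')"
      by (simp add: L_def algebra_simps)
    ultimately show ?thesis using norm_ge_zero[of "y - y'"] by linarith
  qed
  have rng: "h y - u y \<in> {-c..c}" if "norm y < 1" for y
  proof -
    have "\<bar>(h y - u y) - (h 0 - u 0)\<bar> \<le> L * norm (y - 0)" using lip[of y 0] that by simp
    also have "\<dots> \<le> L * 1" using L that by (intro mult_left_mono) auto
    finally have "\<bar>(h y - u y) - (h 0 - u 0)\<bar> \<le> L" by simp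
    moreover have "\<bar>h 0\<bar> \<le> \<bar>a\<bar> + L"
    proof -
      have "b \<le> L" using k_pos invsq_bound_nonneg M_pos by (simp add: L_def)
      then show ?thesis using b_pos by (simp add: h_def)
    qed
    ultimately show ?thesis by (simp add: c_def) linarith
  qed
  have "uniformly_continuous_on {-c..c} ft"
    by (intro compact_uniformly_continuous continuous_on_subset[OF ft_cont]) auto
  then obtain d where d: "d > 0"
    "\<And>s t. s \<in> {-c..c} \<Longrightarrow> t \<in> {-c..c} \<Longrightarrow> dist t s < d \<Longrightarrow> dist (ft t) (ft s) < \<eta>"
    using assms unfolding uniformly_continuous_on_def by metis
  show ?thesis
  proof (rule that[of "d / L"])
    fix y y' :: "real^3" assume y: "norm y < 1" "norm y' < 1" "norm (y - y') < d / L"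
    have "\<bar>(h y - u y) - (h y' - u y')\<bar> < d"
      using lip[OF y(1,2)] y(3) L by (simp add: pos_less_divide_eq mult.commute)
    then show "\<bar>F y - F y'\<bar> < \<eta>"
      using d(2)[OF rng[OF y(2)] rng[OF y(1)]] y by (simp add: F_eq dist_real_def)
  qed (use d L in simp)
qed

section \<open>Reflection order with respect to a plane and its propagation to lower planes\<close>

definition half_plane_order :: "real^3 \<Rightarrow> real \<Rightarrow> bool" where
  "half_plane_order e \<nu> \<longleftrightarrow> (\<forall>x. norm x < 1 \<and> x \<bullet> e > \<nu> \<longrightarrow> u x \<le> u (mirror e \<nu> x))"

text \<open>Where \<open>y \<bullet> e \<le> 0\<close>, reflection in the plane at a level
  \<open>\<mu> > 0\<close> raises \<open>(norm y)\<^sup>2\<close> by at least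
  \<open>4 * \<mu>\<^sup>2\<close>. Points of the cap are thus carried out of the ball, and the
  kernel gain at them has no partner in the ball that could offset it.\<close>

definition cap :: "real^3 \<Rightarrow> real \<Rightarrow> (real^3) set" where
  "cap e \<mu> = {y. norm y < 1 \<and> y \<bullet> e \<le> 0 \<and> 1 - 4 * \<mu>\<^sup>2 \<le> (norm y)\<^sup>2}"

lemma cap_borel [measurable]: "cap e \<mu> \<in> sets borel"
  unfolding cap_def by measurable

definition cap_mass :: "real^3 \<Rightarrow> real \<Rightarrow> real" where
  "cap_mass e \<mu> = (\<integral>y. indicator (ball 0 1) y * (indicator (cap e \<mu>) y * (wt y)\<^sup>2) \<partial>lborel)"

lemma cap_integrable: "integrable lborel (\<lambda>y. indicator (ball 0 1) y * (indicator (cap e \<mu>) y * (wt y)\<^sup>2))"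
proof (rule ball_bounded_integrable)
  fix y :: "real^3" assume "norm y < 1"
  then have "(wt y)\<^sup>2 \<le> 1" using wt_pos[of y] wt_le_1[of y] by (intro power_le_one) auto
  then show "\<bar>indicator (cap e \<mu>) y * (wt y)\<^sup>2\<bar> \<le> 1" by (simp add: indicator_def)
qed measurable

lemma cap_mass_pos:
  assumes e: "norm e = 1" and \<mu>: "0 < \<mu>"
  shows "cap_mass e \<mu> > 0"
proof -
  let ?g = "\<lambda>y. indicator (ball 0 1) y * (indicator (cap e \<mu>) y * (wt y)\<^sup>2)"
  have nn: "AE y in lborel. 0 \<le> ?g y" by simp
  have "cap_mass e \<mu> \<noteq> 0"
  proof
    assume "cap_mass e \<mu> = 0"
    then have ae: "AE y in lborel. ?g y = 0"
      unfolding cap_mass_def using integral_nonneg_eq_0_iff_AE[OF cap_integrable nn] by blast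
    define U where "U = {y::real^3. norm y < 1 \<and> y \<bullet> e < 0 \<and> 1 - 4 * \<mu>\<^sup>2 < (norm y)\<^sup>2}"
    have "U = {y. norm y < 1} \<inter> {y. y \<bullet> e < 0} \<inter> {y. 1 - 4 * \<mu>\<^sup>2 < (norm y)\<^sup>2}"
      by (auto simp: U_def)
    then have opn: "open U" by (auto intro!: open_Int open_Collect_less continuous_intros)
    \<comment> \<open>The square of \<open>r\<close> has to lie strictly between
      \<open>1 - 4 * \<mu>\<^sup>2\<close> and 1; the maximum with 1/2 keeps \<open>r\<close>
      positive for large \<open>\<mu>\<close>.\<close>
    define r where "r = sqrt (max (1/2) (1 - 2 * \<mu>\<^sup>2))"
    have r: "r\<^sup>2 = max (1/2) (1 - 2 * \<mu>\<^sup>2)" "r > 0" by (auto simp: r_def)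
    have "r < 1" using \<mu> by (simp add: r_def)
    then have "- r *\<^sub>R e \<in> U"
      using e r zero_less_power[OF \<mu>, of 2] by (auto simp: U_def less_max_iff_disj power_mult_distrib simp flip: power2_norm_eq_inner)
    then have "U \<noteq> {}" by blast
    then have pos: "emeasure lborel U \<noteq> 0"
      using opn open_not_negligible[OF opn] by (simp add: negligible_iff_null_sets null_sets_def)
    have "AE y in lborel. y \<notin> U"
      using ae
    proof eventually_elim
      case (elim y)
      show ?case
      proof
        assume "y \<in> U"
        then have y: "y \<in> cap e \<mu>" "norm y < 1" by (auto simp: U_def cap_def)
        then have "?g y = (wt y)\<^sup>2" by simp
        then show False using elim wt_pos[OF y(2)] by simp
      qed
    qed
    then have "U \<in> null_sets lborel"
      using opn by (subst (asm) AE_iff_null_sets[symmetric]) auto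
    then show False using pos by (simp add: null_sets_def)
  qed
  moreover have "cap_mass e \<mu> \<ge> 0" unfolding cap_mass_def by (intro integral_nonneg_AE nn)
  ultimately show ?thesis by simp
qed

text \<open>Passing from \<open>x\<close> to \<open>x'\<close> raises \<open>wt\<close> by
  \<open>2 * \<mu> * norm (x - x')\<close>, and for \<open>y \<bullet> e \<le> 0\<close> it lowers
  both distances in \<open>hker\<close>. The growth of the squared weight, multiplied by the bound
  of \<open>hker_ge\<close>, already gives the claim.\<close>

lemma green_cap_ge:
  assumes e: "norm e = 1" and \<mu>: "0 < \<mu>0" "\<mu>0 \<le> \<mu>" and x: "norm x < 1" "x \<bullet> e > \<mu>"
    and y: "norm y < 1" "y \<bullet> e \<le> 0"
  defines "x' \<equiv> mirror e \<mu> x"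
  shows "2 * \<mu>0 * norm (x - x') * wt x' * ((wt y)\<^sup>2 / 32) \<le> green x' y - green x y"
proof -
  have x': "norm x' < 1" using norm_mirror_le[OF e, of \<mu> x] x \<mu> by (simp add: x'_def)
  have n: "norm (x - x') = 2 * (x \<bullet> e - \<mu>)" using x norm_diff_mirror[OF e] by (simp add: x'_def)
  have w: "wt x' = wt x + 2 * \<mu> * norm (x - x')" unfolding n by (simp add: x'_def wt_mirror[OF e])
  have p: "wt x > 0" "wt x' > 0" "wt y > 0" using x x' y wt_pos by auto
  have cd: "(conj_dist x' y)\<^sup>2 \<le> (conj_dist x y)\<^sup>2"
  proof -
    have "x' \<bullet> y = x \<bullet> y - norm (x - x') * (y \<bullet> e)"
      unfolding n by (simp add: x'_def mirror_def inner_diff_left inner_commute[of e y])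
    moreover have "(norm x')\<^sup>2 \<le> (norm x)\<^sup>2"
      using norm_mirror_le[OF e, of \<mu> x] x \<mu> by (intro power_mono) (simp_all add: x'_def)
    then have "(norm x')\<^sup>2 * (norm y)\<^sup>2 \<le> (norm x)\<^sup>2 * (norm y)\<^sup>2" by (intro mult_right_mono) auto
    moreover have "norm (x - x') * (y \<bullet> e) \<le> 0" using y by (intro mult_nonneg_nonpos) auto
    ultimately show ?thesis unfolding conj_dist_sq[OF x(1) y(1)] conj_dist_sq[OF x' y(1)] by linarith
  qed
  have cd': "conj_dist x' y \<le> conj_dist x y"
    using cd conj_dist_pos[OF x(1) y(1)] by (meson less_imp_le power2_le_imp_le)
  have "4 * (x \<bullet> e - \<mu>) * (y \<bullet> e - \<mu>) \<le> 0" using x y \<mu> by (intro mult_nonneg_nonpos) auto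
  then have "(norm (x' - y))\<^sup>2 \<le> (norm (x - y))\<^sup>2" unfolding x'_def dist_mirror_sq[OF e] by simp
  then have nd: "norm (x' - y) \<le> norm (x - y)" by (rule power2_le_imp_le) simp
  have "hker x y \<le> hker x' y"
  proof -
    have A: "conj_dist x' y * (conj_dist x' y + norm (x' - y))\<^sup>2 \<le> conj_dist x y * (conj_dist x y + norm (x - y))\<^sup>2"
      using cd' nd conj_dist_pos[OF x' y(1)] by (intro mult_mono power_mono add_mono) auto
    have "conj_dist x' y * (conj_dist x' y + norm (x' - y))\<^sup>2 > 0"
      using conj_dist_pos[OF x' y(1)] by (intro mult_pos_pos zero_less_power add_pos_nonneg) auto
    then show ?thesis unfolding hker_def using A by (intro frac_le) auto
  qed
  then have "(wt x)\<^sup>2 * hker x y \<le> (wt x)\<^sup>2 * hker x' y" by (intro mult_left_mono) auto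
  then have "((wt x')\<^sup>2 - (wt x)\<^sup>2) * hker x' y \<le> green x' y - green x y"
    using x x' y by (simp add: green_hker algebra_simps)
  moreover have "2 * \<mu>0 * norm (x - x') * wt x' \<le> (wt x')\<^sup>2 - (wt x)\<^sup>2"
  proof -
    have "(wt x')\<^sup>2 - (wt x)\<^sup>2 = (wt x' - wt x) * (wt x' + wt x)" by (simp add: algebra_simps power2_eq_square)
    moreover have "2 * \<mu>0 * norm (x - x') * wt x' \<le> (2 * \<mu> * norm (x - x')) * (wt x' + wt x)"
      using p \<mu> by (intro mult_mono) auto
    ultimately show ?thesis using w by simp
  qed
  then have "2 * \<mu>0 * norm (x - x') * wt x' * ((wt y)\<^sup>2 / 32) \<le> ((wt x')\<^sup>2 - (wt x)\<^sup>2) * hker x' y"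
    using p \<mu> hker_ge[OF x' y(1)] w by (intro mult_mono) auto
  ultimately show ?thesis by linarith
qed

text \<open>
  Lowering the plane from \<open>\<nu>\<close> to \<open>\<mu>\<close> costs at most \<open>\<eta>\<close> in the comparison of \<open>F\<close> with its
  reflection. This loss is proportional to \<open>norm (x - x') * wt x'\<close>, and so is the gain from the
  cap of points whose reflection leaves the ball; the gain does not depend on \<open>\<eta>\<close>.
\<close>

lemma half_plane_order_step:
  assumes e: "norm e = 1" and \<mu>0: "0 < \<mu>0"
  obtains \<tau> where "\<tau> > 0" "\<And>\<nu> \<mu>. \<mu>0 \<le> \<mu> \<Longrightarrow> \<mu> \<le> \<nu> \<Longrightarrow> \<nu> - \<mu> < \<tau> \<Longrightarrow>
    half_plane_order e \<nu> \<Longrightarrow> half_plane_order e \<mu>"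
proof -
  \<comment> \<open>\<open>c * D\<close> will be the integral of the gain over the cap, and
    \<open>C * D\<close> a bound for the integral of the absolute kernel difference, with the same
    \<open>D\<close>. The tolerance \<open>\<eta> = c / C\<close> balances them; the summand 1 in
    \<open>C\<close> ensures that it is positive.\<close>
  define c where "c = 2 * \<mu>0 / 32 * ft a * cap_mass e \<mu>0"
  have c: "c > 0" using \<mu>0 ft_pos cap_mass_pos[OF e \<mu>0] by (simp add: c_def)
  define C where "C = 88 * invsq_bound + 1"
  have C: "C > 0" using invsq_bound_nonneg by (simp add: C_def)
  define \<eta> where "\<eta> = c / C"
  have \<eta>: "\<eta> > 0" using c C by (simp add: \<eta>_def)
  obtain \<delta> where \<delta>: "\<delta> > 0"
    "\<And>y y'. norm y < 1 \<Longrightarrow> norm y' < 1 \<Longrightarrow> norm (y - y') < \<delta> \<Longrightarrow> \<bar>F y - F y'\<bar> < \<eta>"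
    using F_unif_cont[OF \<eta>] by blast
  show ?thesis
  \<comment> \<open>The mirror images of a point in the planes at levels \<open>\<mu>\<close> and
    \<open>\<nu>\<close> are \<open>2 * (\<nu> - \<mu>)\<close> apart, and a point between the
    planes moves by at most this much. Hence half of \<open>\<delta>\<close>.\<close>
  proof (rule that[of "\<delta> / 2"])
    fix \<nu> \<mu> assume le: "\<mu>0 \<le> \<mu>" "\<mu> \<le> \<nu>" "\<nu> - \<mu> < \<delta> / 2" and ho: "half_plane_order e \<nu>"
    show "half_plane_order e \<mu>"
      unfolding half_plane_order_def
    proof (intro allI impI, elim conjE)
      fix x assume x: "norm x < 1" "x \<bullet> e > \<mu>"
      define x' where "x' = mirror e \<mu> x"
      have x': "norm x' < 1" using norm_mirror_le[OF e, of \<mu> x] x \<mu>0 le by (simp add: x'_def)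
      define D where "D = norm (x - x') * wt x'"
      have D: "D \<ge> 0" using wt_pos[OF x'] by (simp add: D_def)
      define K where "K y = green x' y - green x y" for y
      define \<Phi> where "\<Phi> y = indicator (ball 0 1) y * (K y * F y)" for y
      define \<kappa> where "\<kappa> y = indicator (ball 0 1) y * \<bar>K y\<bar>" for y
      define L where "L y = 2 * \<mu>0 / 32 * ft a * D * (indicator (ball 0 1) y * (indicator (cap e \<mu>0) y * (wt y)\<^sup>2))" for y
      have mpos: "\<mu> > 0" using \<mu>0 le by simp
      have \<kappa>0: "\<kappa> y \<ge> 0" for y by (simp add: \<kappa>_def)
      \<comment> \<open>Beyond the old plane, the order at \<open>\<nu>\<close> compares
        \<open>y\<close> with its old image, which is close to the new one. Between the planes,
        \<open>y\<close> itself is close to its image.\<close>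
      have F_mirror: "F y - \<eta> \<le> F (mirror e \<mu> y)" if y: "norm y < 1" "y \<bullet> e \<ge> \<mu>" for y
      proof -
        have ny: "norm (mirror e \<mu> y) < 1" using norm_mirror_le[OF e, of \<mu> y] y mpos by simp
        show ?thesis
        proof (cases "y \<bullet> e > \<nu>")
          case True
          have nl: "norm (mirror e \<nu> y) < 1" "norm (mirror e \<nu> y) \<le> norm y"
            using norm_mirror_le[OF e, of \<nu> y] y True mpos le by auto
          have "u y \<le> u (mirror e \<nu> y)" using ho y True by (simp add: half_plane_order_def)
          moreover have "wt y \<le> wt (mirror e \<nu> y)" using nl by (simp add: wt_def power_mono)
          then have "h (mirror e \<nu> y) \<le> h y" using b_pos by (simp add: h_eq_wt)
          ultimately have "F y \<le> F (mirror e \<nu> y)"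
            unfolding F_eq[OF y(1)] F_eq[OF nl(1)] by (intro ft_antimono) linarith
          moreover have "\<bar>F (mirror e \<mu> y) - F (mirror e \<nu> y)\<bar> < \<eta>"
            using le by (intro \<delta>(2) ny nl) (simp add: mirror_diff_levels[OF e])
          ultimately show ?thesis by linarith
        next
          case False
          have "\<bar>F y - F (mirror e \<mu> y)\<bar> < \<eta>"
            using le False y by (intro \<delta>(2) y ny) (simp add: norm_diff_mirror[OF e])
          then show ?thesis by linarith
        qed
      qed
      \<comment> \<open>Points are paired across the plane. As \<open>y'\<close> has the smaller
        norm, either both points are outside the ball, or only \<open>y'\<close> is inside and its
        kernel difference is non-negative, or both are inside and have to be balanced.\<close>
      have upper: "\<Phi> y + \<Phi> (mirror e \<mu> y) \<ge> - \<eta> * (\<kappa> y + \<kappa> (mirror e \<mu> y)) + (L y + L (mirror e \<mu> y))"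
        if ye: "y \<bullet> e \<ge> \<mu>" for y
      proof -
        define y' where "y' = mirror e \<mu> y"
        have y'e: "y' \<bullet> e \<le> \<mu>" using ye by (simp add: y'_def mirror_inner[OF e])
        have ny: "norm y' \<le> norm y" unfolding y'_def using mpos ye by (intro norm_mirror_le[OF e]) auto
        have Ly: "L y = 0" using ye mpos by (simp add: L_def cap_def)
        have Ky': "K y' \<ge> 0" if "norm y' < 1"
          using green_mirror_mono[OF e _ x(1) that x(2) y'e] mpos by (simp add: K_def x'_def)
        show ?thesis unfolding y'_def[symmetric]
        proof (cases "norm y' < 1")
          case False
          then have "norm y \<ge> 1" using ny by linarith
          then show "\<Phi> y + \<Phi> y' \<ge> - \<eta> * (\<kappa> y + \<kappa> y') + (L y + L y')"
            using False Ly by (simp add: \<Phi>_def \<kappa>_def L_def)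
        next
          case y'1: True
          show "\<Phi> y + \<Phi> y' \<ge> - \<eta> * (\<kappa> y + \<kappa> y') + (L y + L y')"
          proof (cases "norm y < 1")
            case False
            have "L y' \<le> K y' * F y'"
            proof (cases "y' \<in> cap e \<mu>0")
              case True
              then have "L y' = (2 * \<mu>0 * norm (x - x') * wt x' * ((wt y')\<^sup>2 / 32)) * ft a"
                using y'1 by (simp add: L_def D_def)
              also have "\<dots> \<le> K y' * F y'"
                using green_cap_ge[OF e \<mu>0 le(1) x y'1] True F_ge[OF y'1] Ky'[OF y'1] ft_pos[of a]
                unfolding K_def x'_def by (intro mult_mono) (auto simp: cap_def less_imp_le)
              finally show ?thesis .
            qed (use Ky'[OF y'1] F_nonneg[of y'] in \<open>simp add: L_def\<close>)
            moreover have "\<eta> * \<kappa> y' \<ge> 0" using \<eta> \<kappa>0 by simp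
            ultimately show ?thesis using False y'1 Ly by (simp add: \<Phi>_def \<kappa>_def)
          next
            case y1: True
            \<comment> \<open>Cap points are reflected out of the ball at level
              \<open>\<mu>0\<close>, and all the more at \<open>\<mu>\<close>. Since
              \<open>y\<close> is in the ball, its image is not in the cap.\<close>
            have "L y' = 0"
            proof (cases "y' \<bullet> e \<le> 0")
              case True
              then have "y \<bullet> e - \<mu> \<ge> \<mu>" by (simp add: y'_def mirror_inner[OF e])
              then have "4 * \<mu> * (y \<bullet> e - \<mu>) \<ge> 4 * \<mu> * \<mu>" using mpos by simp
              moreover have "\<mu>0 * \<mu>0 \<le> \<mu> * \<mu>" using \<mu>0 le by (intro mult_mono) auto
              moreover have "(norm y)\<^sup>2 < 1" using y1 wt_pos[of y] by (simp add: wt_def)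
              ultimately have "(norm y')\<^sup>2 < 1 - 4 * \<mu>0\<^sup>2"
                unfolding y'_def norm_mirror_sq[OF e] power2_eq_square[of \<mu>0] by linarith
              then show ?thesis by (simp add: L_def cap_def)
            qed (simp add: L_def cap_def)
            \<comment> \<open>Weighting both kernel differences with \<open>F y\<close> gives a
              non-negative sum. Replacing \<open>F y\<close> by \<open>F y'\<close> at the image
              costs at most \<open>\<eta> * K y'\<close>, because \<open>K y'\<close> is
              non-negative.\<close>
            have "K y + K y' \<ge> 0"
              using green_mirror_sum[OF e _ x(1) y1 x(2) ye] mpos by (simp add: K_def x'_def y'_def)
            then have "0 \<le> (K y + K y') * F y" using F_nonneg by simp
            moreover have "K y' * (F y - \<eta>) \<le> K y' * F y'"
              using F_mirror[OF y1 ye] Ky'[OF y'1] unfolding y'_def by (intro mult_left_mono) auto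
            moreover have "\<eta> * \<kappa> y \<ge> 0" using \<eta> \<kappa>0 by simp
            moreover have "\<kappa> y' = K y'" using Ky'[OF y'1] y'1 by (simp add: \<kappa>_def)
            ultimately show ?thesis using y1 y'1 Ly \<open>L y' = 0\<close> by (simp add: \<Phi>_def algebra_simps)
          qed
        qed
      qed
      have pointwise: "\<Phi> y + \<Phi> (mirror e \<mu> y) \<ge> - \<eta> * (\<kappa> y + \<kappa> (mirror e \<mu> y)) + (L y + L (mirror e \<mu> y))" for y
      proof (cases "y \<bullet> e \<ge> \<mu>")
        case False
        then have "mirror e \<mu> y \<bullet> e \<ge> \<mu>" by (simp add: mirror_inner[OF e])
        from upper[OF this] show ?thesis by (simp add: mirror_mirror[OF e] add.commute)
      qed (rule upper)
      have Km [measurable]: "K \<in> borel_measurable borel" unfolding K_def[abs_def] by measurable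
      have Kb: "\<bar>K y\<bar> \<le> 2" if "norm y < 1" for y
        unfolding K_def using green_nonneg[of x y] green_nonneg[of x' y] green_le_2[of x y] green_le_2[of x' y]
          x x' that by simp
      have i\<Phi>: "integrable lborel \<Phi>" unfolding \<Phi>_def[abs_def]
      proof (rule ball_bounded_integrable)
        fix y :: "real^3" assume "norm y < 1"
        then show "\<bar>K y * F y\<bar> \<le> 2 * M" unfolding abs_mult using Kb F_abs by (intro mult_mono) auto
      qed measurable
      have i\<kappa>: "integrable lborel \<kappa>" unfolding \<kappa>_def[abs_def]
        by (rule ball_bounded_integrable[of _ 2]) (use Kb in auto)
      have iL: "integrable lborel L" unfolding L_def[abs_def] using cap_integrable by simp
      have m: "\<Phi> \<in> borel_measurable borel" "\<kappa> \<in> borel_measurable borel" "L \<in> borel_measurable borel"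
        using i\<Phi> i\<kappa> iL by (auto dest: borel_measurable_integrable)
      have i': "integrable lborel (\<lambda>y. \<Phi> (mirror e \<mu> y))" "integrable lborel (\<lambda>y. \<kappa> (mirror e \<mu> y))"
          "integrable lborel (\<lambda>y. L (mirror e \<mu> y))"
        using m i\<Phi> i\<kappa> iL by (simp_all add: integral_mirror[OF e])
      \<comment> \<open>Reflection preserves integrals, so every term is counted twice and a common
        factor 2 cancels.\<close>
      have "(\<integral>y. - \<eta> * (\<kappa> y + \<kappa> (mirror e \<mu> y)) + (L y + L (mirror e \<mu> y)) \<partial>lborel)
         \<le> (\<integral>y. \<Phi> y + \<Phi> (mirror e \<mu> y) \<partial>lborel)"
        by (intro integral_mono pointwise Bochner_Integration.integrable_add integrable_mult_right i\<Phi> i\<kappa> iL i')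
      then have I: "- \<eta> * (\<integral>y. \<kappa> y \<partial>lborel) + (\<integral>y. L y \<partial>lborel) \<le> (\<integral>y. \<Phi> y \<partial>lborel)"
        using i\<Phi> i\<kappa> iL i' m by (simp add: integral_mirror[OF e] algebra_simps)
      \<comment> \<open>With \<open>m\<close> equal to \<open>wt x'\<close>, the larger of the two
        weights, the Lipschitz estimate carries the same factor \<open>D\<close> as the
        gain.\<close>
      have "(\<integral>y. \<kappa> y \<partial>lborel) \<le> 88 * invsq_bound * wt x' * norm (x' - x)"
        unfolding \<kappa>_def K_def
      proof (rule green_diff_integral[OF x' x(1) order_refl _ wt_le_1])
        show "wt x \<le> wt x'" using x mpos by (simp add: x'_def wt_mirror[OF e])
      qed
      also have "\<dots> = 88 * invsq_bound * D" by (simp add: D_def norm_minus_commute)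
      also have "\<dots> \<le> C * D" using D by (simp add: C_def algebra_simps)
      finally have "\<eta> * (\<integral>y. \<kappa> y \<partial>lborel) \<le> \<eta> * (C * D)" using \<eta> by (intro mult_left_mono) auto
      also have "\<dots> = c * D" using C by (simp add: \<eta>_def)
      also have "\<dots> = (\<integral>y. L y \<partial>lborel)"
        unfolding L_def integral_mult_right_zero cap_mass_def[symmetric] c_def by simp
      finally have "(\<integral>y. \<Phi> y \<partial>lborel) \<ge> 0" using I by linarith
      moreover have "u x' - u x = k * (\<integral>y. \<Phi> y \<partial>lborel)"
      proof -
        have "(\<integral>y. \<Phi> y \<partial>lborel) = (\<integral>y. indicator (ball 0 1) y * (green x' y * F y)
            - indicator (ball 0 1) y * (green x y * F y) \<partial>lborel)"
          unfolding \<Phi>_def K_def by (simp add: algebra_simps)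
        also have "\<dots> = (\<integral>y. indicator (ball 0 1) y * (green x' y * F y) \<partial>lborel)
            - (\<integral>y. indicator (ball 0 1) y * (green x y * F y) \<partial>lborel)"
          using green_mult_integrable[OF x(1) F_borel F_abs] green_mult_integrable[OF x' F_borel F_abs] by simp
        finally show ?thesis using x x' by (simp add: u_F right_diff_distrib)
      qed
      ultimately show "u x \<le> u (mirror e \<mu> x)" using k_pos unfolding x'_def[symmetric]
        by (metis diff_ge_0_iff_ge mult_nonneg_nonneg less_imp_le)
    qed
  qed (use \<delta> in simp)
qed

text \<open>At levels of at least 1 there are no points of the ball beyond the plane. The admissible
  step length is fixed once the target level \<open>\<mu>\<close> is, so finitely many steps of
  length \<open>\<tau> / 2\<close> come down to it.\<close>

lemma half_plane_order_pos:
  assumes e: "norm e = 1" and \<mu>: "0 < \<mu>"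
  shows "half_plane_order e \<mu>"
proof -
  obtain \<tau> where \<tau>: "\<tau> > 0" "\<And>\<nu> \<mu>'. \<mu> \<le> \<mu>' \<Longrightarrow> \<mu>' \<le> \<nu> \<Longrightarrow> \<nu> - \<mu>' < \<tau> \<Longrightarrow>
    half_plane_order e \<nu> \<Longrightarrow> half_plane_order e \<mu>'"
    using half_plane_order_step[OF e \<mu>] by blast
  have base: "half_plane_order e \<nu>" if "\<nu> \<ge> 1" for \<nu>
    unfolding half_plane_order_def
  proof (intro allI impI, elim conjE)
    fix x assume "norm x < 1" "x \<bullet> e > \<nu>"
    moreover have "x \<bullet> e \<le> norm x * norm e" by (rule norm_cauchy_schwarz)
    ultimately show "u x \<le> u (mirror e \<nu> x)" using that e by simp
  qed
  have "half_plane_order e (max \<mu> (1 - real n * (\<tau> / 2)))" for n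
  proof (induction n)
    case 0
    show ?case by (rule base) simp
  next
    case (Suc n)
    show ?case
    proof (rule \<tau>(2)[OF _ _ _ Suc.IH])
      show "max \<mu> (1 - real (Suc n) * (\<tau> / 2)) \<le> max \<mu> (1 - real n * (\<tau> / 2))"
        using \<tau>(1) by (intro max.mono) (simp_all add: algebra_simps)
      define B where "B = 1 - real (Suc n) * (\<tau> / 2)"
      have "1 - real n * (\<tau> / 2) = B + \<tau> / 2" by (simp add: B_def field_simps)
      then show "max \<mu> (1 - real n * (\<tau> / 2)) - max \<mu> (1 - real (Suc n) * (\<tau> / 2)) < \<tau>"
        unfolding B_def[symmetric] using \<tau>(1) by (simp add: max_def)
    qed simp
  qed
  moreover obtain n where "real n * (\<tau> / 2) > 1"
    using reals_Archimedean3[of "\<tau> / 2"] \<tau>(1) half_gt_zero by blast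
  then have "max \<mu> (1 - real n * (\<tau> / 2)) = \<mu>" using \<mu> by simp
  ultimately show ?thesis by metis
qed

section \<open>From reflections to radial symmetry and monotonicity\<close>

lemma u_isCont: "norm x < 1 \<Longrightarrow> isCont u x"
  using u_cont continuous_on_eq_continuous_at[OF open_ball, of "0::real^3" 1 u] by simp

text \<open>The step length is available for positive target levels and may shrink with them, so the
  central plane is reached as a limit, by continuity of \<open>u\<close>.\<close>

lemma half_plane_order_zero:
  assumes e: "norm e = 1"
  shows "half_plane_order e 0"
  unfolding half_plane_order_def
proof (intro allI impI, elim conjE)
  fix x assume x: "norm x < 1" "x \<bullet> e > 0"
  have "norm (mirror e 0 x) < 1" using norm_mirror_le[OF e, of 0 x] x by simp
  then have "isCont u (mirror e 0 x)" by (rule u_isCont)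
  moreover have "((\<lambda>\<mu>. mirror e \<mu> x) \<longlongrightarrow> mirror e 0 x) (at_right 0)"
    unfolding mirror_def by (intro tendsto_intros)
  ultimately have "((\<lambda>\<mu>. u (mirror e \<mu> x)) \<longlongrightarrow> u (mirror e 0 x)) (at_right 0)"
    by (rule isCont_tendsto_compose)
  moreover have "eventually (\<lambda>\<mu>. u x \<le> u (mirror e \<mu> x)) (at_right 0)"
    unfolding eventually_at_right_field
  proof (intro exI[of _ "x \<bullet> e"] conjI allI impI)
    fix \<mu> assume "0 < \<mu>" "\<mu> < x \<bullet> e"
    then show "u x \<le> u (mirror e \<mu> x)"
      using half_plane_order_pos[OF e, of \<mu>] x by (simp add: half_plane_order_def)
  qed (use x in simp)
  ultimately show "u x \<le> u (mirror e 0 x)" by (intro tendsto_lowerbound) auto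
qed

text \<open>Two distinct points of equal norm are mirror images in a plane through the origin, so
  the order at level 0 applies; exchanging the points gives equality.\<close>

lemma u_radial_le:
  assumes "norm x = norm y" "norm x < 1"
  shows "u x \<le> u y"
proof (cases "x = y")
  case False
  define e where "e = (1 / norm (x - y)) *\<^sub>R (x - y)"
  have n: "norm (x - y) > 0" using False by simp
  have e: "norm e = 1" using n by (simp add: e_def)
  have xx: "x \<bullet> x = y \<bullet> y" using assms(1) by (simp add: dot_square_norm)
  have nn: "(norm (x - y))\<^sup>2 = 2 * (x \<bullet> (x - y))"
    unfolding power2_norm_eq_inner by (simp add: inner_diff_left inner_diff_right inner_commute[of y x] xx)
  have xe: "x \<bullet> e = norm (x - y) / 2"
    using n nn unfolding e_def inner_scaleR_right by (simp add: power2_eq_square divide_simps)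
  have "mirror e 0 x = x - (norm (x - y)) *\<^sub>R e" unfolding mirror_def xe by simp
  also have "\<dots> = y" using n by (simp add: e_def)
  finally show ?thesis
    using half_plane_order_zero[OF e] assms(2) xe n by (metis half_plane_order_def half_gt_zero)
qed simp

lemma u_radial: "norm x = norm y \<Longrightarrow> norm x < 1 \<Longrightarrow> u x = u y"
  using u_radial_le[of x y] u_radial_le[of y x] by simp

text \<open>Two points on a ray from the origin are mirror images in the plane through their
  midpoint, whose level is positive.\<close>

lemma u_decreasing:
  assumes "0 \<le> r" "r < s" "s < 1" "norm e = 1"
  shows "u (s *\<^sub>R e) \<le> u (r *\<^sub>R e)"
proof -
  have ee: "e \<bullet> e = 1" using assms(4) by (simp add: dot_square_norm)
  have "mirror e ((r + s) / 2) (s *\<^sub>R e) = r *\<^sub>R e"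
  proof -
    have "s - 2 * (s - (r + s) / 2) = r" by (simp add: field_simps)
    then show ?thesis by (simp only: mirror_def inner_scaleR_left ee mult_1_right flip: scaleR_diff_left)
  qed
  moreover have "half_plane_order e ((r + s) / 2)"
    using assms by (intro half_plane_order_pos) auto
  moreover have "norm (s *\<^sub>R e) < 1" "(s *\<^sub>R e) \<bullet> e > (r + s) / 2" using assms ee by auto
  ultimately show ?thesis unfolding half_plane_order_def by metis
qed

theorem radial_increasing:
  obtains g :: "real \<Rightarrow> real" where "strict_mono_on {0..<1} g"
    "\<And>x. norm x < 1 \<Longrightarrow> h x - u x = g (norm x)"
proof -
  define e :: "real^3" where "e = axis 1 1"
  have e: "norm e = 1" by (simp add: e_def)
  define g where "g r = h (r *\<^sub>R e) - u (r *\<^sub>R e)" for r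
  show ?thesis
  proof (rule that[of g])
    show "strict_mono_on {0..<1} g"
    proof (rule strict_mono_onI)
      fix r s :: real assume rs: "r \<in> {0..<1}" "s \<in> {0..<1}" "r < s"
      have "r\<^sup>2 < s\<^sup>2" using rs by (intro power_strict_mono) auto
      then have "h (r *\<^sub>R e) < h (s *\<^sub>R e)" using e b_pos by (simp add: h_def divide_strict_right_mono)
      moreover have "u (s *\<^sub>R e) \<le> u (r *\<^sub>R e)" using rs e by (intro u_decreasing) auto
      ultimately show "g r < g s" by (simp add: g_def)
    qed
    fix x :: "real^3" assume x: "norm x < 1"
    have "u x = u (norm x *\<^sub>R e)" using x e by (intro u_radial) auto
    then show "h x - u x = g (norm x)" using e by (simp add: g_def h_def)
  qed
qed

end

section \<open>A smooth cutoff\<close>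

text \<open>The polynomial factor makes the family closed under differentiation for fixed
  \<open>c > 0\<close>, as \<open>smooth3_comp\<close> requires.\<close>

definition flat :: "real \<Rightarrow> real poly \<Rightarrow> real \<Rightarrow> real" where
  "flat c p t = (if t > 0 then poly p (1 / t) * exp (- c / t) else 0)"

lemma poly_exp_tendsto_0:
  assumes "c > (0::real)"
  shows "((\<lambda>z. poly p z * exp (- c * z)) \<longlongrightarrow> 0) at_top"
proof -
  have mono: "((\<lambda>z. z ^ k * exp (- c * z)) \<longlongrightarrow> 0) at_top" for k
  proof -
    have "((\<lambda>z. (c * z) ^ k / exp (c * z)) \<longlongrightarrow> 0) at_top"
    proof (rule filterlim_compose[OF tendsto_power_div_exp_0])
      show "filterlim (\<lambda>z. c * z) at_top at_top"
        by (rule filterlim_tendsto_pos_mult_at_top[OF tendsto_const assms filterlim_ident])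
    qed
    from tendsto_mult_right[OF this, of "1 / c ^ k"]
    have "((\<lambda>z. 1 / c ^ k * ((c * z) ^ k / exp (c * z))) \<longlongrightarrow> 0) at_top"
      by (simp add: mult.commute)
    moreover have "(\<lambda>z. 1 / c ^ k * ((c * z) ^ k / exp (c * z))) = (\<lambda>z. z ^ k * exp (- c * z))"
      using assms by (auto simp: fun_eq_iff power_mult_distrib exp_minus field_simps)
    ultimately show ?thesis by simp
  qed
  have "((\<lambda>z. \<Sum>i\<le>degree p. coeff p i * (z ^ i * exp (- c * z))) \<longlongrightarrow> (\<Sum>i\<le>degree p. coeff p i * 0)) at_top"
    by (intro tendsto_intros mono)
  then show ?thesis by (simp add: poly_altdef sum_distrib_right mult.assoc)
qed

text \<open>In the variable \<open>z = 1 / t\<close> differentiation by \<open>t\<close> becomes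
  \<open>- z\<^sup>2\<close> times differentiation by \<open>z\<close>, which yields the polynomial
  \<open>z\<^sup>2 * (c * p - p')\<close>. At 0 the difference quotient has an extra factor
  \<open>z\<close>, and the exponential still wins.\<close>

lemma flat_deriv:
  assumes c: "c > 0"
  shows "(flat c p has_real_derivative flat c ([:0, 0, 1:] * (smult c p - pderiv p)) t) (at t)"
proof -
  consider "t > 0" | "t < 0" | "t = 0" by linarith
  then show ?thesis
  proof cases
    case 1
    have "((\<lambda>t. poly p (1 / t) * exp (- c / t)) has_real_derivative
        flat c ([:0, 0, 1:] * (smult c p - pderiv p)) t) (at t)"
      using 1 by (auto intro!: derivative_eq_intros simp: flat_def power2_eq_square field_simps)
    moreover have "eventually (\<lambda>t. flat c p t = poly p (1 / t) * exp (- c / t)) (nhds t)"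
      using eventually_nhds_in_open[of "{0<..}" t] 1
      by (auto elim!: eventually_mono simp: flat_def)
    ultimately show ?thesis by (subst DERIV_cong_ev[OF refl _ refl]) auto
  next
    case 2
    have "eventually (\<lambda>t. flat c p t = 0) (nhds t)"
      using eventually_nhds_in_open[of "{..<0}" t] 2
      by (auto elim!: eventually_mono simp: flat_def)
    then have "(flat c p has_real_derivative 0) (at t)"
      by (subst DERIV_cong_ev[OF refl _ refl, of _ "\<lambda>_. 0"]) auto
    then show ?thesis using 2 by (simp add: flat_def)
  next
    case 3
    have "((\<lambda>y. poly (pCons 0 p) (inverse y) * exp (- c * inverse y)) \<longlongrightarrow> 0) (at_right 0)"
      by (rule filterlim_compose[OF poly_exp_tendsto_0[OF c] filterlim_inverse_at_top_right])
    then have r: "((\<lambda>y. flat c p y / y) \<longlongrightarrow> 0) (at_right 0)"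
    proof (rule Lim_transform_eventually)
      show "\<forall>\<^sub>F y in at_right 0. poly (pCons 0 p) (inverse y) * exp (- c * inverse y) = flat c p y / y"
        unfolding eventually_at_right_field
        by (intro exI[of _ 1]) (auto simp: flat_def divide_inverse)
    qed
    have l: "((\<lambda>y. flat c p y / y) \<longlongrightarrow> 0) (at_left 0)"
    proof (rule Lim_transform_eventually[OF tendsto_const])
      show "\<forall>\<^sub>F y in at_left 0. 0 = flat c p y / y"
        unfolding eventually_at_left_field by (intro exI[of _ "-1"]) (auto simp: flat_def)
    qed
    have "((\<lambda>y. flat c p y / y) \<longlongrightarrow> 0) (at 0)" using l r by (rule filterlim_split_at)
    then show ?thesis using 3 by (simp add: DERIV_def flat_def)
  qed
qed

lemma smooth3_flat:
  assumes "c > 0" "smooth3 f"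
  shows "smooth3 (\<lambda>y. flat c p (f y))"
proof (rule smooth3_comp[where g = "flat c p" and f = f and \<G> = "range (flat c)" and S = UNIV])
  fix g assume "g \<in> range (flat c)"
  then obtain q where "g = flat c q" by blast
  then show "\<exists>g'\<in>range (flat c). \<forall>t\<in>UNIV. (g has_real_derivative g' t) (at t)"
    using flat_deriv[OF assms(1), of q] by blast
qed (use assms in auto)

text \<open>
  For \<open>t > s\<close> and \<open>\<kappa> = s / (t - s)\<close> the second derivative of \<open>cutoff s\<close> is
  \<open>(2 + 2 * \<kappa> + \<kappa>^2) * exp (- \<kappa>)\<close>, hence at most 2 by the Taylor bound for \<open>exp\<close>.
\<close>

definition cutoff :: "real \<Rightarrow> real \<Rightarrow> real" where
  "cutoff s t = (t - s)\<^sup>2 * flat s 1 (t - s)"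

definition cutoff' :: "real \<Rightarrow> real \<Rightarrow> real" where
  "cutoff' s t = 2 * (t - s) * flat s 1 (t - s) + (t - s)\<^sup>2 * flat s [:0, 0, s:] (t - s)"

definition cutoff'' :: "real \<Rightarrow> real \<Rightarrow> real" where
  "cutoff'' s t = 2 * flat s 1 (t - s) + 4 * (t - s) * flat s [:0, 0, s:] (t - s)
     + (t - s)\<^sup>2 * flat s ([:0, 0, 1:] * ([:0, - 2 * s, s * s:])) (t - s)"

lemma cutoff_deriv:
  assumes "s > 0"
  shows "(cutoff s has_real_derivative cutoff' s t) (at t)"
    and "(cutoff' s has_real_derivative cutoff'' s t) (at t)"
proof -
  have 0: "((\<lambda>t. flat s p (t - s)) has_real_derivative
      flat s ([:0, 0, 1:] * (smult s p - pderiv p)) (t - s) * 1) (at t)" for p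
    by (rule DERIV_chain2[OF flat_deriv[OF assms]]) (auto intro!: derivative_eq_intros)
  have 1: "((\<lambda>t. flat s 1 (t - s)) has_real_derivative flat s [:0, 0, s:] (t - s)) (at t)"
    using 0[of 1] by (simp add: one_pCons)
  have 2: "((\<lambda>t. flat s [:0, 0, s:] (t - s)) has_real_derivative
      flat s ([:0, 0, 1:] * ([:0, - 2 * s, s * s:])) (t - s)) (at t)"
    using 0[of "[:0, 0, s:]"] by (simp add: pderiv_pCons)
  show "(cutoff s has_real_derivative cutoff' s t) (at t)"
    unfolding cutoff_def[abs_def] cutoff'_def
    by (auto intro!: derivative_eq_intros 1 simp: algebra_simps)
  show "(cutoff' s has_real_derivative cutoff'' s t) (at t)"
    unfolding cutoff'_def[abs_def] cutoff''_def
    by (auto intro!: derivative_eq_intros 1 2 simp: algebra_simps power2_eq_square)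
qed

lemma cutoff_eq:
  assumes "t > s"
  shows "cutoff s t = (t - s)\<^sup>2 * exp (- s / (t - s))"
    and "cutoff' s t = (2 * (t - s) + s) * exp (- s / (t - s))"
    and "cutoff'' s t = (2 + 2 * (s / (t - s)) + (s / (t - s))\<^sup>2) * exp (- s / (t - s))"
proof -
  define \<sigma> where "\<sigma> = t - s"
  have \<sigma>: "\<sigma> > 0" using assms by (simp add: \<sigma>_def)
  show "cutoff s t = (t - s)\<^sup>2 * exp (- s / (t - s))"
    using \<sigma> by (simp add: cutoff_def flat_def flip: \<sigma>_def)
  show "cutoff' s t = (2 * (t - s) + s) * exp (- s / (t - s))"
    using \<sigma> by (simp add: cutoff'_def flat_def flip: \<sigma>_def) (simp add: field_simps power2_eq_square)
  show "cutoff'' s t = (2 + 2 * (s / (t - s)) + (s / (t - s))\<^sup>2) * exp (- s / (t - s))"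
    using \<sigma> by (simp add: cutoff''_def flat_def flip: \<sigma>_def) (simp add: field_simps power2_eq_square)
qed

lemma cutoff_zero: "t \<le> s \<Longrightarrow> cutoff s t = 0 \<and> cutoff' s t = 0 \<and> cutoff'' s t = 0"
  by (simp add: cutoff_def cutoff'_def cutoff''_def flat_def)

text \<open>The bounds are those of \<open>t\<^sup>2\<close> and do not involve \<open>s\<close>.
  This uniformity is what permits dominated convergence for \<open>lap (psi s x)\<close>.\<close>

lemma cutoff_bounds:
  assumes s: "s > 0"
  shows "\<bar>cutoff s t\<bar> \<le> t\<^sup>2" "\<bar>cutoff' s t\<bar> \<le> 2 * \<bar>t\<bar>" "\<bar>cutoff'' s t\<bar> \<le> 2"
proof -
  have "\<bar>cutoff s t\<bar> \<le> t\<^sup>2 \<and> \<bar>cutoff' s t\<bar> \<le> 2 * \<bar>t\<bar> \<and> \<bar>cutoff'' s t\<bar> \<le> 2"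
  proof (cases "t > s")
    case True
    define \<sigma> where "\<sigma> = t - s"
    define \<kappa> where "\<kappa> = s / \<sigma>"
    have \<sigma>: "\<sigma> > 0" "\<sigma> \<le> t" using True s by (auto simp: \<sigma>_def)
    have \<kappa>: "\<kappa> \<ge> 0" using s \<sigma> by (simp add: \<kappa>_def)
    have ex: "1 + \<kappa> + \<kappa>\<^sup>2 / 2 \<le> exp \<kappa>" using \<kappa> by (rule exp_lower_Taylor_quadratic)
    have e2: "2 + 2 * \<kappa> + \<kappa>\<^sup>2 \<le> 2 * exp \<kappa>" using ex by simp
    have e1: "1 + \<kappa> / 2 \<le> exp \<kappa>" using ex \<kappa> zero_le_power2[of \<kappa>] by linarith
    have s\<kappa>: "s = \<sigma> * \<kappa>" using \<sigma> by (simp add: \<kappa>_def)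
    have C: "cutoff s t = \<sigma>\<^sup>2 * exp (- \<kappa>)" "cutoff' s t = (2 * \<sigma> + s) * exp (- \<kappa>)"
      "cutoff'' s t = (2 + 2 * \<kappa> + \<kappa>\<^sup>2) * exp (- \<kappa>)"
      using cutoff_eq[OF True] by (simp_all add: \<sigma>_def \<kappa>_def)
    have "\<sigma>\<^sup>2 * exp (- \<kappa>) \<le> t\<^sup>2 * 1" using \<sigma> \<kappa> by (intro mult_mono power_mono) auto
    moreover have "(2 * \<sigma> + s) * exp (- \<kappa>) \<le> 2 * t"
    proof -
      have "2 * \<sigma> + s = 2 * \<sigma> * (1 + \<kappa> / 2)" by (simp add: s\<kappa> algebra_simps)
      also have "\<dots> \<le> 2 * \<sigma> * exp \<kappa>" using e1 \<sigma> by (intro mult_left_mono) auto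
      also have "\<dots> \<le> 2 * t * exp \<kappa>" using \<sigma> by (intro mult_right_mono) auto
      finally show ?thesis by (simp add: exp_minus field_simps)
    qed
    moreover have "(2 + 2 * \<kappa> + \<kappa>\<^sup>2) * exp (- \<kappa>) \<le> 2"
      using e2 by (simp add: exp_minus field_simps)
    ultimately show ?thesis unfolding C using \<sigma> \<kappa> s by (simp add: abs_mult)
  qed (use cutoff_zero[of t s] in auto)
  then show "\<bar>cutoff s t\<bar> \<le> t\<^sup>2" "\<bar>cutoff' s t\<bar> \<le> 2 * \<bar>t\<bar>" "\<bar>cutoff'' s t\<bar> \<le> 2" by auto
qed

lemma cutoff_tendsto:
  fixes s t :: "nat \<Rightarrow> real"
  assumes s: "s \<longlonglongrightarrow> 0" and t: "t \<longlonglongrightarrow> l" and l: "l > 0"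
  shows "(\<lambda>n. cutoff (s n) (t n)) \<longlonglongrightarrow> l\<^sup>2" "(\<lambda>n. cutoff' (s n) (t n)) \<longlonglongrightarrow> 2 * l"
    "(\<lambda>n. cutoff'' (s n) (t n)) \<longlonglongrightarrow> 2"
proof -
  have d: "(\<lambda>n. t n - s n) \<longlonglongrightarrow> l - 0" by (intro tendsto_intros s t)
  then have "\<forall>\<^sub>F n in sequentially. t n - s n > 0" using l by (intro order_tendstoD(1)) auto
  then have ev: "\<forall>\<^sub>F n in sequentially. t n > s n" by (rule eventually_mono) simp
  have d': "(\<lambda>n. t n - s n) \<longlonglongrightarrow> l" using d by simp
  have k: "(\<lambda>n. s n / (t n - s n)) \<longlonglongrightarrow> 0" using tendsto_divide[OF s d'] l by simp
  have e: "(\<lambda>n. exp (- s n / (t n - s n))) \<longlonglongrightarrow> 1"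
    using tendsto_exp[OF tendsto_minus[OF k]] by simp
  have e1: "\<forall>\<^sub>F n in sequentially. (t n - s n)\<^sup>2 * exp (- s n / (t n - s n)) = cutoff (s n) (t n)"
    and e2: "\<forall>\<^sub>F n in sequentially. (2 * (t n - s n) + s n) * exp (- s n / (t n - s n)) = cutoff' (s n) (t n)"
    and e3: "\<forall>\<^sub>F n in sequentially. (2 + 2 * (s n / (t n - s n)) + (s n / (t n - s n))\<^sup>2)
       * exp (- s n / (t n - s n)) = cutoff'' (s n) (t n)"
    by (rule eventually_mono[OF ev], simp add: cutoff_eq)+
  have "(\<lambda>n. (t n - s n)\<^sup>2 * exp (- s n / (t n - s n))) \<longlonglongrightarrow> l\<^sup>2 * 1"
    by (intro tendsto_intros d' e)
  from Lim_transform_eventually[OF this e1] show "(\<lambda>n. cutoff (s n) (t n)) \<longlonglongrightarrow> l\<^sup>2" by simp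
  have "(\<lambda>n. (2 * (t n - s n) + s n) * exp (- s n / (t n - s n))) \<longlonglongrightarrow> (2 * l + 0) * 1"
    by (intro tendsto_intros d' e s)
  from Lim_transform_eventually[OF this e2] show "(\<lambda>n. cutoff' (s n) (t n)) \<longlonglongrightarrow> 2 * l" by simp
  have "(\<lambda>n. (2 + 2 * (s n / (t n - s n)) + (s n / (t n - s n))\<^sup>2) * exp (- s n / (t n - s n)))
      \<longlonglongrightarrow> (2 + 2 * 0 + 0\<^sup>2) * 1"
    by (intro tendsto_intros k e)
  from Lim_transform_eventually[OF this e3] show "(\<lambda>n. cutoff'' (s n) (t n)) \<longlonglongrightarrow> 2" by simp
qed

lemma smooth3_cutoff: "s > 0 \<Longrightarrow> smooth3 f \<Longrightarrow> smooth3 (\<lambda>y. cutoff s (f y))"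
  unfolding cutoff_def power2_eq_square
  by (intro smooth3_mult smooth3_diff smooth3_const smooth3_flat)

section \<open>Powers of quadratic functions\<close>

text \<open>One family covers the regularised squared distances \<open>Rq\<close> and
  \<open>Aq\<close>, the affine factor \<open>1 - x \<bullet> y\<close>, and the function
  \<open>h\<close> with the prescribed boundary data.\<close>

definition quad :: "real \<Rightarrow> real^3 \<Rightarrow> real \<Rightarrow> real^3 \<Rightarrow> real" where
  "quad \<alpha> \<beta> \<gamma> y = \<alpha> * (norm y)\<^sup>2 - 2 * (\<beta> \<bullet> y) + \<gamma>"

lemma smooth3_quad: "smooth3 (quad \<alpha> \<beta> \<gamma>)"
  unfolding quad_def[abs_def]
  by (intro smooth3_add smooth3_diff smooth3_mult smooth3_const smooth3_norm_sq smooth3_inner)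

lemma partial_quad: "partial i (quad \<alpha> \<beta> \<gamma>) = (\<lambda>y. 2 * (\<alpha> * y $ i - \<beta> $ i))"
proof (rule partial_eqI, unfold has_partial_def, intro allI)
  fix y :: "real^3"
  have "quad \<alpha> \<beta> \<gamma> (y + t *\<^sub>R axis i 1) =
     \<alpha> * ((norm y)\<^sup>2 + 2 * t * (y $ i) + t\<^sup>2) - 2 * (\<beta> \<bullet> y + t * \<beta> $ i) + \<gamma>" for t
    unfolding quad_def power2_norm_eq_inner
    by (simp add: inner_add_left inner_add_right inner_axis inner_axis' power2_eq_square algebra_simps)
  then have eq: "(\<lambda>t. quad \<alpha> \<beta> \<gamma> (y + t *\<^sub>R axis i 1)) =
    (\<lambda>t. \<alpha> * ((norm y)\<^sup>2 + 2 * t * (y $ i) + t\<^sup>2) - 2 * (\<beta> \<bullet> y + t * \<beta> $ i) + \<gamma>)" by (rule ext)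
  show "((\<lambda>t. quad \<alpha> \<beta> \<gamma> (y + t *\<^sub>R axis i 1)) has_real_derivative 2 * (\<alpha> * y $ i - \<beta> $ i)) (at 0)"
    unfolding eq by (auto intro!: derivative_eq_intros simp: algebra_simps)
qed

lemma lap_quad: "lap (quad \<alpha> \<beta> \<gamma>) y = 6 * \<alpha>"
proof -
  have "partial i (partial i (quad \<alpha> \<beta> \<gamma>)) y = 2 * \<alpha>" for i
  proof -
    have "has_partial i (\<lambda>y. 2 * (\<alpha> * y $ i - \<beta> $ i)) (\<lambda>_. 2 * \<alpha>)"
      unfolding has_partial_def by (auto intro!: derivative_eq_intros)
    from partial_eqI[OF this] show ?thesis by (simp add: partial_quad)
  qed
  then show ?thesis by (simp add: lap_def)
qed

lemma gradp_quad: "gradp (quad \<alpha> \<beta> \<gamma>) (quad \<alpha>' \<beta>' \<gamma>') y = 4 * ((\<alpha> *\<^sub>R y - \<beta>) \<bullet> (\<alpha>' *\<^sub>R y - \<beta>'))"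
  unfolding gradp_def partial_quad inner_vec_def sum_distrib_left
  by (intro sum.cong) (simp_all add: algebra_simps)

lemma powr_deriv_at:
  "t > (0::real) \<Longrightarrow> ((\<lambda>t. a * t powr \<sigma>) has_real_derivative (a * \<sigma>) * t powr (\<sigma> - 1)) (at t)"
  by (auto intro!: derivative_eq_intros simp: powr_diff field_simps)

lemma lap_powr:
  assumes "smooth3 q" "\<And>y. q y > 0"
  shows "lap (\<lambda>y. q y powr \<sigma>) y =
    \<sigma> * (\<sigma> - 1) * q y powr (\<sigma> - 2) * gradp q q y + \<sigma> * q y powr (\<sigma> - 1) * lap q y"
proof -
  have "((\<lambda>t. t powr \<sigma>) has_real_derivative \<sigma> * q y powr (\<sigma> - 1)) (at (q y))" for y
    using powr_deriv_at[OF assms(2), of 1 \<sigma>] by simp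
  moreover have "((\<lambda>t. \<sigma> * t powr (\<sigma> - 1)) has_real_derivative \<sigma> * (\<sigma> - 1) * q y powr (\<sigma> - 2)) (at (q y))" for y
    using powr_deriv_at[OF assms(2), of \<sigma> "\<sigma> - 1"] by simp
  ultimately show ?thesis
    using lap_comp[OF assms(1), of "\<lambda>t. t powr \<sigma>" "\<lambda>t. \<sigma> * t powr (\<sigma> - 1)"
      "\<lambda>t. \<sigma> * (\<sigma> - 1) * t powr (\<sigma> - 2)" y] by simp
qed

lemma gradp_powr_left:
  assumes "smooth3 q" "\<And>y. q y > 0"
  shows "gradp (\<lambda>y. q y powr \<sigma>) f y = \<sigma> * q y powr (\<sigma> - 1) * gradp q f y"
  using gradp_comp_left[OF assms(1), of "\<lambda>t. t powr \<sigma>" "\<lambda>t. \<sigma> * t powr (\<sigma> - 1)" f y]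
    powr_deriv_at[OF assms(2), of 1 \<sigma>] by simp

lemma gradp_powr:
  assumes "smooth3 q" "\<And>y. q y > 0" "smooth3 q'" "\<And>y. q' y > 0"
  shows "gradp (\<lambda>y. q y powr \<sigma>) (\<lambda>y. q' y powr \<sigma>') y =
    \<sigma> * \<sigma>' * q y powr (\<sigma> - 1) * q' y powr (\<sigma>' - 1) * gradp q q' y"
  by (simp add: gradp_powr_left[OF assms(1,2)] gradp_commute[of q] gradp_powr_left[OF assms(3,4)])

lemma powr_half_nat:
  assumes "q > (0::real)"
  shows "q powr (- (real n / 2)) = 1 / sqrt q ^ n"
proof -
  have "q = sqrt q powr 2" using assms by simp
  then have "q powr (- (real n / 2)) = (sqrt q powr 2) powr (- (real n / 2))" by simp
  also have "\<dots> = sqrt q powr (- real n)" by (simp add: powr_powr)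
  also have "\<dots> = 1 / sqrt q ^ n" using assms by (simp add: powr_minus_divide powr_realpow)
  finally show ?thesis .
qed

lemma powr_halves:
  assumes "q > (0::real)"
  shows "q powr (1/2) = sqrt q" "q powr (-1/2) = 1 / sqrt q" "q powr (-3/2) = 1 / sqrt q ^ 3"
    "q powr (-5/2) = 1 / sqrt q ^ 5" "q powr (-7/2) = 1 / sqrt q ^ 7" "q powr (-1) = 1 / sqrt q ^ 2"
  using powr_half_nat[OF assms, of 1] powr_half_nat[OF assms, of 3] powr_half_nat[OF assms, of 5]
    powr_half_nat[OF assms, of 7] powr_half_nat[OF assms, of 2] assms
  by (simp_all add: powr_half_sqrt)

section \<open>Regularised kernels\<close>

text \<open>
  For \<open>s > 0\<close> the quadratic functions \<open>Rq s x\<close> and \<open>Aq s x\<close> are smooth positive replacements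
  for the squares of \<open>norm (x - y)\<close> and \<open>conj_dist x y\<close>.
\<close>

definition Rq :: "real \<Rightarrow> real^3 \<Rightarrow> real^3 \<Rightarrow> real" where
  "Rq s x = quad 1 x (s\<^sup>2 + (norm x)\<^sup>2)"

definition Aq :: "real \<Rightarrow> real^3 \<Rightarrow> real^3 \<Rightarrow> real" where
  "Aq s x = quad ((norm x)\<^sup>2) x (1 + s\<^sup>2)"

lemma Rq_eq: "Rq s x y = s\<^sup>2 + (norm (x - y))\<^sup>2"
  by (simp add: Rq_def quad_def power2_norm_eq_inner inner_diff_left inner_diff_right
      inner_commute[of y x])

lemma Aq_eq: "Aq s x y = s\<^sup>2 + (1 - 2 * (x \<bullet> y) + (norm x)\<^sup>2 * (norm y)\<^sup>2)"
  by (simp add: Aq_def quad_def)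

lemma Aq_conj_dist: "norm x < 1 \<Longrightarrow> norm y < 1 \<Longrightarrow> Aq s x y = s\<^sup>2 + (conj_dist x y)\<^sup>2"
  by (simp add: Aq_eq conj_dist_sq)

lemma Rq_pos: "s > 0 \<Longrightarrow> Rq s x y > 0"
  by (simp add: Rq_eq add_pos_nonneg)

lemma Aq_ge: "s\<^sup>2 + (1 - norm x * norm y)\<^sup>2 \<le> Aq s x y"
  using norm_cauchy_schwarz[of x y] by (simp add: Aq_eq power2_diff power_mult_distrib)

lemma Aq_pos: "s > 0 \<Longrightarrow> Aq s x y > 0"
  using Aq_ge[of s x y] zero_less_power[of s 2] zero_le_power2[of "1 - norm x * norm y"] by linarith

lemma smooth3_Rq: "smooth3 (Rq s x)" and smooth3_Aq: "smooth3 (Aq s x)"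
  by (simp_all add: Rq_def Aq_def smooth3_quad)

lemma lap_Rq: "lap (Rq s x) y = 6" and lap_Aq: "lap (Aq s x) y = 6 * (norm x)\<^sup>2"
  by (simp_all add: Rq_def Aq_def lap_quad)

lemma gradp_Rq: "gradp (Rq s x) (Rq s x) y = 4 * (Rq s x y - s\<^sup>2)"
  by (simp add: Rq_eq) (simp add: Rq_def gradp_quad norm_minus_commute[of x y] flip: power2_norm_eq_inner)

lemma gradp_Aq: "gradp (Aq s x) (Aq s x) y = 4 * (norm x)\<^sup>2 * (Aq s x y - s\<^sup>2)"
proof -
  have "gradp (Aq s x) (Aq s x) y = 4 * (((norm x)\<^sup>2 *\<^sub>R y - x) \<bullet> ((norm x)\<^sup>2 *\<^sub>R y - x))"
    by (simp only: Aq_def gradp_quad)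
  also have "\<dots> = 4 * (norm x)\<^sup>2 * (Aq s x y - s\<^sup>2)"
    unfolding Aq_eq power2_norm_eq_inner
    by (simp add: inner_diff_left inner_diff_right inner_commute[of y x] algebra_simps)
  finally show ?thesis .
qed

definition cross :: "real^3 \<Rightarrow> real^3 \<Rightarrow> real" where
  "cross x y = ((norm x)\<^sup>2 *\<^sub>R y - x) \<bullet> (y - x)"

lemma gradp_Aq_Rq: "gradp (Aq s x) (Rq s x) y = 4 * cross x y"
  by (simp add: Rq_def Aq_def gradp_quad cross_def)

lemma cross_eq: "norm x < 1 \<Longrightarrow> norm y < 1 \<Longrightarrow> cross x y = (conj_dist x y)\<^sup>2 - wt x * (1 - x \<bullet> y)"
  by (simp add: conj_dist_sq cross_def wt_def inner_diff_left inner_diff_right inner_commute[of y x]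
     algebra_simps flip: power2_norm_eq_inner)

text \<open>The factor \<open>norm (x - y)\<close> offsets the division of \<open>cross\<close> by
  the regularised distance in \<open>psi_lap\<close>, so that no power of it beyond the first
  remains in the denominator.\<close>

lemma cross_le:
  assumes "norm x < 1" "norm y < 1" shows "\<bar>cross x y\<bar> \<le> 2 * norm (x - y)"
proof -
  have "\<bar>cross x y\<bar> \<le> norm ((norm x)\<^sup>2 *\<^sub>R y - x) * norm (y - x)"
    unfolding cross_def by (rule Cauchy_Schwarz_ineq2)
  also have "\<dots> \<le> 2 * norm (y - x)"
  proof (rule mult_right_mono)
    have "norm ((norm x)\<^sup>2 *\<^sub>R y - x) \<le> norm ((norm x)\<^sup>2 *\<^sub>R y) + norm x" by (rule norm_triangle_ineq4)
    moreover have "norm ((norm x)\<^sup>2 *\<^sub>R y) \<le> 1 * 1"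
      unfolding norm_scaleR using assms by (intro mult_mono) (auto intro: power_le_one)
    ultimately show "norm ((norm x)\<^sup>2 *\<^sub>R y - x) \<le> 2" using assms by linarith
  qed simp
  finally show ?thesis by (simp add: norm_minus_commute)
qed

lemma lap_Aq_powr:
  assumes "s > 0"
  shows "lap (\<lambda>y. Aq s x y powr \<sigma>) y = \<sigma> * (\<sigma> - 1) * Aq s x y powr (\<sigma> - 2)
     * (4 * (norm x)\<^sup>2 * (Aq s x y - s\<^sup>2)) + \<sigma> * Aq s x y powr (\<sigma> - 1) * (6 * (norm x)\<^sup>2)"
  using lap_powr[OF smooth3_Aq Aq_pos[OF assms], of x \<sigma> y] by (simp add: gradp_Aq lap_Aq)

lemma lap_Rq_powr:
  assumes "s > 0"
  shows "lap (\<lambda>y. Rq s x y powr \<sigma>) y = \<sigma> * (\<sigma> - 1) * Rq s x y powr (\<sigma> - 2)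
     * (4 * (Rq s x y - s\<^sup>2)) + \<sigma> * Rq s x y powr (\<sigma> - 1) * 6"
  using lap_powr[OF smooth3_Rq Rq_pos[OF assms], of x \<sigma> y] by (simp add: gradp_Rq lap_Rq)

lemma half_exponents:
  "-1/2 - 2 = (-5/2 :: real)" "-1/2 - 1 = (-3/2 :: real)" "-3/2 - 2 = (-7/2 :: real)"
  "-3/2 - 1 = (-5/2 :: real)" "1/2 - 2 = (-3/2 :: real)" "1/2 - 1 = (-1/2 :: real)"
  by simp_all

lemma lap_Aq_halves:
  fixes x y :: "real^3"
  assumes s: "s > 0"
  defines "a \<equiv> sqrt (Aq s x y)"
  shows "lap (\<lambda>y. Aq s x y powr (-1/2)) y = - 3 * (norm x)\<^sup>2 * s\<^sup>2 / a ^ 5"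
    and "lap (\<lambda>y. Aq s x y powr (-3/2)) y = 6 * (norm x)\<^sup>2 / a ^ 5 - 15 * (norm x)\<^sup>2 * s\<^sup>2 / a ^ 7"
    and "lap (\<lambda>y. Aq s x y powr (1/2)) y = 2 * (norm x)\<^sup>2 / a + (norm x)\<^sup>2 * s\<^sup>2 / a ^ 3"
proof -
  define \<rho> b where "\<rho> = (norm x)\<^sup>2" and "b = a"
  have A: "Aq s x y = b\<^sup>2" "b > 0" using Aq_pos[OF s, of x y] by (auto simp: a_def b_def)
  note pa = powr_halves[OF Aq_pos[OF s, of x y], folded a_def b_def]
  show "lap (\<lambda>y. Aq s x y powr (-1/2)) y = - 3 * (norm x)\<^sup>2 * s\<^sup>2 / a ^ 5"
    "lap (\<lambda>y. Aq s x y powr (-3/2)) y = 6 * (norm x)\<^sup>2 / a ^ 5 - 15 * (norm x)\<^sup>2 * s\<^sup>2 / a ^ 7"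
    "lap (\<lambda>y. Aq s x y powr (1/2)) y = 2 * (norm x)\<^sup>2 / a + (norm x)\<^sup>2 * s\<^sup>2 / a ^ 3"
    unfolding lap_Aq_powr[OF s] half_exponents pa unfolding A(1) \<rho>_def[symmetric] b_def[symmetric]
    using A(2) by (simp_all add: field_simps power_numeral_reduce)
qed

lemma lap_Rq_halves:
  fixes x y :: "real^3"
  assumes s: "s > 0"
  defines "r \<equiv> sqrt (Rq s x y)"
  shows "lap (\<lambda>y. Rq s x y powr (-1/2)) y = - 3 * s\<^sup>2 / r ^ 5"
    and "lap (\<lambda>y. Rq s x y powr (1/2)) y = 2 / r + s\<^sup>2 / r ^ 3"
proof -
  define b where "b = r"
  have R: "Rq s x y = b\<^sup>2" "b > 0" using Rq_pos[OF s, of x y] by (auto simp: r_def b_def)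
  note pr = powr_halves[OF Rq_pos[OF s, of x y], folded r_def b_def]
  show "lap (\<lambda>y. Rq s x y powr (-1/2)) y = - 3 * s\<^sup>2 / r ^ 5"
    "lap (\<lambda>y. Rq s x y powr (1/2)) y = 2 / r + s\<^sup>2 / r ^ 3"
    unfolding lap_Rq_powr[OF s] half_exponents pr unfolding R(1) b_def[symmetric]
    using R(2) by (simp_all add: field_simps power_numeral_reduce)
qed

lemma smooth3_Aq_powr: "s > 0 \<Longrightarrow> smooth3 (\<lambda>y. Aq s x y powr \<sigma>)"
  and smooth3_Rq_powr: "s > 0 \<Longrightarrow> smooth3 (\<lambda>y. Rq s x y powr \<sigma>)"
  by (rule smooth3_powr[OF smooth3_Aq Aq_pos], assumption)
     (rule smooth3_powr[OF smooth3_Rq Rq_pos], assumption)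

subsection \<open>The Laplacian of the Green function\<close>

text \<open>
  Away from the diagonal \<open>dker x\<close> is the Laplacian of \<open>green x\<close>; its first two terms together are
  harmonic in the ball.
\<close>

definition dker :: "real^3 \<Rightarrow> real^3 \<Rightarrow> real" where
  "dker x y = (2 * (norm x)\<^sup>2 + 2) / conj_dist x y + 4 * wt x * (1 - x \<bullet> y) / conj_dist x y ^ 3
     - 4 / norm (x - y)"

definition dreg :: "real \<Rightarrow> real^3 \<Rightarrow> real^3 \<Rightarrow> real" where
  "dreg s x y = (2 * (norm x)\<^sup>2 + 2) * Aq s x y powr (-1/2)
     + 4 * wt x * ((1 - x \<bullet> y) * Aq s x y powr (-3/2)) - 4 * Rq s x y powr (-1/2)"

lemma smooth3_one_minus_inner: "smooth3 (\<lambda>y. 1 - x \<bullet> y)"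
  by (intro smooth3_diff smooth3_const smooth3_inner)

lemma smooth3_dreg: "s > 0 \<Longrightarrow> smooth3 (dreg s x)"
  unfolding dreg_def[abs_def]
  by (intro smooth3_diff smooth3_add smooth3_mult[OF smooth3_const] smooth3_mult
      smooth3_one_minus_inner smooth3_Aq_powr smooth3_Rq_powr)

lemma one_minus_inner_quad: "(\<lambda>y. 1 - x \<bullet> y) = quad 0 ((1/2) *\<^sub>R x) 1"
  by (simp add: fun_eq_iff quad_def)

text \<open>Every term carries \<open>s\<^sup>2\<close>. The term with \<open>Rq\<close>
  concentrates at \<open>x\<close> with total mass \<open>12 * bump_mass\<close>; the coefficients
  of \<open>s\<^sup>2\<close> that come from \<open>Aq\<close> stay bounded on the ball for fixed
  \<open>x\<close>, so their contribution disappears in the limit.\<close>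

lemma lap_dreg:
  assumes s: "s > 0"
  shows "lap (dreg s x) y = 12 * (s\<^sup>2 * Rq s x y powr (-5/2))
    - s\<^sup>2 * (6 * (norm x)\<^sup>2 * ((norm x)\<^sup>2 + 1) * Aq s x y powr (-5/2)
        + 60 * wt x * (norm x)\<^sup>2 * (1 - x \<bullet> y) * Aq s x y powr (-7/2))"
proof -
  define a r where "a = sqrt (Aq s x y)" and "r = sqrt (Rq s x y)"
  have A: "Aq s x y = a\<^sup>2" "a > 0" and R: "Rq s x y = r\<^sup>2" "r > 0"
    using Aq_pos[OF s, of x y] Rq_pos[OF s, of x y] by (auto simp: a_def r_def)
  note pa = powr_halves[OF Aq_pos[OF s, of x y], folded a_def]
  note pr = powr_halves[OF Rq_pos[OF s, of x y], folded r_def]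
  define \<rho> t where "\<rho> = (norm x)\<^sup>2" and "t = x \<bullet> y"
  note L1 = lap_Aq_halves(1)[OF s, of x y, folded a_def \<rho>_def]
  note L2 = lap_Rq_halves(1)[OF s, of x y, folded r_def]
  note L3 = lap_Aq_halves(2)[OF s, of x y, folded a_def \<rho>_def]
  have G: "gradp (\<lambda>y. 1 - x \<bullet> y) (\<lambda>y. Aq s x y powr (-3/2)) y = 3 * (\<rho> * t - \<rho>) / a ^ 5"
  proof -
    have "gradp (\<lambda>y. 1 - x \<bullet> y) (\<lambda>y. Aq s x y powr (-3/2)) y =
      (-3/2) * Aq s x y powr (-3/2 - 1) * gradp (Aq s x) (\<lambda>y. 1 - x \<bullet> y) y"
      by (subst gradp_commute) (rule gradp_powr_left[OF smooth3_Aq Aq_pos[OF s]])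
    also have "gradp (Aq s x) (\<lambda>y. 1 - x \<bullet> y) y = - 2 * (\<rho> * t - \<rho>)"
      unfolding one_minus_inner_quad Aq_def gradp_quad
      by (simp add: \<rho>_def t_def inner_diff_left inner_commute[of y x] algebra_simps flip: power2_norm_eq_inner)
    finally show ?thesis unfolding half_exponents pa using A(2) by (simp add: field_simps)
  qed
  have L0: "lap (\<lambda>y. 1 - x \<bullet> y) y = 0" unfolding one_minus_inner_quad lap_quad by simp
  have "lap (dreg s x) y = (2 * \<rho> + 2) * (- 3 * \<rho> * s\<^sup>2 / a ^ 5)
     + 4 * wt x * ((1 - t) * (6 * \<rho> / a ^ 5 - 15 * \<rho> * s\<^sup>2 / a ^ 7) + 2 * (3 * (\<rho> * t - \<rho>) / a ^ 5)
         + Aq s x y powr (-3/2) * 0)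
     - 4 * (- 3 * s\<^sup>2 / r ^ 5)"
    unfolding dreg_def[abs_def]
    by (simp only: lap_diff lap_add lap_cmult lap_mult smooth3_diff smooth3_add smooth3_mult smooth3_const
        smooth3_one_minus_inner smooth3_Aq_powr[OF s] smooth3_Rq_powr[OF s] L0 L1 L2 L3 G
        \<rho>_def[symmetric] t_def[symmetric])
  also have "\<dots> = 12 * (s\<^sup>2 * (1 / r ^ 5)) - s\<^sup>2 * (6 * \<rho> * (\<rho> + 1) * (1 / a ^ 5)
        + 60 * wt x * \<rho> * (1 - t) * (1 / a ^ 7))"
  proof -
    have "(2 * \<rho> + 2) * (- 3 * \<rho> * s\<^sup>2 * U) + 4 * wt x * ((1 - t) * (6 * \<rho> * U - 15 * \<rho> * s\<^sup>2 * V)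
        + 2 * (3 * (\<rho> * t - \<rho>) * U)) - 4 * (- 3 * s\<^sup>2 * Z)
      = 12 * (s\<^sup>2 * Z) - s\<^sup>2 * (6 * \<rho> * (\<rho> + 1) * U + 60 * wt x * \<rho> * (1 - t) * V)" for U V Z
      by algebra
    from this[of "1 / a ^ 5" "1 / a ^ 7" "1 / r ^ 5"] show ?thesis by simp
  qed
  finally show ?thesis unfolding pa pr \<rho>_def t_def .
qed

subsection \<open>Approximation of the Green function by test functions\<close>

definition psi_arg :: "real \<Rightarrow> real^3 \<Rightarrow> real^3 \<Rightarrow> real" where
  "psi_arg s x y = Aq s x y powr (1/2) - Rq s x y powr (1/2)"

text \<open>The Green function with its square replaced by \<open>cutoff s\<close> and its distances
  regularised. Near and beyond the sphere the argument falls below \<open>s\<close>, which makes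
  this a test function, whereas \<open>green x\<close> has a singular point at \<open>x\<close> and
  reaches up to the sphere.\<close>

definition psi :: "real \<Rightarrow> real^3 \<Rightarrow> real^3 \<Rightarrow> real" where
  "psi s x y = cutoff s (psi_arg s x y) * Aq s x y powr (-1/2)"

lemma smooth3_psi_arg: "s > 0 \<Longrightarrow> smooth3 (psi_arg s x)"
  unfolding psi_arg_def[abs_def] by (intro smooth3_diff smooth3_Aq_powr smooth3_Rq_powr)

lemma smooth3_psi: "s > 0 \<Longrightarrow> smooth3 (psi s x)"
  unfolding psi_def[abs_def] by (intro smooth3_mult smooth3_cutoff smooth3_psi_arg smooth3_Aq_powr)

text \<open>Shifting both squares by the same \<open>s\<^sup>2\<close> leaves their difference
  intact. Its sign confines the support of \<open>psi s x\<close> to the ball.\<close>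

lemma Aq_minus_Rq: "Aq s x y - Rq s x y = wt x * wt y"
  unfolding Aq_eq Rq_eq wt_def
  by (simp add: power2_norm_eq_inner inner_diff_left inner_diff_right inner_commute[of y x] algebra_simps)

lemma psi_test_fun:
  assumes s: "s > 0" and x: "norm x < 1"
  shows "test_fun (ball 0 1) (psi s x)"
proof -
  define K where "K = {y. s \<le> psi_arg s x y}"
  have "closed K" unfolding K_def
    by (intro closed_Collect_le continuous_on_const smooth3_continuous smooth3_psi_arg s)
  have sub: "{y. psi s x y \<noteq> 0} \<subseteq> K"
  proof
    fix y assume "y \<in> {y. psi s x y \<noteq> 0}"
    then have "cutoff s (psi_arg s x y) \<noteq> 0" by (auto simp: psi_def)
    then have "\<not> psi_arg s x y \<le> s" using cutoff_zero by blast
    then show "y \<in> K" by (simp add: K_def)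
  qed
  have KB: "K \<subseteq> ball 0 1"
  proof
    fix y assume "y \<in> K"
    then have "s \<le> sqrt (Aq s x y) - sqrt (Rq s x y)"
      using powr_halves(1)[OF Aq_pos[OF s]] powr_halves(1)[OF Rq_pos[OF s]]
      by (simp add: K_def psi_arg_def)
    then have "sqrt (Rq s x y) < sqrt (Aq s x y)" using s by linarith
    then have "wt x * wt y > 0" using Aq_minus_Rq[of s x y] by simp
    then have "wt y > 0" using wt_pos[OF x] zero_less_mult_pos by blast
    then have "(norm y)\<^sup>2 < 1\<^sup>2" by (simp add: wt_def)
    then have "norm y < 1" by (rule power2_less_imp_less) simp
    then show "y \<in> ball 0 1" by simp
  qed
  have cl: "closure {y. psi s x y \<noteq> 0} \<subseteq> K" using sub \<open>closed K\<close> by (rule closure_minimal)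
  have "bounded (closure {y. psi s x y \<noteq> 0})"
    using bounded_subset[OF bounded_ball] cl KB by (meson subset_trans)
  then show ?thesis using cl KB smooth3_psi[OF s] by (auto simp: test_fun_def compact_eq_bounded_closed)
qed

text \<open>The formula of \<open>lap_psi\<close> with the values of the cutoff and its derivatives,
  the two regularised distances, \<open>(norm x)\<^sup>2\<close> and \<open>cross x y\<close> as
  free reals. The uniform bound and the limit thereby become real algebra.\<close>

definition psi_lap :: "real \<Rightarrow> real \<Rightarrow> real \<Rightarrow> real \<Rightarrow> real \<Rightarrow> real \<Rightarrow> real \<Rightarrow> real \<Rightarrow> real" where
  "psi_lap c0 c1 c2 a r s \<rho> w = - 3 * \<rho> * s\<^sup>2 * c0 / a ^ 5
     + 2 * c1 * (- \<rho> * (a\<^sup>2 - s\<^sup>2) / a ^ 4 + w / (r * a ^ 3))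
     + (1 / a) * (c2 * (\<rho> * (a\<^sup>2 - s\<^sup>2) / a\<^sup>2 - 2 * w / (a * r) + (r\<^sup>2 - s\<^sup>2) / r\<^sup>2)
       + c1 * (2 * \<rho> / a + \<rho> * s\<^sup>2 / a ^ 3 - 2 / r - s\<^sup>2 / r ^ 3))"

lemma gradp_diff_left:
  "smooth3 f \<Longrightarrow> smooth3 g \<Longrightarrow> gradp (\<lambda>y. f y - g y) h y = gradp f h y - gradp g h y"
  by (simp add: gradp_def partial_diff left_diff_distrib sum_subtractf)

lemma lap_psi:
  assumes s: "s > 0"
  shows "lap (psi s x) y = psi_lap (cutoff s (psi_arg s x y)) (cutoff' s (psi_arg s x y))
     (cutoff'' s (psi_arg s x y)) (sqrt (Aq s x y)) (sqrt (Rq s x y)) s ((norm x)\<^sup>2) (cross x y)"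
proof -
  define a r where "a = sqrt (Aq s x y)" and "r = sqrt (Rq s x y)"
  have A: "Aq s x y = a\<^sup>2" "a > 0" and R: "Rq s x y = r\<^sup>2" "r > 0"
    using Aq_pos[OF s, of x y] Rq_pos[OF s, of x y] by (auto simp: a_def r_def)
  note pa = powr_halves[OF Aq_pos[OF s, of x y], folded a_def]
  note pr = powr_halves[OF Rq_pos[OF s, of x y], folded r_def]
  define \<rho> w \<tau> where "\<rho> = (norm x)\<^sup>2" and "w = cross x y" and "\<tau> = psi_arg s x y"
  note sm = smooth3_Aq_powr[OF s] smooth3_Rq_powr[OF s]
  note gp = gradp_powr[OF smooth3_Aq Aq_pos[OF s] smooth3_Aq Aq_pos[OF s]]
    gradp_powr[OF smooth3_Aq Aq_pos[OF s] smooth3_Rq Rq_pos[OF s]]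
    gradp_powr[OF smooth3_Rq Rq_pos[OF s] smooth3_Rq Rq_pos[OF s]]
    gradp_powr[OF smooth3_Rq Rq_pos[OF s] smooth3_Aq Aq_pos[OF s]]
  have gRA: "gradp (Rq s x) (Aq s x) y = 4 * w" by (subst gradp_commute) (simp add: gradp_Aq_Rq w_def)
  note L1 = lap_Aq_halves(1)[OF s, of x y, folded a_def \<rho>_def]
  note L2 = lap_Aq_halves(3)[OF s, of x y, folded a_def \<rho>_def]
  note L3 = lap_Rq_halves(2)[OF s, of x y, folded r_def]
  have lt: "lap (psi_arg s x) y = 2 * \<rho> / a + \<rho> * s\<^sup>2 / a ^ 3 - 2 / r - s\<^sup>2 / r ^ 3"
    unfolding psi_arg_def[abs_def] by (simp add: lap_diff sm L2 L3)
  have g1: "gradp (psi_arg s x) (\<lambda>y. Aq s x y powr (-1/2)) y = - \<rho> * (a\<^sup>2 - s\<^sup>2) / a ^ 4 + w / (r * a ^ 3)"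
    unfolding psi_arg_def[abs_def] gradp_diff_left[OF sm] gp gRA gradp_Aq half_exponents pa pr unfolding A(1)
      \<rho>_def[symmetric]
    using A(2) R(2) by (simp add: field_simps power_numeral_reduce)
  have gA: "gradp (\<lambda>y. Aq s x y powr (1/2)) (psi_arg s x) y = \<rho> * (a\<^sup>2 - s\<^sup>2) / a\<^sup>2 - w / (a * r)"
    unfolding gradp_commute[of "\<lambda>y. Aq s x y powr (1/2)" "psi_arg s x"]
    unfolding psi_arg_def[abs_def] gradp_diff_left[OF sm]
      gp gRA gradp_Aq half_exponents pa pr unfolding A(1) \<rho>_def[symmetric]
    using A(2) R(2) by (simp add: field_simps power_numeral_reduce)
  have gR: "gradp (\<lambda>y. Rq s x y powr (1/2)) (psi_arg s x) y = w / (a * r) - (r\<^sup>2 - s\<^sup>2) / r\<^sup>2"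
    unfolding gradp_commute[of "\<lambda>y. Rq s x y powr (1/2)" "psi_arg s x"]
    unfolding psi_arg_def[abs_def] gradp_diff_left[OF sm]
      gp gradp_Aq_Rq gradp_Rq half_exponents pa pr unfolding R(1) w_def[symmetric]
    using A(2) R(2) by (simp add: field_simps power_numeral_reduce)
  have g2: "gradp (psi_arg s x) (psi_arg s x) y =
      \<rho> * (a\<^sup>2 - s\<^sup>2) / a\<^sup>2 - 2 * w / (a * r) + (r\<^sup>2 - s\<^sup>2) / r\<^sup>2"
  proof -
    have "gradp (psi_arg s x) (psi_arg s x) y = gradp (\<lambda>y. Aq s x y powr (1/2)) (psi_arg s x) y
       - gradp (\<lambda>y. Rq s x y powr (1/2)) (psi_arg s x) y"
      by (subst (1) psi_arg_def[abs_def]) (rule gradp_diff_left[OF sm])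
    then show ?thesis unfolding gA gR by simp
  qed
  have lc: "lap (\<lambda>y. cutoff s (psi_arg s x y)) y = cutoff'' s \<tau> * gradp (psi_arg s x) (psi_arg s x) y
     + cutoff' s \<tau> * lap (psi_arg s x) y"
    unfolding \<tau>_def by (rule lap_comp[OF smooth3_psi_arg[OF s] cutoff_deriv[OF s]])
  have gc: "gradp (\<lambda>y. cutoff s (psi_arg s x y)) h y = cutoff' s \<tau> * gradp (psi_arg s x) h y" for h
    unfolding \<tau>_def by (rule gradp_comp_left[OF smooth3_psi_arg[OF s] cutoff_deriv(1)[OF s]])
  have "lap (psi s x) y = cutoff s \<tau> * (- 3 * \<rho> * s\<^sup>2 / a ^ 5)
     + 2 * (cutoff' s \<tau> * (- \<rho> * (a\<^sup>2 - s\<^sup>2) / a ^ 4 + w / (r * a ^ 3)))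
     + (1 / a) * (cutoff'' s \<tau> * (\<rho> * (a\<^sup>2 - s\<^sup>2) / a\<^sup>2 - 2 * w / (a * r) + (r\<^sup>2 - s\<^sup>2) / r\<^sup>2)
       + cutoff' s \<tau> * (2 * \<rho> / a + \<rho> * s\<^sup>2 / a ^ 3 - 2 / r - s\<^sup>2 / r ^ 3))"
    unfolding psi_def[abs_def]
      lap_mult[OF smooth3_cutoff[OF s smooth3_psi_arg[OF s]] sm(1)] gc lc L1 g1 g2 lt pa(2) \<tau>_def[symmetric]
    by simp
  then show ?thesis unfolding psi_lap_def a_def[symmetric] r_def[symmetric] \<rho>_def[symmetric]
      w_def[symmetric] \<tau>_def[symmetric] by (simp add: mult_ac)
qed

text \<open>Once every datum is scaled to absolute value at most 1, only the powers
  \<open>1 / a\<close>, \<open>1 / a\<^sup>2\<close> and \<open>1 / r\<close> remain, with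
  coefficients of size at most 17, 16 and 6. A single power of \<open>1 / d\<close> is square
  integrable in dimension three.\<close>

lemma psi_lap_bound:
  assumes m: "0 < m" "m \<le> a" "m \<le> 1" and s: "0 < s" "s \<le> a" "s \<le> r" and d: "0 < d" "d \<le> r"
    and w: "\<bar>w\<bar> \<le> 2 * r" and \<rho>: "0 \<le> \<rho>" "\<rho> \<le> 1"
    and c: "\<bar>c0\<bar> \<le> a\<^sup>2" "\<bar>c1\<bar> \<le> 2 * a" "\<bar>c2\<bar> \<le> 2"
  shows "\<bar>psi_lap c0 c1 c2 a r s \<rho> w\<bar> \<le> 35 / m\<^sup>2 + 6 / d"
proof -
  have a: "a > 0" "r > 0" using m s by auto
  define C0 C1 C2 S T W where "C0 = c0 / a\<^sup>2" and "C1 = c1 / (2 * a)" and "C2 = c2 / 2"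
    and "S = s\<^sup>2 / a\<^sup>2" and "T = s\<^sup>2 / r\<^sup>2" and "W = w / (2 * r)"
  have eqs: "c0 = a\<^sup>2 * C0" "c1 = 2 * a * C1" "c2 = 2 * C2" "w = 2 * r * W"
    using a by (auto simp: C0_def C1_def C2_def W_def)
  have s2: "s\<^sup>2 = a\<^sup>2 * S" "s\<^sup>2 = r\<^sup>2 * T" using a by (auto simp: S_def T_def)
  have b: "\<bar>C0\<bar> \<le> 1" "\<bar>C1\<bar> \<le> 1" "\<bar>C2\<bar> \<le> 1" "\<bar>W\<bar> \<le> 1" "0 \<le> S" "S \<le> 1" "0 \<le> T" "T \<le> 1"
    using a c w s by (auto simp: C0_def C1_def C2_def W_def S_def T_def abs_mult power_mono)
  have P: "psi_lap c0 c1 c2 a r s \<rho> w =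
     (1 / a) * (- 3 * (\<rho> * S * C0) - 4 * (\<rho> * C1 * (1 - S)) + 2 * (C2 * \<rho> * (1 - S)) + 2 * (C2 * (1 - T))
        + 4 * (\<rho> * C1) + 2 * (\<rho> * C1 * S))
     + (1 / a\<^sup>2) * (8 * (C1 * W) - 8 * (C2 * W)) + (1 / r) * (- 4 * C1 - 2 * (C1 * T))"
  proof -
    have "psi_lap c0 c1 c2 a r s \<rho> w = - 3 * \<rho> * (a\<^sup>2 * S) * c0 / a ^ 5
     + 2 * c1 * (- \<rho> * (a\<^sup>2 - a\<^sup>2 * S) / a ^ 4 + w / (r * a ^ 3))
     + (1 / a) * (c2 * (\<rho> * (a\<^sup>2 - a\<^sup>2 * S) / a\<^sup>2 - 2 * w / (a * r) + (r\<^sup>2 - r\<^sup>2 * T) / r\<^sup>2)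
       + c1 * (2 * \<rho> / a + \<rho> * (a\<^sup>2 * S) / a ^ 3 - 2 / r - r\<^sup>2 * T / r ^ 3))"
      unfolding psi_lap_def s2(1)[symmetric] s2(2)[symmetric] ..
    also have "\<dots> = (1 / a) * (- 3 * (\<rho> * S * C0) - 4 * (\<rho> * C1 * (1 - S)) + 2 * (C2 * \<rho> * (1 - S))
        + 2 * (C2 * (1 - T)) + 4 * (\<rho> * C1) + 2 * (\<rho> * C1 * S))
     + (1 / a\<^sup>2) * (8 * (C1 * W) - 8 * (C2 * W)) + (1 / r) * (- 4 * C1 - 2 * (C1 * T))"
      unfolding eqs using a by (simp add: field_simps power_numeral_reduce)
    finally show ?thesis .
  qed
  have u: "\<bar>p * q\<bar> \<le> 1" if "\<bar>p\<bar> \<le> 1" "\<bar>q\<bar> \<le> 1" for p q :: real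
    using that by (simp add: abs_mult mult_le_one)
  have "\<bar>\<rho> * S * C0\<bar> \<le> 1" "\<bar>\<rho> * C1 * (1 - S)\<bar> \<le> 1" "\<bar>C2 * \<rho> * (1 - S)\<bar> \<le> 1"
    "\<bar>C2 * (1 - T)\<bar> \<le> 1" "\<bar>\<rho> * C1\<bar> \<le> 1" "\<bar>\<rho> * C1 * S\<bar> \<le> 1" "\<bar>C1 * W\<bar> \<le> 1"
    "\<bar>C2 * W\<bar> \<le> 1" "\<bar>C1 * T\<bar> \<le> 1"
    using b \<rho> by (auto intro!: u)
  note units = this
  have q1: "\<bar>- 3 * x1 - 4 * x2 + 2 * x3 + 2 * x4 + 4 * x5 + 2 * x6\<bar> \<le> 17"
    if "\<bar>x1\<bar> \<le> 1" "\<bar>x2\<bar> \<le> 1" "\<bar>x3\<bar> \<le> 1" "\<bar>x4\<bar> \<le> 1" "\<bar>x5\<bar> \<le> 1" "\<bar>x6\<bar> \<le> 1"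
    for x1 x2 x3 x4 x5 x6 :: real
    using that unfolding abs_le_iff by linarith
  have q2: "\<bar>8 * x1 - 8 * x2\<bar> \<le> 16" "\<bar>- 4 * x1 - 2 * x2\<bar> \<le> 6"
    if "\<bar>x1\<bar> \<le> 1" "\<bar>x2\<bar> \<le> 1" for x1 x2 :: real
    using that unfolding abs_le_iff by linarith+
  note q = q1[OF units(1-6)] q2(1)[OF units(7,8)] q2(2)[OF b(2) units(9)]
  have ia: "1 / a \<le> 1 / m\<^sup>2"
  proof -
    have "m\<^sup>2 \<le> m * 1" unfolding power2_eq_square using m by (intro mult_left_mono) auto
    then show ?thesis using m a by (intro divide_left_mono) auto
  qed
  have ia2: "1 / a\<^sup>2 \<le> 1 / m\<^sup>2" using m a by (intro divide_left_mono power_mono) auto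
  have ir: "1 / r \<le> 1 / d" using d by (intro divide_left_mono) auto
  have "\<bar>psi_lap c0 c1 c2 a r s \<rho> w\<bar> \<le> (1 / m\<^sup>2) * 17 + (1 / m\<^sup>2) * 16 + (1 / d) * 6"
    unfolding P
  proof (intro order_trans[OF abs_triangle_ineq] add_mono)
    have m': "\<bar>i * z\<bar> \<le> j * c" if "0 \<le> i" "i \<le> j" "\<bar>z\<bar> \<le> c" for i j z c :: real
      unfolding abs_mult using that by (intro mult_mono) auto
    show "\<bar>(1 / a) * (- 3 * (\<rho> * S * C0) - 4 * (\<rho> * C1 * (1 - S)) + 2 * (C2 * \<rho> * (1 - S))
        + 2 * (C2 * (1 - T)) + 4 * (\<rho> * C1) + 2 * (\<rho> * C1 * S))\<bar> \<le> (1 / m\<^sup>2) * 17"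
      using a by (intro m' ia q) simp
    show "\<bar>(1 / a\<^sup>2) * (8 * (C1 * W) - 8 * (C2 * W))\<bar> \<le> (1 / m\<^sup>2) * 16"
      by (intro m' ia2 q) simp
    show "\<bar>(1 / r) * (- 4 * C1 - 2 * (C1 * T))\<bar> \<le> (1 / d) * 6"
      using a by (intro m' ir q) simp
  qed
  also have "\<dots> \<le> 35 / m\<^sup>2 + 6 / d" by (simp add: divide_right_mono)
  finally show ?thesis .
qed

lemma psi_lap_limit:
  assumes A: "A > 0" "d > 0"
  shows "psi_lap ((A - d)\<^sup>2) (2 * (A - d)) 2 A d 0 \<rho> w = (2 * \<rho> + 6) / A - 4 * w / A ^ 3 - 4 / d"
  unfolding psi_lap_def using A by (simp add: field_simps power_numeral_reduce)

section \<open>Passage to the limit in the regularisation\<close>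

lemma sqrt_Rq_ge: "norm (x - y) \<le> sqrt (Rq s x y)" and sqrt_Rq_ge_s: "s \<ge> 0 \<Longrightarrow> s \<le> sqrt (Rq s x y)"
  by (auto simp: Rq_eq intro!: real_le_rsqrt)

lemma sqrt_Aq_ge_s: "s \<ge> 0 \<Longrightarrow> s \<le> sqrt (Aq s x y)"
  using Aq_ge[of s x y] zero_le_power2[of "1 - norm x * norm y"] by (intro real_le_rsqrt) linarith

lemma sqrt_Aq_ge:
  assumes "norm x < 1" "norm y < 1" shows "1 - norm x \<le> sqrt (Aq s x y)"
proof (rule real_le_rsqrt)
  have "norm x * norm y \<le> norm x * 1" using assms by (intro mult_left_mono) auto
  then have "(1 - norm x)\<^sup>2 \<le> (1 - norm x * norm y)\<^sup>2" using assms by (intro power_mono) auto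
  then show "(1 - norm x)\<^sup>2 \<le> Aq s x y" using Aq_ge[of s x y] zero_le_power2[of s] by linarith
qed

lemma psi_arg_sqrt: "s > 0 \<Longrightarrow> psi_arg s x y = sqrt (Aq s x y) - sqrt (Rq s x y)"
  unfolding psi_arg_def by (simp only: powr_halves(1)[OF Aq_pos] powr_halves(1)[OF Rq_pos])

lemma psi_arg_bounds:
  assumes "s > 0" "norm x < 1" "norm y < 1"
  shows "\<bar>psi_arg s x y\<bar> \<le> sqrt (Aq s x y)"
proof -
  have "wt x * wt y > 0" using assms wt_pos by simp
  then have "sqrt (Rq s x y) \<le> sqrt (Aq s x y)" using Aq_minus_Rq[of s x y] by simp
  moreover have "sqrt (Rq s x y) \<ge> 0" using Rq_pos[OF assms(1), of x y] by simp
  ultimately show ?thesis unfolding psi_arg_sqrt[OF assms(1)] by simp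
qed

lemma lap_psi_bound:
  assumes s: "s > 0" and xy: "norm x < 1" "norm y < 1" "y \<noteq> x"
  shows "\<bar>lap (psi s x) y\<bar> \<le> 35 / (1 - norm x)\<^sup>2 + 6 / norm (x - y)"
  unfolding lap_psi[OF s]
proof (rule psi_lap_bound)
  let ?a = "sqrt (Aq s x y)" and ?t = "psi_arg s x y"
  have t: "\<bar>?t\<bar> \<le> ?a" by (rule psi_arg_bounds[OF s xy(1,2)])
  have a: "?a > 0" using Aq_pos[OF s] by simp
  show "\<bar>cutoff s ?t\<bar> \<le> ?a\<^sup>2"
    using cutoff_bounds(1)[OF s, of ?t] power_mono[OF t, of 2] by simp
  show "\<bar>cutoff' s ?t\<bar> \<le> 2 * ?a" using cutoff_bounds(2)[OF s, of ?t] t by linarith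
  show "\<bar>cutoff'' s ?t\<bar> \<le> 2" by (rule cutoff_bounds(3)[OF s])
  show "\<bar>cross x y\<bar> \<le> 2 * sqrt (Rq s x y)" using cross_le[OF xy(1,2)] sqrt_Rq_ge[of x y s] by linarith
qed (use s xy sqrt_Aq_ge[OF xy(1,2), of s] sqrt_Aq_ge_s[of s x y] sqrt_Rq_ge_s[of s x y] sqrt_Rq_ge[of x y s]
  in \<open>auto simp: power_le_one\<close>)

lemma psi_bound:
  assumes s: "s > 0" "s \<le> 1" and xy: "norm x < 1" "norm y < 1"
  shows "\<bar>psi s x y\<bar> \<le> 3"
proof -
  let ?a = "sqrt (Aq s x y)" and ?t = "psi_arg s x y"
  have a: "?a > 0" using Aq_pos[OF s(1)] by simp
  have "\<bar>cutoff s ?t\<bar> \<le> ?a\<^sup>2"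
    using cutoff_bounds(1)[OF s(1), of ?t] power_mono[OF psi_arg_bounds[OF s(1) xy], of 2] by simp
  then have "\<bar>psi s x y\<bar> \<le> ?a\<^sup>2 * (1 / ?a)"
    unfolding psi_def powr_halves(2)[OF Aq_pos[OF s(1)]] abs_mult using a by (intro mult_mono) auto
  also have "\<dots> = ?a" using a by (simp add: real_div_sqrt)
  also have "\<dots> \<le> sqrt (3\<^sup>2)"
  proof (rule real_sqrt_le_mono)
    have "s\<^sup>2 \<le> 1" using s by (simp add: power_le_one)
    moreover have "(conj_dist x y)\<^sup>2 \<le> 2\<^sup>2"
      using conj_dist_le_2[OF xy] conj_dist_pos[OF xy] by (intro power_mono) auto
    ultimately show "Aq s x y \<le> 3\<^sup>2" unfolding Aq_conj_dist[OF xy] by simp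
  qed
  finally show ?thesis by simp
qed

context
  fixes s :: "nat \<Rightarrow> real" and x y :: "real^3"
  assumes s: "\<And>n. s n > 0" "s \<longlonglongrightarrow> 0" and xy: "norm x < 1" "norm y < 1" "y \<noteq> x"
begin

lemma sqrt_Aq_tendsto: "(\<lambda>n. sqrt (Aq (s n) x y)) \<longlonglongrightarrow> conj_dist x y"
proof -
  have "(\<lambda>n. sqrt ((s n)\<^sup>2 + (conj_dist x y)\<^sup>2)) \<longlonglongrightarrow> sqrt (0\<^sup>2 + (conj_dist x y)\<^sup>2)"
    by (intro tendsto_intros s)
  then show ?thesis using conj_dist_pos[OF xy(1,2)] by (simp add: Aq_conj_dist[OF xy(1,2)])
qed

lemma sqrt_Rq_tendsto: "(\<lambda>n. sqrt (Rq (s n) x y)) \<longlonglongrightarrow> norm (x - y)"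
proof -
  have "(\<lambda>n. sqrt ((s n)\<^sup>2 + (norm (x - y))\<^sup>2)) \<longlonglongrightarrow> sqrt (0\<^sup>2 + (norm (x - y))\<^sup>2)"
    by (intro tendsto_intros s)
  then show ?thesis by (simp add: Rq_eq)
qed

lemma conj_dist_gt_norm: "norm (x - y) < conj_dist x y"
proof -
  have "(norm (x - y))\<^sup>2 < (conj_dist x y)\<^sup>2"
    using wt_pos[OF xy(1)] wt_pos[OF xy(2)] by (simp add: conj_dist_def)
  then show ?thesis by (rule power2_less_imp_less) (use conj_dist_pos[OF xy(1,2)] in simp)
qed

lemma psi_arg_tendsto: "(\<lambda>n. psi_arg (s n) x y) \<longlonglongrightarrow> conj_dist x y - norm (x - y)"
  unfolding psi_arg_sqrt[OF s(1)] by (intro tendsto_intros sqrt_Aq_tendsto sqrt_Rq_tendsto)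

lemma cutoff_psi_arg_tendsto:
  "(\<lambda>n. cutoff (s n) (psi_arg (s n) x y)) \<longlonglongrightarrow> (conj_dist x y - norm (x - y))\<^sup>2"
  "(\<lambda>n. cutoff' (s n) (psi_arg (s n) x y)) \<longlonglongrightarrow> 2 * (conj_dist x y - norm (x - y))"
  "(\<lambda>n. cutoff'' (s n) (psi_arg (s n) x y)) \<longlonglongrightarrow> 2"
  using cutoff_tendsto[OF s(2) psi_arg_tendsto] conj_dist_gt_norm by simp_all

lemma psi_tendsto: "(\<lambda>n. psi (s n) x y) \<longlonglongrightarrow> green x y"
proof -
  have "(\<lambda>n. cutoff (s n) (psi_arg (s n) x y) * (1 / sqrt (Aq (s n) x y)))
     \<longlonglongrightarrow> (conj_dist x y - norm (x - y))\<^sup>2 * (1 / conj_dist x y)"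
    using conj_dist_pos[OF xy(1,2)] by (intro tendsto_intros cutoff_psi_arg_tendsto sqrt_Aq_tendsto) auto
  then show ?thesis unfolding psi_def powr_halves(2)[OF Aq_pos[OF s(1)]] green_def by simp
qed

lemma lap_psi_tendsto: "(\<lambda>n. lap (psi (s n) x) y) \<longlonglongrightarrow> dker x y"
proof -
  have A: "conj_dist x y > 0" "norm (x - y) > 0" using conj_dist_pos[OF xy(1,2)] xy by auto
  have "(\<lambda>n. lap (psi (s n) x) y) \<longlonglongrightarrow> psi_lap ((conj_dist x y - norm (x - y))\<^sup>2)
     (2 * (conj_dist x y - norm (x - y))) 2 (conj_dist x y) (norm (x - y)) 0 ((norm x)\<^sup>2) (cross x y)"
    unfolding lap_psi[OF s(1)] unfolding psi_lap_def
    using A by (intro tendsto_intros cutoff_psi_arg_tendsto sqrt_Aq_tendsto sqrt_Rq_tendsto s) auto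
  also have "psi_lap ((conj_dist x y - norm (x - y))\<^sup>2)
     (2 * (conj_dist x y - norm (x - y))) 2 (conj_dist x y) (norm (x - y)) 0 ((norm x)\<^sup>2) (cross x y)
     = (2 * (norm x)\<^sup>2 + 6) / conj_dist x y - 4 * cross x y / conj_dist x y ^ 3 - 4 / norm (x - y)"
    by (rule psi_lap_limit[OF A])
  also have "\<dots> = dker x y"
    unfolding dker_def cross_eq[OF xy(1,2)] using A(1)
    by (simp add: field_simps power_numeral_reduce)
  finally show ?thesis .
qed

text \<open>\<open>dreg\<close> and the Laplacian of \<open>psi\<close> regularise the same kernel
  for different purposes: the first has an explicit Laplacian and can be paired with any test
  function, the second comes from a test function. The common limit joins the two arguments.\<close>

lemma dreg_tendsto: "(\<lambda>n. dreg (s n) x y) \<longlonglongrightarrow> dker x y"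
proof -
  have A: "conj_dist x y > 0" "norm (x - y) > 0" using conj_dist_pos[OF xy(1,2)] xy by auto
  have "(\<lambda>n. (2 * (norm x)\<^sup>2 + 2) * (1 / sqrt (Aq (s n) x y))
     + 4 * wt x * ((1 - x \<bullet> y) * (1 / sqrt (Aq (s n) x y) ^ 3)) - 4 * (1 / sqrt (Rq (s n) x y)))
    \<longlonglongrightarrow> (2 * (norm x)\<^sup>2 + 2) * (1 / conj_dist x y)
     + 4 * wt x * ((1 - x \<bullet> y) * (1 / conj_dist x y ^ 3)) - 4 * (1 / norm (x - y))"
    using A by (intro tendsto_intros sqrt_Aq_tendsto sqrt_Rq_tendsto) auto
  then show ?thesis
    unfolding dreg_def powr_halves(2,3)[OF Aq_pos[OF s(1)]] powr_halves(2)[OF Rq_pos[OF s(1)]]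
    by (simp add: dker_def)
qed

end

definition sn :: "nat \<Rightarrow> real" where "sn n = 1 / real (Suc n)"

lemma sn: "sn n > 0" "sn n \<le> 1" "sn \<longlonglongrightarrow> 0"
  using LIMSEQ_inverse_real_of_nat by (auto simp: sn_def[abs_def] inverse_eq_divide)

text \<open>The bound on \<open>lap (psi s x)\<close> is uniform in \<open>s\<close> and passes to
  the limit.\<close>

lemma dker_bound:
  assumes xy: "norm x < 1" "norm y < 1" "y \<noteq> x"
  shows "\<bar>dker x y\<bar> \<le> 35 / (1 - norm x)\<^sup>2 + 6 / norm (x - y)"
proof (rule LIMSEQ_le_const2)
  show "(\<lambda>n. \<bar>lap (psi (sn n) x) y\<bar>) \<longlonglongrightarrow> \<bar>dker x y\<bar>"
    by (intro tendsto_rabs lap_psi_tendsto sn xy)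
  show "\<exists>N. \<forall>n\<ge>N. \<bar>lap (psi (sn n) x) y\<bar> \<le> 35 / (1 - norm x)\<^sup>2 + 6 / norm (x - y)"
    using lap_psi_bound[OF sn(1) xy] by blast
qed

lemma dker_borel [measurable]: "dker x \<in> borel_measurable borel"
  unfolding dker_def[abs_def] by measurable

lemma one_minus_inner_bound:
  assumes "norm x < 1" "norm y < 1" shows "0 \<le> 1 - x \<bullet> y" "1 - x \<bullet> y \<le> 2"
proof -
  have "\<bar>x \<bullet> y\<bar> \<le> norm x * norm y" by (rule Cauchy_Schwarz_ineq2)
  also have "\<dots> \<le> 1 * 1" using assms by (intro mult_mono) auto
  finally show "0 \<le> 1 - x \<bullet> y" "1 - x \<bullet> y \<le> 2" by auto
qed

lemma dreg_bound:
  assumes s: "s > 0" and xy: "norm x < 1" "norm y < 1" "y \<noteq> x"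
  shows "\<bar>dreg s x y\<bar> \<le> 4 / (1 - norm x) + 8 / (1 - norm x) ^ 3 + 4 / norm (x - y)"
proof -
  define m a r where "m = 1 - norm x" and "a = sqrt (Aq s x y)" and "r = sqrt (Rq s x y)"
  have m: "m > 0" "m \<le> a" "0 < norm (x - y)" "norm (x - y) \<le> r" "r > 0"
    using xy sqrt_Aq_ge[OF xy(1,2), of s] sqrt_Rq_ge[of x y s] Rq_pos[OF s, of x y]
    by (auto simp: m_def a_def r_def)
  have e: "dreg s x y = (2 * (norm x)\<^sup>2 + 2) * (1 / a) + 4 * wt x * ((1 - x \<bullet> y) * (1 / a ^ 3)) - 4 * (1 / r)"
    unfolding dreg_def powr_halves(2,3)[OF Aq_pos[OF s]] powr_halves(2)[OF Rq_pos[OF s]]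
    by (simp add: a_def r_def)
  have b1: "\<bar>(2 * (norm x)\<^sup>2 + 2) * (1 / a)\<bar> \<le> 4 * (1 / m)"
    unfolding abs_mult using m xy power_le_one[of "norm x" 2]
    by (intro mult_mono) (auto intro!: divide_left_mono)
  have b2: "\<bar>4 * wt x * ((1 - x \<bullet> y) * (1 / a ^ 3))\<bar> \<le> (4 * 1) * (2 * (1 / m ^ 3))"
    unfolding abs_mult using m xy one_minus_inner_bound[OF xy(1,2)] wt_pos[OF xy(1)] wt_le_1[of x]
    by (intro mult_mono) (auto intro!: divide_left_mono power_mono)
  have b3: "\<bar>4 * (1 / r)\<bar> \<le> 4 * (1 / norm (x - y))"
    unfolding abs_mult using m by (intro mult_mono) (auto intro!: divide_left_mono)
  show ?thesis unfolding e m_def[symmetric] using b1 b2 b3 by linarith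
qed

section \<open>Test functions in the ball\<close>

lemma test_fun_smooth3: "test_fun U \<phi> \<Longrightarrow> smooth3 \<phi>"
  by (simp add: test_fun_def)

lemma test_fun_zero:
  assumes t: "test_fun (ball 0 1) \<phi>" and y: "\<not> norm y < 1"
  shows "\<phi> y = 0" "partial i \<phi> y = 0" "partial j (partial i \<phi>) y = 0" "lap \<phi> y = 0"
proof -
  define S where "S = - closure {x. \<phi> x \<noteq> 0}"
  have S: "open S" "y \<in> S" using t y by (auto simp: S_def test_fun_def)
  have z: "\<phi> x = 0" if "x \<in> S" for x
    using that closure_subset[of "{x. \<phi> x \<noteq> 0}"] by (auto simp: S_def)
  show "\<phi> y = 0" by (rule z[OF S(2)])
  have z1: "partial i \<phi> x = 0" if "x \<in> S" for x i by (rule partial_zero_on_open[OF S(1) z that])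
  then show "partial i \<phi> y = 0" using S by blast
  have z2: "partial j (partial i \<phi>) x = 0" if "x \<in> S" for x i j
    by (rule partial_zero_on_open[OF S(1) z1 that])
  then show "partial j (partial i \<phi>) y = 0" using S by blast
  show "lap \<phi> y = 0" unfolding lap_def using z2[OF S(2)] by simp
qed

lemma test_fun_bdd_support: "test_fun (ball 0 1) \<phi> \<Longrightarrow> bdd_support \<phi>"
  unfolding bdd_support_def using test_fun_zero(1) by (metis less_asym')

lemma inv_norm_le: "6 / norm (x - y) \<le> 3 + 3 * invsq x y"
proof -
  have "0 \<le> (1 / norm (x - y) - 1)\<^sup>2" by simp
  then show ?thesis by (simp add: invsq_def power2_diff power_divide)
qed

text \<open>Green's identity moves the Laplacian onto \<open>dreg\<close>, where it splits into an
  approximate identity and a vanishing remainder. This is the representation formula that identifies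
  \<open>dker x\<close> as a fundamental solution with pole at \<open>x\<close>, tested inside the
  ball.\<close>

lemma dker_test_fun:
  assumes x: "norm x < 1" and t: "test_fun (ball 0 1) \<phi>"
  shows "(\<integral>y. dker x y * lap \<phi> y \<partial>lborel) = 12 * bump_mass * \<phi> x"
proof -
  have sm: "smooth3 \<phi>" and bs: "bdd_support \<phi>"
    using t by (auto simp: test_fun_smooth3 test_fun_bdd_support)
  obtain M where M: "M \<ge> 0" "\<And>y. \<bar>lap \<phi> y\<bar> \<le> M"
    using bdd_support_bounded[of "lap \<phi>"] sm bs by (metis smooth3_continuous smooth3_lap bdd_support_lap)
  obtain N where N: "N \<ge> 0" "\<And>y. \<bar>\<phi> y\<bar> \<le> N"
    using bdd_support_bounded[of \<phi>] sm bs by (metis smooth3_continuous)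
  have [measurable]: "lap \<phi> \<in> borel_measurable borel" "\<phi> \<in> borel_measurable borel"
    using sm by (auto intro: smooth3_borel smooth3_lap)
  define m where "m = 1 - norm x"
  have m: "m > 0" using x by (simp add: m_def)
  define K where "K = 4 / m + 8 / m ^ 3"
  have K: "K \<ge> 0" using m by (simp add: K_def)
  have lim1: "(\<lambda>n. \<integral>y. dreg (sn n) x y * lap \<phi> y \<partial>lborel) \<longlonglongrightarrow> (\<integral>y. dker x y * lap \<phi> y \<partial>lborel)"
  proof (rule integral_dominated_convergence)
    show "integrable lborel (\<lambda>y. (K + 3) * M * indicator (ball 0 1) y
        + 3 * M * (indicator (ball 0 1) y * invsq x y))"
      using ball_bounded_integrable[of "\<lambda>_. 1" 1] x
      by (intro Bochner_Integration.integrable_add integrable_mult_right invsq_integrable) auto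
    show "AE y in lborel. (\<lambda>n. dreg (sn n) x y * lap \<phi> y) \<longlonglongrightarrow> dker x y * lap \<phi> y"
      using AE_lborel_neq[of x]
    proof eventually_elim
      case (elim y)
      show ?case
      proof (cases "norm y < 1")
        case True
        then show ?thesis by (intro tendsto_intros dreg_tendsto sn x elim)
      qed (use test_fun_zero(4)[OF t] in simp)
    qed
    show "AE y in lborel. norm (dreg (sn n) x y * lap \<phi> y) \<le>
        (K + 3) * M * indicator (ball 0 1) y + 3 * M * (indicator (ball 0 1) y * invsq x y)" for n
      using AE_lborel_neq[of x]
    proof eventually_elim
      case (elim y)
      show ?case
      proof (cases "norm y < 1")
        case True
        have "\<bar>dreg (sn n) x y\<bar> \<le> K + 4 / norm (x - y)"
          using dreg_bound[OF sn(1) x True elim] by (simp add: K_def m_def)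
        also have "4 / norm (x - y) \<le> 6 / norm (x - y)" by (intro divide_right_mono) auto
        also have "\<dots> \<le> 3 + 3 * invsq x y" by (rule inv_norm_le)
        finally have "\<bar>dreg (sn n) x y\<bar> * \<bar>lap \<phi> y\<bar> \<le> (K + (3 + 3 * invsq x y)) * M"
          using M K by (intro mult_mono) auto
        then show ?thesis using True by (simp add: abs_mult algebra_simps)
      qed (use test_fun_zero(4)[OF t] in simp)
    qed
    show "(\<lambda>y. dreg (sn n) x y * lap \<phi> y) \<in> borel_measurable lborel" for n
      using smooth3_borel[OF smooth3_mult[OF smooth3_dreg[OF sn(1)] smooth3_lap[OF sm]]] by simp
  qed measurable
  define E where "E n y = 6 * (norm x)\<^sup>2 * ((norm x)\<^sup>2 + 1) * Aq (sn n) x y powr (-5/2)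
        + 60 * wt x * (norm x)\<^sup>2 * (1 - x \<bullet> y) * Aq (sn n) x y powr (-7/2)" for n y
  have sE: "smooth3 (E n)" for n unfolding E_def[abs_def]
    by (intro smooth3_add smooth3_mult smooth3_const smooth3_one_minus_inner smooth3_Aq_powr sn)
  have eq: "(\<integral>y. dreg (sn n) x y * lap \<phi> y \<partial>lborel) =
     12 * (\<integral>y. (sn n)\<^sup>2 * ((sn n)\<^sup>2 + (norm (x - y))\<^sup>2) powr (-5/2) * \<phi> y \<partial>lborel)
     - (\<integral>y. (sn n)\<^sup>2 * (E n y * \<phi> y) \<partial>lborel)" for n
  proof -
    have i1: "integrable lborel (\<lambda>y. (sn n)\<^sup>2 * (Rq (sn n) x y powr (-5/2)) * \<phi> y)"
      by (intro smooth3_integrable smooth3_mult smooth3_const smooth3_Rq_powr sn sm bdd_support_mult bs)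
    have i2: "integrable lborel (\<lambda>y. (sn n)\<^sup>2 * (E n y * \<phi> y))"
      by (intro smooth3_integrable smooth3_mult smooth3_const sE sm bdd_support_mult bs)
    have "(\<integral>y. dreg (sn n) x y * lap \<phi> y \<partial>lborel) = (\<integral>y. lap (dreg (sn n) x) y * \<phi> y \<partial>lborel)"
      by (rule green_identity[OF sm bs smooth3_dreg[OF sn(1)]])
    also have "\<dots> = (\<integral>y. 12 * ((sn n)\<^sup>2 * (Rq (sn n) x y powr (-5/2)) * \<phi> y)
        - (sn n)\<^sup>2 * (E n y * \<phi> y) \<partial>lborel)"
      unfolding lap_dreg[OF sn(1)] E_def by (simp add: algebra_simps)
    also have "\<dots> = 12 * (\<integral>y. (sn n)\<^sup>2 * (Rq (sn n) x y powr (-5/2)) * \<phi> y \<partial>lborel)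
        - (\<integral>y. (sn n)\<^sup>2 * (E n y * \<phi> y) \<partial>lborel)"
      using i1 i2 by simp
    finally show ?thesis unfolding Rq_eq .
  qed
  have lim2: "(\<lambda>n. \<integral>y. (sn n)\<^sup>2 * ((sn n)\<^sup>2 + (norm (x - y))\<^sup>2) powr (-5/2) * \<phi> y \<partial>lborel)
     \<longlonglongrightarrow> bump_mass * \<phi> x"
    by (rule approximate_identity[OF smooth3_continuous[OF sm] N(2) sn(1) sn(3)])
  \<comment> \<open>For \<open>y\<close> in the ball \<open>sqrt (Aq s x y)\<close> is at least
    \<open>m\<close>, which bounds \<open>E n\<close> independently of \<open>n\<close>.\<close>
  define L where "L = 12 * (1 / m ^ 5) + 120 * (1 / m ^ 7)"
  have L: "L \<ge> 0" using m by (simp add: L_def)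
  have Eb: "\<bar>E n y\<bar> \<le> L" if y: "norm y < 1" for n y
  proof -
    have a: "m \<le> sqrt (Aq (sn n) x y)" using sqrt_Aq_ge[OF x y] by (simp add: m_def)
    have ia: "\<bar>1 / sqrt (Aq (sn n) x y) ^ k\<bar> \<le> 1 / m ^ k" for k
    proof -
      have p: "sqrt (Aq (sn n) x y) ^ k > 0" using a m by (intro zero_less_power) linarith
      have "m ^ k \<le> sqrt (Aq (sn n) x y) ^ k" using a m by (intro power_mono) auto
      then have "1 / sqrt (Aq (sn n) x y) ^ k \<le> 1 / m ^ k" using m p by (intro divide_left_mono) auto
      then show ?thesis using p by simp
    qed
    have x2: "(norm x)\<^sup>2 \<le> 1" using x by (simp add: power_le_one)
    have b1: "\<bar>6 * (norm x)\<^sup>2 * ((norm x)\<^sup>2 + 1) * (1 / sqrt (Aq (sn n) x y) ^ 5)\<bar> \<le> (6 * 1 * (1 + 1)) * (1 / m ^ 5)"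
      unfolding abs_mult using m x2 by (intro mult_mono ia) auto
    have b2: "\<bar>60 * wt x * (norm x)\<^sup>2 * (1 - x \<bullet> y) * (1 / sqrt (Aq (sn n) x y) ^ 7)\<bar>
        \<le> (60 * 1 * 1 * 2) * (1 / m ^ 7)"
      unfolding abs_mult using m x2 wt_le_1[of x] wt_pos[OF x] one_minus_inner_bound[OF x y]
      by (intro mult_mono ia) auto
    show ?thesis
      using order_trans[OF abs_triangle_ineq add_mono[OF b1 b2]]
      unfolding E_def powr_halves(4,5)[OF Aq_pos[OF sn(1)]] L_def by simp
  qed
  have lim3: "(\<lambda>n. \<integral>y. (sn n)\<^sup>2 * (E n y * \<phi> y) \<partial>lborel) \<longlonglongrightarrow> (\<integral>y. 0 \<partial>(lborel :: (real^3) measure))"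
  proof (rule integral_dominated_convergence)
    have Ep: "\<bar>E n y * \<phi> y\<bar> \<le> L * \<bar>\<phi> y\<bar>" for n y
      unfolding abs_mult using Eb[of y n] test_fun_zero(1)[OF t, of y]
      by (cases "norm y < 1") (auto intro: mult_right_mono)
    show "integrable lborel (\<lambda>y. L * \<bar>\<phi> y\<bar>)"
      using smooth3_integrable[OF sm bs] by simp
    show "AE y in lborel. norm ((sn n)\<^sup>2 * (E n y * \<phi> y)) \<le> L * \<bar>\<phi> y\<bar>" for n
    proof (rule AE_I2)
      fix y
      have "(sn n)\<^sup>2 \<le> 1" using sn(1)[of n] sn(2)[of n] by (simp add: power_le_one)
      then have "\<bar>(sn n)\<^sup>2\<bar> * \<bar>E n y * \<phi> y\<bar> \<le> 1 * (L * \<bar>\<phi> y\<bar>)" using Ep L by (intro mult_mono) auto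
      then show "norm ((sn n)\<^sup>2 * (E n y * \<phi> y)) \<le> L * \<bar>\<phi> y\<bar>" by (simp add: abs_mult)
    qed
    show "AE y in lborel. (\<lambda>n. (sn n)\<^sup>2 * (E n y * \<phi> y)) \<longlonglongrightarrow> 0"
    proof (rule AE_I2)
      fix y
      have "(\<lambda>n. (sn n)\<^sup>2 * (L * \<bar>\<phi> y\<bar>)) \<longlonglongrightarrow> 0\<^sup>2 * (L * \<bar>\<phi> y\<bar>)" by (intro tendsto_intros sn)
      then have "(\<lambda>n. (sn n)\<^sup>2 * (L * \<bar>\<phi> y\<bar>)) \<longlonglongrightarrow> 0" by simp
      then show "(\<lambda>n. (sn n)\<^sup>2 * (E n y * \<phi> y)) \<longlonglongrightarrow> 0"
      proof (rule Lim_null_comparison[rotated])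
        show "\<forall>\<^sub>F n in sequentially. norm ((sn n)\<^sup>2 * (E n y * \<phi> y)) \<le> (sn n)\<^sup>2 * (L * \<bar>\<phi> y\<bar>)"
          using Ep by (auto intro!: always_eventually mult_left_mono simp: abs_mult[of "(sn _)\<^sup>2"])
      qed
    qed
    show "(\<lambda>y. (sn n)\<^sup>2 * (E n y * \<phi> y)) \<in> borel_measurable lborel" for n
      using smooth3_borel[OF smooth3_mult[OF smooth3_const smooth3_mult[OF sE sm]]] by simp
  qed simp
  have "(\<lambda>n. \<integral>y. dreg (sn n) x y * lap \<phi> y \<partial>lborel) \<longlonglongrightarrow> 12 * (bump_mass * \<phi> x) - (\<integral>y. 0 \<partial>(lborel :: (real^3) measure))"
    unfolding eq by (intro tendsto_intros lim2 lim3)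
  then show ?thesis using LIMSEQ_unique[OF lim1] by simp
qed

section \<open>Square integrable functions on the ball\<close>

lemma abs_mult_le_sum_squares: "\<bar>p * q\<bar> \<le> p\<^sup>2 + q\<^sup>2" for p q :: real
proof -
  have "2 * (\<bar>p\<bar> * \<bar>q\<bar>) \<le> p\<^sup>2 + q\<^sup>2" using sum_squares_bound[of "\<bar>p\<bar>" "\<bar>q\<bar>"] by simp
  moreover have "0 \<le> \<bar>p\<bar> * \<bar>q\<bar>" by simp
  ultimately show ?thesis unfolding abs_mult by linarith
qed

text \<open>The weak formulation integrates with respect to \<open>lebesgue\<close>, the kernel
  calculus with respect to \<open>lborel\<close>. \<open>ball_integral_lborel\<close> passes between
  them for Borel functions.\<close>

definition ball_integral :: "(real^3 \<Rightarrow> real) \<Rightarrow> real" where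
  "ball_integral f = (\<integral>y. indicator (ball 0 1) y * f y \<partial>lebesgue)"

lemma set_integral_ball: "set_lebesgue_integral lebesgue (ball 0 1) f = ball_integral f"
  by (simp add: ball_integral_def set_lebesgue_integral_def)

lemma L2_ball_iff: "L2 (ball 0 1) f \<longleftrightarrow> (\<lambda>y. indicator (ball 0 1) y * f y) \<in> borel_measurable lebesgue \<and>
    integrable lebesgue (\<lambda>y. indicator (ball 0 1) y * (f y)\<^sup>2)"
  by (simp add: L2_def set_borel_measurable_def set_integrable_def)

lemma ball_lebesgue_pred [measurable]: "Measurable.pred lebesgue (\<lambda>y::real^3. y \<in> ball 0 1)"
  by (simp add: pred_def)

lemma ball_integral_lborel:
  assumes "f \<in> borel_measurable borel"
  shows "ball_integral f = (\<integral>y. indicator (ball 0 1) y * f y \<partial>lborel)"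
proof -
  have "(\<lambda>y. indicator (ball 0 1) y * f y) \<in> borel_measurable lborel" using assms by measurable
  then show ?thesis unfolding ball_integral_def by (rule integral_completion)
qed

lemma borel_lebesgue: "f \<in> borel_measurable borel \<Longrightarrow> f \<in> borel_measurable lebesgue"
  by (intro measurable_completion) simp

lemma L2_mult_measurable:
  assumes "L2 (ball 0 1) f" "L2 (ball 0 1) g"
  shows "(\<lambda>y. indicator (ball 0 1) y * (f y * g y)) \<in> borel_measurable lebesgue"
proof -
  have "(\<lambda>y. (indicator (ball 0 1) y * f y) * (indicator (ball 0 1) y * g y)) \<in> borel_measurable lebesgue"
    using assms unfolding L2_ball_iff by (intro borel_measurable_times[of "\<lambda>y. _ y * f y"]) blast+
  moreover have "(indicator (ball 0 1) y * f y) * (indicator (ball 0 1) y * g y)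
      = indicator (ball 0 1) y * (f y * g y)" for y :: "real^3"
    by (simp add: indicator_def)
  ultimately show ?thesis by simp
qed

lemma L2_mult_integrable:
  assumes f: "L2 (ball 0 1) f" and g: "L2 (ball 0 1) g"
  shows "integrable lebesgue (\<lambda>y. indicator (ball 0 1) y * (f y * g y))"
proof (rule Bochner_Integration.integrable_bound)
  show "integrable lebesgue (\<lambda>y. indicator (ball 0 1) y * (f y)\<^sup>2 + indicator (ball 0 1) y * (g y)\<^sup>2)"
    using f g by (intro Bochner_Integration.integrable_add) (auto simp: L2_ball_iff)
  show "AE y in lebesgue. norm (indicator (ball 0 1) y * (f y * g y)) \<le>
      norm (indicator (ball 0 1) y * (f y)\<^sup>2 + indicator (ball 0 1) y * (g y)\<^sup>2)"
  proof (rule AE_I2)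
    fix y
    have "\<bar>f y * g y\<bar> \<le> (f y)\<^sup>2 + (g y)\<^sup>2"
      by (rule abs_mult_le_sum_squares)
    then show "norm (indicator (ball 0 1) y * (f y * g y)) \<le>
      norm (indicator (ball 0 1) y * (f y)\<^sup>2 + indicator (ball 0 1) y * (g y)\<^sup>2)"
      by (simp add: indicator_def)
  qed
qed (rule L2_mult_measurable[OF f g])

lemma L2_add:
  assumes f: "L2 (ball 0 1) f" and g: "L2 (ball 0 1) g"
  shows "L2 (ball 0 1) (\<lambda>y. f y + g y)"
proof -
  have "(\<lambda>y. indicator (ball 0 1) y * f y + indicator (ball 0 1) y * g y) \<in> borel_measurable lebesgue"
    using f g by (intro borel_measurable_add) (auto simp: L2_ball_iff)
  moreover have "integrable lebesgue (\<lambda>y. indicator (ball 0 1) y * (f y)\<^sup>2 + indicator (ball 0 1) y * (g y)\<^sup>2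
      + 2 * (indicator (ball 0 1) y * (f y * g y)))"
    using f g L2_mult_integrable[OF f g]
    by (intro Bochner_Integration.integrable_add integrable_mult_right) (auto simp: L2_ball_iff)
  ultimately show ?thesis
    by (simp add: L2_ball_iff algebra_simps power2_sum)
qed

lemma L2_cmult: "L2 (ball 0 1) f \<Longrightarrow> L2 (ball 0 1) (\<lambda>y. c * f y)"
proof -
  assume f: "L2 (ball 0 1) f"
  have "(\<lambda>y. c * (indicator (ball 0 1) y * f y)) \<in> borel_measurable lebesgue"
    using f unfolding L2_ball_iff by (intro borel_measurable_times[OF borel_measurable_const]) blast
  moreover have "integrable lebesgue (\<lambda>y. c\<^sup>2 * (indicator (ball 0 1) y * (f y)\<^sup>2))"
    using f by (intro integrable_mult_right) (auto simp: L2_ball_iff)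
  ultimately show ?thesis by (simp add: L2_ball_iff power_mult_distrib mult.left_commute)
qed

lemma L2_diff: "L2 (ball 0 1) f \<Longrightarrow> L2 (ball 0 1) g \<Longrightarrow> L2 (ball 0 1) (\<lambda>y. f y - g y)"
  using L2_add[of f "\<lambda>y. -1 * g y"] L2_cmult[of g "-1"] by simp

lemma L2_dominated:
  assumes f: "f \<in> borel_measurable borel" and M: "\<And>y. norm y < 1 \<Longrightarrow> y \<noteq> x \<Longrightarrow> (f y)\<^sup>2 \<le> K + L * invsq x y"
    and x: "norm x < 1"
  shows "L2 (ball 0 1) f"
proof -
  have b: "integrable lborel (\<lambda>y. indicator (ball 0 1) y * (f y)\<^sup>2)"
  proof (rule Bochner_Integration.integrable_bound)
    show "integrable lborel (\<lambda>y. K * indicator (ball 0 1) y + L * (indicator (ball 0 1) y * invsq x y))"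
      using ball_bounded_integrable[of "\<lambda>_. 1" 1] x
      by (intro Bochner_Integration.integrable_add integrable_mult_right invsq_integrable) auto
    show "AE y in lborel. norm (indicator (ball 0 1) y * (f y)\<^sup>2) \<le>
      norm (K * indicator (ball 0 1) y + L * (indicator (ball 0 1) y * invsq x y))"
      using AE_lborel_neq[of x]
    proof eventually_elim
      case (elim y)
      then show ?case using M[of y] by (auto simp: indicator_def)
    qed
    show "(\<lambda>y. indicator (ball 0 1) y * (f y)\<^sup>2) \<in> borel_measurable lborel" using f by measurable
  qed
  have m: "(\<lambda>y. indicator (ball 0 1) y * f y) \<in> borel_measurable borel"
    using f by measurable
  show ?thesis unfolding L2_ball_iff
    using integrable_completion[of "\<lambda>y. indicator (ball 0 1) y * (f y)\<^sup>2" lborel]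
      borel_measurable_integrable[OF b] b borel_lebesgue[OF m] by blast
qed

lemma L2_bounded:
  assumes f: "f \<in> borel_measurable borel" and M: "\<And>y. norm y < 1 \<Longrightarrow> \<bar>f y\<bar> \<le> M"
  shows "L2 (ball 0 1) f"
proof (rule L2_dominated[where x = 0 and K = "M\<^sup>2" and L = 0])
  fix y :: "real^3" assume "norm y < 1"
  then show "(f y)\<^sup>2 \<le> M\<^sup>2 + 0 * invsq 0 y" using power_mono[OF M, of y 2] by simp
qed (use f in auto)

lemma L2_smooth3:
  assumes "smooth3 f" shows "L2 (ball 0 1) f"
proof -
  have "compact (f ` cball 0 1)"
    by (intro compact_continuous_image continuous_on_subset[OF smooth3_continuous[OF assms]]) auto
  then have "bounded (f ` cball 0 1)" by (rule compact_imp_bounded)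
  then obtain M where "\<forall>y\<in>cball 0 1. \<bar>f y\<bar> \<le> M" unfolding bounded_iff by auto
  then show ?thesis using assms by (intro L2_bounded[of f M] smooth3_borel) auto
qed

text \<open>From \<open>(p + q)\<^sup>2 \<le> 2 * p\<^sup>2 + 2 * q\<^sup>2\<close>; the constant 72
  is \<open>2 * 6\<^sup>2\<close>.\<close>

lemma sq_le_invsq:
  assumes "\<bar>f\<bar> \<le> K + 6 / norm (x - y)"
  shows "f\<^sup>2 \<le> 2 * K\<^sup>2 + 72 * invsq x y"
proof -
  have "f\<^sup>2 \<le> (K + 6 / norm (x - y))\<^sup>2" using power_mono[OF assms, of 2] by simp
  also have "\<dots> \<le> 2 * K\<^sup>2 + 2 * (6 / norm (x - y))\<^sup>2"
    using sum_squares_bound[of K "6 / norm (x - y)"] by (simp add: power2_sum)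
  finally show ?thesis by (simp add: invsq_def power_divide)
qed

text \<open>The singularity of order one is square integrable in dimension three. Thus mere L2
  convergence of second derivatives gives convergence of the pairing at each fixed
  \<open>x\<close>.\<close>

lemma L2_dker: "norm x < 1 \<Longrightarrow> L2 (ball 0 1) (dker x)"
  by (rule L2_dominated[where x = x and K = "2 * (35 / (1 - norm x)\<^sup>2)\<^sup>2" and L = 72])
     (auto intro: sq_le_invsq dker_bound)

lemma ball_integral_diff:
  assumes "integrable lebesgue (\<lambda>y. indicator (ball 0 1) y * f y)"
    "integrable lebesgue (\<lambda>y. indicator (ball 0 1) y * g y)"
  shows "ball_integral (\<lambda>y. f y - g y) = ball_integral f - ball_integral g"
  using assms by (simp add: ball_integral_def right_diff_distrib)

lemma ball_integral_cmult: "ball_integral (\<lambda>y. c * f y) = c * ball_integral f"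
proof -
  have "ball_integral (\<lambda>y. c * f y) = (\<integral>y. c * (indicator (ball 0 1) y * f y) \<partial>lebesgue)"
    unfolding ball_integral_def by (simp add: mult.left_commute)
  then show ?thesis by (simp add: ball_integral_def)
qed

lemma ball_integral_sum:
  assumes "\<And>i. i \<in> I \<Longrightarrow> integrable lebesgue (\<lambda>y. indicator (ball 0 1) y * f i y)"
  shows "ball_integral (\<lambda>y. \<Sum>i\<in>I. f i y) = (\<Sum>i\<in>I. ball_integral (f i))"
  using assms by (simp add: ball_integral_def sum_distrib_left)

text \<open>Young's inequality with a free parameter \<open>t\<close> takes the place of the Cauchy-Schwarz inequality.\<close>

lemma L2_pairing_tendsto_0:
  assumes k: "L2 (ball 0 1) k" and e: "\<And>n. L2 (ball 0 1) (e n)"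
    and lim: "(\<lambda>n. ball_integral (\<lambda>y. (e n y)\<^sup>2)) \<longlonglongrightarrow> 0"
  shows "(\<lambda>n. ball_integral (\<lambda>y. k y * e n y)) \<longlonglongrightarrow> 0"
proof (rule LIMSEQ_I)
  fix r :: real assume r: "r > 0"
  define Q where "Q = ball_integral (\<lambda>y. (k y)\<^sup>2)"
  have Q: "Q \<ge> 0" unfolding Q_def ball_integral_def by (intro Bochner_Integration.integral_nonneg) simp
  define t where "t = r / (2 * (Q + 1))"
  have t: "t > 0" using r Q by (simp add: t_def)
  have tQ: "t * Q \<le> r / 2" using r Q by (simp add: t_def field_simps)
  have bnd: "\<bar>ball_integral (\<lambda>y. k y * e n y)\<bar> \<le> t * Q + (1 / t) * ball_integral (\<lambda>y. (e n y)\<^sup>2)" for n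
  proof -
    have i: "integrable lebesgue (\<lambda>y. indicator (ball 0 1) y * (k y)\<^sup>2)"
      "integrable lebesgue (\<lambda>y. indicator (ball 0 1) y * (e n y)\<^sup>2)"
      using k e[of n] by (auto simp: L2_ball_iff)
    have "\<bar>\<integral>y. indicator (ball 0 1) y * (k y * e n y) \<partial>lebesgue\<bar> \<le>
      (\<integral>y. t * (indicator (ball 0 1) y * (k y)\<^sup>2) + (1 / t) * (indicator (ball 0 1) y * (e n y)\<^sup>2) \<partial>lebesgue)"
    proof (rule integral_abs_bound_mono)
      fix y
      have "\<bar>k y * e n y\<bar> \<le> t * (k y)\<^sup>2 + (1 / t) * (e n y)\<^sup>2"
      proof -
        have "0 \<le> (t * \<bar>k y\<bar> - \<bar>e n y\<bar>)\<^sup>2 + t * \<bar>k y * e n y\<bar>" using t by simp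
        also have "\<dots> = t\<^sup>2 * (k y)\<^sup>2 + (e n y)\<^sup>2 - t * \<bar>k y * e n y\<bar>"
          by (simp add: power2_diff power_mult_distrib abs_mult)
        finally have "\<bar>k y * e n y\<bar> * t \<le> t\<^sup>2 * (k y)\<^sup>2 + (e n y)\<^sup>2" by (simp add: mult.commute)
        then have "\<bar>k y * e n y\<bar> \<le> (t\<^sup>2 * (k y)\<^sup>2 + (e n y)\<^sup>2) / t" using t by (simp add: pos_le_divide_eq)
        also have "\<dots> = t * (k y)\<^sup>2 + (1 / t) * (e n y)\<^sup>2" using t by (simp add: add_divide_distrib power2_eq_square)
        finally show ?thesis .
      qed
      then show "\<bar>indicator (ball 0 1) y * (k y * e n y)\<bar> \<le>
        t * (indicator (ball 0 1) y * (k y)\<^sup>2) + (1 / t) * (indicator (ball 0 1) y * (e n y)\<^sup>2)"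
        by (simp add: indicator_def)
    qed (use i L2_mult_integrable[OF k e] in auto)
    then show ?thesis using i unfolding ball_integral_def Q_def by simp
  qed
  have "t * (r / 2) > 0" using t r by simp
  then obtain N where N: "\<And>n. n \<ge> N \<Longrightarrow> \<bar>ball_integral (\<lambda>y. (e n y)\<^sup>2)\<bar> < t * (r / 2)"
    using LIMSEQ_D[OF lim] by (metis diff_zero real_norm_def)
  show "\<exists>N. \<forall>n\<ge>N. norm (ball_integral (\<lambda>y. k y * e n y) - 0) < r"
  proof (intro exI[of _ N] allI impI)
    fix n assume "n \<ge> N"
    then have "ball_integral (\<lambda>y. (e n y)\<^sup>2) < t * (r / 2)" using N by fastforce
    then have "(1 / t) * ball_integral (\<lambda>y. (e n y)\<^sup>2) < (1 / t) * (t * (r / 2))"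
      using t by (intro mult_strict_left_mono) auto
    then have "(1 / t) * ball_integral (\<lambda>y. (e n y)\<^sup>2) < r / 2" using t by simp
    then show "norm (ball_integral (\<lambda>y. k y * e n y) - 0) < r" using bnd[of n] tQ
      unfolding real_norm_def diff_zero by linarith
  qed
qed

lemma L2_pairing_tendsto:
  assumes k: "L2 (ball 0 1) k" and e: "\<And>n. L2 (ball 0 1) (e n)" and g: "L2 (ball 0 1) g"
    and lim: "(\<lambda>n. ball_integral (\<lambda>y. (e n y - g y)\<^sup>2)) \<longlonglongrightarrow> 0"
  shows "(\<lambda>n. ball_integral (\<lambda>y. k y * e n y)) \<longlonglongrightarrow> ball_integral (\<lambda>y. k y * g y)"
proof -
  have "(\<lambda>n. ball_integral (\<lambda>y. k y * (e n y - g y))) \<longlonglongrightarrow> 0"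
    by (intro L2_pairing_tendsto_0 k L2_diff e g lim)
  moreover have "ball_integral (\<lambda>y. k y * (e n y - g y)) =
      ball_integral (\<lambda>y. k y * e n y) - ball_integral (\<lambda>y. k y * g y)" for n
    unfolding right_diff_distrib by (intro ball_integral_diff L2_mult_integrable k e g)
  ultimately have "(\<lambda>n. ball_integral (\<lambda>y. k y * e n y) - ball_integral (\<lambda>y. k y * g y)) \<longlonglongrightarrow> 0"
    by simp
  then show ?thesis by (rule LIM_zero_cancel)
qed

text \<open>This is completeness of Lebesgue measure. It is applied to \<open>f (v x)\<close> times
  a test function, which is known only to agree almost everywhere with a measurable
  function.\<close>

lemma lebesgue_measurable_AE:
  fixes f g :: "real^3 \<Rightarrow> real"
  assumes f: "f \<in> borel_measurable lebesgue" and ae: "AE y in lebesgue. f y = g y"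
  shows "g \<in> borel_measurable lebesgue"
proof (rule measurableI)
  fix S :: "real set" assume S: "S \<in> sets borel"
  show "g -` S \<inter> space lebesgue \<in> sets lebesgue"
  proof (rule completion.in_sets_AE)
    show "AE y in lebesgue. (y \<in> f -` S \<inter> space lebesgue) = (y \<in> g -` S \<inter> space lebesgue)"
      using ae by eventually_elim simp
    show "f -` S \<inter> space lebesgue \<in> sets lebesgue" by (rule measurable_sets[OF f S])
  qed simp
qed simp

lemma integral_cong_AE_lebesgue:
  fixes f g :: "real^3 \<Rightarrow> real"
  assumes "f \<in> borel_measurable lebesgue" "AE y in lebesgue. f y = g y"
  shows "integral\<^sup>L lebesgue f = integral\<^sup>L lebesgue g"
  using assms lebesgue_measurable_AE[OF assms] by (intro integral_cong_AE) auto

text \<open>As \<open>W\<close> is merely square integrable, the product is dominated by the sum of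
  the squares; the square of \<open>lap (psi (sn n) x)\<close> has a bound in terms of
  \<open>invsq x\<close> that is the same for all \<open>n\<close>.\<close>

lemma dker_lap_psi_pairing_tendsto:
  assumes x: "norm x < 1" and W: "L2 (ball 0 1) W"
  shows "(\<lambda>n. ball_integral (\<lambda>y. lap (psi (sn n) x) y * W y)) \<longlonglongrightarrow> ball_integral (\<lambda>y. dker x y * W y)"
  unfolding ball_integral_def
proof (rule integral_dominated_convergence)
  let ?K = "35 / (1 - norm x)\<^sup>2"
  have L: "L2 (ball 0 1) (lap (psi (sn n) x))" for n
    by (intro L2_smooth3 smooth3_lap smooth3_psi sn)
  have bor: "(\<lambda>y. indicator (ball 0 1) y * invsq x y) \<in> borel_measurable lborel" by measurable
  have i1: "integrable lebesgue (\<lambda>y. indicator (ball 0 1) y * invsq x y)"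
    using integrable_completion[OF bor] invsq_integrable(1)[OF x] by blast
  have i0: "integrable lebesgue (\<lambda>y::real^3. indicator (ball 0 1) y :: real)"
    using L2_bounded[of "\<lambda>_. 1" 1] by (simp add: L2_ball_iff)
  show "integrable lebesgue (\<lambda>y. 2 * ?K\<^sup>2 * indicator (ball 0 1) y
      + 72 * (indicator (ball 0 1) y * invsq x y) + indicator (ball 0 1) y * (W y)\<^sup>2)"
    using W by (intro Bochner_Integration.integrable_add integrable_mult_right i0 i1) (simp add: L2_ball_iff)
  show "AE y in lebesgue. (\<lambda>n. indicator (ball 0 1) y * (lap (psi (sn n) x) y * W y))
      \<longlonglongrightarrow> indicator (ball 0 1) y * (dker x y * W y)"
    using AE_completion[OF AE_lborel_neq[of x]]
  proof eventually_elim
    case (elim y)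
    show ?case
    proof (cases "norm y < 1")
      case True
      then show ?thesis by (intro tendsto_intros lap_psi_tendsto sn x elim)
    qed simp
  qed
  show "AE y in lebesgue. norm (indicator (ball 0 1) y * (lap (psi (sn n) x) y * W y)) \<le>
      2 * ?K\<^sup>2 * indicator (ball 0 1) y + 72 * (indicator (ball 0 1) y * invsq x y)
      + indicator (ball 0 1) y * (W y)\<^sup>2" for n
    using AE_completion[OF AE_lborel_neq[of x]]
  proof eventually_elim
    case (elim y)
    show ?case
    proof (cases "norm y < 1")
      case True
      have "(lap (psi (sn n) x) y)\<^sup>2 \<le> 2 * ?K\<^sup>2 + 72 * invsq x y"
        by (rule sq_le_invsq[OF lap_psi_bound[OF sn(1) x True elim]])
      moreover have "\<bar>lap (psi (sn n) x) y * W y\<bar> \<le> (lap (psi (sn n) x) y)\<^sup>2 + (W y)\<^sup>2"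
        by (rule abs_mult_le_sum_squares)
      ultimately show ?thesis using True by simp
    qed simp
  qed
qed (use L2_mult_measurable[OF L2_dker[OF x] W]
       L2_mult_measurable[OF L2_smooth3[OF smooth3_lap[OF smooth3_psi[OF sn(1)]]] W] in auto)

lemma psi_pairing_tendsto:
  assumes x: "norm x < 1" and F: "F \<in> borel_measurable borel" "\<And>y. \<bar>F y\<bar> \<le> M"
  shows "(\<lambda>n. ball_integral (\<lambda>y. F y * psi (sn n) x y)) \<longlonglongrightarrow>
    (\<integral>y. indicator (ball 0 1) y * (green x y * F y) \<partial>lborel)"
proof -
  have [measurable]: "psi (sn n) x \<in> borel_measurable borel" for n
    by (intro smooth3_borel smooth3_psi sn)
  note [measurable] = F(1)
  have "ball_integral (\<lambda>y. F y * psi (sn n) x y) =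
      (\<integral>y. indicator (ball 0 1) y * (psi (sn n) x y * F y) \<partial>lborel)" for n
    by (subst ball_integral_lborel) (auto simp: mult.commute)
  moreover have "(\<lambda>n. \<integral>y. indicator (ball 0 1) y * (psi (sn n) x y * F y) \<partial>lborel) \<longlonglongrightarrow>
    (\<integral>y. indicator (ball 0 1) y * (green x y * F y) \<partial>lborel)"
  proof (rule integral_dominated_convergence)
    show "integrable lborel (\<lambda>y. indicator (ball (0::real^3) 1) y * (3 * M))"
      by (rule ball_bounded_integrable[of _ "\<bar>3 * M\<bar>"]) auto
    show "AE y in lborel. (\<lambda>n. indicator (ball 0 1) y * (psi (sn n) x y * F y)) \<longlonglongrightarrow>
        indicator (ball 0 1) y * (green x y * F y)"
      using AE_lborel_neq[of x]
    proof eventually_elim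
      case (elim y)
      show ?case
      proof (cases "norm y < 1")
        case True
        then show ?thesis by (intro tendsto_intros psi_tendsto sn x elim)
      qed simp
    qed
    show "AE y in lborel. norm (indicator (ball 0 1) y * (psi (sn n) x y * F y)) \<le>
        indicator (ball (0::real^3) 1) y * (3 * M)" for n
    proof (rule AE_I2)
      fix y :: "real^3"
      have "norm y < 1 \<Longrightarrow> \<bar>psi (sn n) x y\<bar> * \<bar>F y\<bar> \<le> 3 * M"
        using psi_bound[OF sn(1,2) x] F(2) by (intro mult_mono) auto
      then show "norm (indicator (ball 0 1) y * (psi (sn n) x y * F y)) \<le>
          indicator (ball (0::real^3) 1) y * (3 * M)"
        by (simp add: indicator_def abs_mult)
    qed
  qed measurable
  ultimately show ?thesis by simp
qed

section \<open>The integral equation for the weak solution, and the conclusion\<close>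

theorem theorem1p2:
  fixes f :: "real \<Rightarrow> real" and v :: "real^3 \<Rightarrow> real" and a b \<epsilon> :: real
  assumes a_pos: "a > 0" and b_pos: "b > 0"
    and f_pos: "\<And>t. t > 0 \<Longrightarrow> f t > 0"
    and f_cont: "continuous_on {0<..} f"
    and f_noninc: "\<And>s t. 0 < s \<Longrightarrow> s \<le> t \<Longrightarrow> f t \<le> f s"
    and v_W22: "W22 (ball 0 1) v"
    and v_pos: "AE x in lebesgue. x \<in> ball 0 1 \<longrightarrow> v x > 0"
    and eps_pos: "\<epsilon> > 0"
    and v_inf: "AE x in lebesgue. x \<in> ball 0 1 \<longrightarrow> \<bar>v x\<bar> \<ge> \<epsilon>"
    and v_weak: "\<And>\<phi> g. test_fun (ball 0 1) \<phi> \<Longrightarrow>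
        (\<forall>i. L2 (ball 0 1) (g i) \<and> weak_deriv (ball 0 1) [i, i] v (g i)) \<Longrightarrow>
        set_lebesgue_integral lebesgue (ball 0 1)
          (\<lambda>x. (\<Sum>i\<in>UNIV. g i x) * (\<Sum>j\<in>UNIV. partial j (partial j \<phi>) x))
        = - set_lebesgue_integral lebesgue (ball 0 1) (\<lambda>x. f (v x) * \<phi> x)"
    and v_bdry: "W022 (ball 0 1) (\<lambda>x. v x - (a + b * ((norm x)^2 - 1) / 2))"
  shows "\<exists>g :: real \<Rightarrow> real. strict_mono_on {0..<1} g \<and>
           (AE x in lebesgue. x \<in> ball 0 1 \<longrightarrow> v x = g (norm x))"
proof -
  define h where "h x = a + b * ((norm x)\<^sup>2 - 1) / 2" for x :: "real^3"
  define u0 where "u0 x = v x - h x" for x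
  \<comment> \<open>Almost everywhere in the ball \<open>v\<close> is at least
    \<open>\<epsilon>\<close>, where \<open>ft\<close> and \<open>f\<close> agree. The truncation
    supplies positivity and the bound \<open>f \<epsilon>\<close> on the whole line.\<close>
  define ft where "ft t = f (max t \<epsilon>)" for t
  have hq: "h = quad (b / 2) 0 (a - b / 2)" by (simp add: fun_eq_iff h_def quad_def field_simps)
  have sh: "smooth3 h" unfolding hq by (rule smooth3_quad)
  have ph: "partial i (partial i h) y = b" for i y
  proof -
    have "has_partial i (\<lambda>y. 2 * (b / 2 * y $ i - (0::real^3) $ i)) (\<lambda>_. b)"
      unfolding has_partial_def by (auto intro!: derivative_eq_intros)
    from partial_eqI[OF this] show ?thesis unfolding hq partial_quad by simp
  qed
  have L2v: "L2 (ball 0 1) v" using v_W22 by (simp add: W22_def)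
  have L2u0: "L2 (ball 0 1) u0" unfolding u0_def[abs_def] by (intro L2_diff L2v L2_smooth3 sh)
  have "\<forall>i. \<exists>g. L2 (ball 0 1) g \<and> weak_deriv (ball 0 1) [i, i] v g"
  proof
    fix i :: 3
    have "length [i, i] \<le> 2" by simp
    then show "\<exists>g. L2 (ball 0 1) g \<and> weak_deriv (ball 0 1) [i, i] v g" using v_W22 unfolding W22_def by blast
  qed
  then obtain g where g: "\<And>i. L2 (ball 0 1) (g i)" "\<And>i. weak_deriv (ball 0 1) [i, i] v (g i)" by metis
  \<comment> \<open>All pure second derivatives of \<open>h\<close> equal \<open>b\<close>, so these
    are the weak second derivatives of \<open>v - h\<close>.\<close>
  define g0 where "g0 i x = g i x - b" for i x
  have L2g0: "L2 (ball 0 1) (g0 i)" for i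
    unfolding g0_def[abs_def] by (intro L2_diff g L2_smooth3 smooth3_const)
  have wd0: "weak_deriv (ball 0 1) [i, i] u0 (g0 i)" for i
    unfolding weak_deriv_def set_integral_ball
  proof (intro allI impI)
    fix \<phi> assume t: "test_fun (ball 0 1) \<phi>"
    have sm: "smooth3 \<phi>" and bs: "bdd_support \<phi>" by (auto intro: test_fun_smooth3[OF t] test_fun_bdd_support[OF t])
    have L: "L2 (ball 0 1) (partial i (partial i \<phi>))" "L2 (ball 0 1) \<phi>" "L2 (ball 0 1) (\<lambda>_. b)"
      by (auto intro!: L2_smooth3 smooth3_partial sm smooth3_const)
    have "ball_integral (\<lambda>x. v x * partial i (partial i \<phi>) x) = ball_integral (\<lambda>x. g i x * \<phi> x)"
      using g(2)[of i] t unfolding weak_deriv_def set_integral_ball by auto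
    moreover have "ball_integral (\<lambda>x. h x * partial i (partial i \<phi>) x) = ball_integral (\<lambda>x. b * \<phi> x)"
    proof -
      have 1: "(\<lambda>y. indicator (ball 0 1) y * (h y * partial i (partial i \<phi>) y)) = (\<lambda>y. h y * partial i (partial i \<phi>) y)"
        and 2: "(\<lambda>y. indicator (ball 0 1) y * (b * \<phi> y)) = (\<lambda>y. b * \<phi> y)"
        using test_fun_zero[OF t] by (auto simp: fun_eq_iff indicator_def)
      have "ball_integral (\<lambda>x. h x * partial i (partial i \<phi>) x) = (\<integral>y. h y * partial i (partial i \<phi>) y \<partial>lborel)"
        by (subst ball_integral_lborel) (intro smooth3_borel smooth3_mult sh smooth3_partial sm, simp only: 1)
      also have "\<dots> = (\<integral>y. b * \<phi> y \<partial>lborel)"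
        unfolding integral_by_parts_twice[OF sm bs sh] ph ..
      also have "\<dots> = ball_integral (\<lambda>x. b * \<phi> x)"
        by (subst ball_integral_lborel) (intro smooth3_borel smooth3_mult smooth3_const sm, simp only: 2)
      finally show ?thesis .
    qed
    moreover have "ball_integral (\<lambda>x. u0 x * partial i (partial i \<phi>) x) =
      ball_integral (\<lambda>x. v x * partial i (partial i \<phi>) x) - ball_integral (\<lambda>x. h x * partial i (partial i \<phi>) x)"
      unfolding u0_def left_diff_distrib
      by (intro ball_integral_diff L2_mult_integrable L2v L2_smooth3 sh L(1))
    moreover have "ball_integral (\<lambda>x. g0 i x * \<phi> x) = ball_integral (\<lambda>x. g i x * \<phi> x) - ball_integral (\<lambda>x. b * \<phi> x)"
      unfolding g0_def left_diff_distrib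
      by (intro ball_integral_diff L2_mult_integrable g(1) L(2,3))
    ultimately show "ball_integral (\<lambda>x. u0 x * foldr partial [i, i] \<phi> x) =
        (- 1) ^ length [i, i] * ball_integral (\<lambda>x. g0 i x * \<phi> x)" by simp
  qed
  obtain \<phi> where \<phi>: "\<And>n. test_fun (ball 0 1) (\<phi> n)"
    "\<And>js g. length js \<le> 2 \<Longrightarrow> L2 (ball 0 1) g \<Longrightarrow> weak_deriv (ball 0 1) js u0 g \<Longrightarrow>
      (\<lambda>n. ball_integral (\<lambda>x. (foldr partial js (\<phi> n) x - g x)\<^sup>2)) \<longlonglongrightarrow> 0"
    using v_bdry unfolding W022_def u0_def[abs_def] h_def[symmetric] set_integral_ball by blast
  \<comment> \<open>The empty list stands for the derivative of order zero, of which
    \<open>u0\<close> itself is a weak representative.\<close>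
  have lim0: "(\<lambda>n. ball_integral (\<lambda>x. (\<phi> n x - u0 x)\<^sup>2)) \<longlonglongrightarrow> 0"
    using \<phi>(2)[of "[]" u0] L2u0 by (simp add: weak_deriv_def)
  have lim2: "(\<lambda>n. ball_integral (\<lambda>x. (partial i (partial i (\<phi> n)) x - g0 i x)\<^sup>2)) \<longlonglongrightarrow> 0" for i
    using \<phi>(2)[of "[i, i]" "g0 i"] L2g0 wd0 by simp
  have s\<phi>: "smooth3 (\<phi> n)" for n by (rule test_fun_smooth3[OF \<phi>(1)])

  define W where "W x = (\<Sum>i\<in>UNIV. g0 i x)" for x
  have L2W: "L2 (ball 0 1) W"
    unfolding W_def[abs_def] UNIV_3 by (simp add: L2_add L2g0)
  define c where "c = 12 * bump_mass"
  have c: "c > 0" using bump_mass_pos by (simp add: c_def)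
  \<comment> \<open>The representation formula for \<open>\<phi> n\<close> gives convergence at
    every point of the ball. The boundary conditions act through these test functions.\<close>
  have limW: "(\<lambda>n. c * \<phi> n x) \<longlonglongrightarrow> ball_integral (\<lambda>y. dker x y * W y)" if x: "norm x < 1" for x
  proof -
    have Lp: "L2 (ball 0 1) (partial i (partial i (\<phi> n)))" for i n
      by (intro L2_smooth3 smooth3_partial s\<phi>)
    have "(\<lambda>n. \<Sum>i\<in>UNIV. ball_integral (\<lambda>y. dker x y * partial i (partial i (\<phi> n)) y))
       \<longlonglongrightarrow> (\<Sum>i\<in>UNIV. ball_integral (\<lambda>y. dker x y * g0 i y))"
      by (intro tendsto_sum L2_pairing_tendsto L2_dker x Lp L2g0 lim2)
    moreover have "(\<Sum>i\<in>UNIV. ball_integral (\<lambda>y. dker x y * g0 i y)) = ball_integral (\<lambda>y. dker x y * W y)"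
      unfolding W_def sum_distrib_left
      by (rule ball_integral_sum[symmetric]) (intro L2_mult_integrable L2_dker x L2g0)
    moreover have "(\<Sum>i\<in>UNIV. ball_integral (\<lambda>y. dker x y * partial i (partial i (\<phi> n)) y)) = c * \<phi> n x" for n
    proof -
      have [measurable]: "lap (\<phi> n) \<in> borel_measurable borel" by (intro smooth3_borel smooth3_lap s\<phi>)
      have "(\<Sum>i\<in>UNIV. ball_integral (\<lambda>y. dker x y * partial i (partial i (\<phi> n)) y))
          = ball_integral (\<lambda>y. dker x y * lap (\<phi> n) y)"
        unfolding lap_def sum_distrib_left
        by (rule ball_integral_sum[symmetric]) (intro L2_mult_integrable L2_dker x Lp)
      also have "\<dots> = (\<integral>y. indicator (ball 0 1) y * (dker x y * lap (\<phi> n) y) \<partial>lborel)"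
        by (rule ball_integral_lborel) measurable
      also have "\<dots> = (\<integral>y. dker x y * lap (\<phi> n) y \<partial>lborel)"
        using test_fun_zero(4)[OF \<phi>(1)[of n]]
        by (intro Bochner_Integration.integral_cong) (auto simp: indicator_def)
      also have "\<dots> = c * \<phi> n x" unfolding c_def by (rule dker_test_fun[OF x \<phi>(1)])
      finally show ?thesis .
    qed
    ultimately show ?thesis by simp
  qed

  \<comment> \<open>\<open>v\<close> is only Lebesgue measurable; a Borel representative makes the
    composition with \<open>ft\<close> Borel measurable, as the kernel estimates require.\<close>
  obtain v1 where v1: "v1 \<in> borel_measurable lborel" "AE x in lborel. indicator (ball 0 1) x * v x = v1 x"
    using completion_ex_borel_measurable_real[of "\<lambda>x. indicator (ball 0 1) x * v x" lborel] L2v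
    by (auto simp: L2_ball_iff)
  have [measurable]: "v1 \<in> borel_measurable borel" using v1(1) by simp
  have ftc: "continuous_on UNIV ft" unfolding ft_def[abs_def]
    by (intro continuous_on_compose2[OF f_cont] continuous_intros) (use eps_pos in \<open>auto simp: max_def\<close>)
  have [measurable]: "ft \<in> borel_measurable borel" by (rule borel_measurable_continuous_onI[OF ftc])
  have ftpos: "ft t > 0" for t unfolding ft_def using eps_pos by (intro f_pos) (auto simp: max_def)
  have ftle: "ft t \<le> f \<epsilon>" for t unfolding ft_def using eps_pos by (intro f_noninc) auto
  have ftanti: "ft t \<le> ft s" if "s \<le> t" for s t
    unfolding ft_def using eps_pos that by (intro f_noninc) (auto simp: max_def)
  define F0 where "F0 y = ft (v1 y)" for y
  have F0b: "\<bar>F0 y\<bar> \<le> f \<epsilon>" for y using ftpos[of "v1 y"] ftle[of "v1 y"] by (simp add: F0_def)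
  have [measurable]: "F0 \<in> borel_measurable borel" unfolding F0_def[abs_def] by measurable
  have v1': "AE y in lebesgue. y \<in> ball 0 1 \<longrightarrow> v y = v1 y"
    using AE_completion[OF v1(2)] by eventually_elim (auto simp: indicator_def)
  have fF0: "AE y in lebesgue. y \<in> ball 0 1 \<longrightarrow> F0 y = f (v y)"
    using v1' v_pos v_inf by eventually_elim (auto simp: F0_def ft_def max_def)
  define I where "I x = (\<integral>y. indicator (ball 0 1) y * (green x y * F0 y) \<partial>lborel)" for x
  \<comment> \<open>The weak equation is tested with \<open>psi (sn n) x\<close>. In the limit the
    left side pairs \<open>W\<close>, the weak Laplacian of \<open>u0\<close>, with
    \<open>dker x\<close>, and the right side becomes the Green potential of the source.\<close>
  have dkerW: "ball_integral (\<lambda>y. dker x y * W y) = - I x" if x: "norm x < 1" for x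
  proof -
    have "ball_integral (\<lambda>y. lap (psi (sn n) x) y * W y) = - ball_integral (\<lambda>y. F0 y * psi (sn n) x y)" for n
    proof -
      let ?p = "psi (sn n) x"
      have tp: "test_fun (ball 0 1) ?p" by (rule psi_test_fun[OF sn(1) x])
      have sp: "smooth3 ?p" by (rule smooth3_psi[OF sn(1)])
      have [measurable]: "?p \<in> borel_measurable borel" by (rule smooth3_borel[OF sp])
      have Ll: "L2 (ball 0 1) (lap ?p)" by (intro L2_smooth3 smooth3_lap sp)
      have Lg: "L2 (ball 0 1) (\<lambda>y. \<Sum>i\<in>UNIV. g i y)" unfolding UNIV_3 by (simp add: L2_add g)
      have "ball_integral (\<lambda>y. (\<Sum>i\<in>UNIV. g i y) * lap ?p y) = - ball_integral (\<lambda>y. f (v y) * ?p y)"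
        using v_weak[OF tp, of g] g unfolding set_integral_ball lap_def by simp
      also have "ball_integral (\<lambda>y. f (v y) * ?p y) = ball_integral (\<lambda>y. F0 y * ?p y)"
        unfolding ball_integral_def
      proof (rule integral_cong_AE_lebesgue[symmetric])
        have "(\<lambda>y. indicator (ball 0 1) y * (F0 y * ?p y)) \<in> borel_measurable borel" by measurable
        then show "(\<lambda>y. indicator (ball 0 1) y * (F0 y * ?p y)) \<in> borel_measurable lebesgue"
          by (rule borel_lebesgue)
        show "AE y in lebesgue. indicator (ball 0 1) y * (F0 y * ?p y) = indicator (ball 0 1) y * (f (v y) * ?p y)"
          using fF0 by eventually_elim (auto simp: indicator_def)
      qed
      finally have 1: "ball_integral (\<lambda>y. (\<Sum>i\<in>UNIV. g i y) * lap ?p y) = - ball_integral (\<lambda>y. F0 y * ?p y)" .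
      \<comment> \<open>\<open>W\<close> differs from the weak Laplacian of \<open>v\<close> by the
        constant \<open>3 * b\<close>, which drops out because the Laplacian of a test function has
        integral zero.\<close>
      have 2: "ball_integral (lap ?p) = 0"
      proof -
        have "ball_integral (lap ?p) = (\<integral>y. indicator (ball 0 1) y * lap ?p y \<partial>lborel)"
          by (intro ball_integral_lborel smooth3_borel smooth3_lap sp)
        also have "\<dots> = (\<integral>y. 1 * lap ?p y \<partial>lborel)"
          using test_fun_zero(4)[OF tp] by (intro Bochner_Integration.integral_cong) (auto simp: indicator_def)
        also have "\<dots> = (\<integral>y. lap (\<lambda>_. 1) y * ?p y \<partial>lborel)"
          by (rule green_identity[OF sp test_fun_bdd_support[OF tp] smooth3_const])
        also have "lap (\<lambda>_::real^3. 1) = (\<lambda>_. 0)" by (simp add: fun_eq_iff lap_def partial_const)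
        finally show ?thesis by simp
      qed
      have "ball_integral (\<lambda>y. lap ?p y * W y) =
          ball_integral (\<lambda>y. (\<Sum>i\<in>UNIV. g i y) * lap ?p y - (3 * b) * lap ?p y)"
        unfolding W_def g0_def by (simp add: sum_subtractf algebra_simps)
      also have "\<dots> = ball_integral (\<lambda>y. (\<Sum>i\<in>UNIV. g i y) * lap ?p y) - ball_integral (\<lambda>y. (3 * b) * lap ?p y)"
        by (intro ball_integral_diff L2_mult_integrable Lg Ll L2_smooth3 smooth3_const)
      also have "\<dots> = - ball_integral (\<lambda>y. F0 y * ?p y)" unfolding ball_integral_cmult 1 2 by simp
      finally show ?thesis .
    qed
    then have "(\<lambda>n. - ball_integral (\<lambda>y. F0 y * psi (sn n) x y)) \<longlonglongrightarrow> ball_integral (\<lambda>y. dker x y * W y)"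
      using dker_lap_psi_pairing_tendsto[OF x L2W] by simp
    moreover have "(\<lambda>n. - ball_integral (\<lambda>y. F0 y * psi (sn n) x y)) \<longlonglongrightarrow> - I x"
      unfolding I_def by (intro tendsto_minus psi_pairing_tendsto[OF x _ F0b]) measurable
    ultimately show ?thesis by (rule LIMSEQ_unique)
  qed

  \<comment> \<open>The limit of \<open>\<phi> n\<close> is \<open>- u\<close>, so this is the
    continuous representative of \<open>h - v\<close>, given at every point of the ball by a
    potential.\<close>
  define u where "u x = (1 / c) * I x" for x
  have \<phi>u: "(\<lambda>n. \<phi> n x) \<longlonglongrightarrow> - u x" if x: "norm x < 1" for x
  proof -
    have "(\<lambda>n. (1 / c) * (c * \<phi> n x)) \<longlonglongrightarrow> (1 / c) * (- I x)"
      using limW[OF x] dkerW[OF x] by (intro tendsto_intros) simp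
    then show ?thesis using c by (simp add: u_def)
  qed
  \<comment> \<open>The L2 limit \<open>u0\<close> and the pointwise limit \<open>- u\<close> of the
    same sequence agree almost everywhere, by way of an almost everywhere convergent
    subsequence.\<close>
  have u0u: "AE x in lebesgue. x \<in> ball 0 1 \<longrightarrow> u0 x = - u x"
  proof -
    have Ld: "L2 (ball 0 1) (\<lambda>x. \<phi> n x - u0 x)" for n by (intro L2_diff L2_smooth3 s\<phi> L2u0)
    obtain r where r: "strict_mono r"
      "AE x in lebesgue. (\<lambda>n. indicator (ball 0 1) x * (\<phi> (r n) x - u0 x)\<^sup>2) \<longlonglongrightarrow> 0"
      using tendsto_L1_AE_subseq[of lebesgue "\<lambda>n x. indicator (ball 0 1) x * (\<phi> n x - u0 x)\<^sup>2"]
        Ld lim0 by (auto simp: L2_ball_iff ball_integral_def abs_mult)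
    show ?thesis using r(2)
    proof eventually_elim
      case (elim x)
      show ?case
      proof
        assume x: "x \<in> ball 0 1"
        have "(\<lambda>n. \<phi> (r n) x) \<longlonglongrightarrow> - u x"
          using LIMSEQ_subseq_LIMSEQ[OF \<phi>u r(1), of x] x by (simp add: o_def)
        then have "(\<lambda>n. (\<phi> (r n) x - u0 x)\<^sup>2) \<longlonglongrightarrow> (- u x - u0 x)\<^sup>2" by (intro tendsto_intros)
        moreover have "(\<lambda>n. (\<phi> (r n) x - u0 x)\<^sup>2) \<longlonglongrightarrow> 0" using elim x by simp
        ultimately have "(- u x - u0 x)\<^sup>2 = 0" by (rule LIMSEQ_unique)
        then show "u0 x = - u x" by simp
      qed
    qed
  qed
  then have vh: "AE x in lebesgue. x \<in> ball 0 1 \<longrightarrow> v x = h x - u x"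
    by eventually_elim (auto simp: u0_def)
  have ucont: "continuous_on (ball 0 1) u"
  proof -
    have lip: "\<bar>u x - u x'\<bar> \<le> (1 / c) * (88 * invsq_bound * f \<epsilon>) * norm (x - x')"
      if "norm x < 1" "norm x' < 1" for x x'
    proof -
      have "\<bar>u x - u x'\<bar> = (1 / c) * \<bar>I x - I x'\<bar>"
        using c unfolding u_def right_diff_distrib[symmetric] abs_mult by simp
      also have "\<dots> \<le> (1 / c) * (88 * invsq_bound * f \<epsilon> * norm (x - x'))"
        unfolding I_def using c F0b that by (intro mult_left_mono green_potential_lipschitz) auto
      finally show ?thesis by simp
    qed
    define L where "L = (1 / c) * (88 * invsq_bound * f \<epsilon>)"
    have "L-lipschitz_on (ball 0 1) u"
    proof (rule lipschitz_onI)
      show "L \<ge> 0" using c invsq_bound_nonneg f_pos[OF eps_pos] by (simp add: L_def)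
    qed (use lip in \<open>auto simp: L_def dist_norm\<close>)
    then show ?thesis by (rule lipschitz_on_continuous_on)
  qed
  \<comment> \<open>Under the integral the source may be rewritten in terms of \<open>u\<close>,
    which turns the formula for \<open>u\<close> into a fixed point equation valid at every point of
    the ball.\<close>
  have F0u: "AE y in lborel. y \<in> ball 0 1 \<longrightarrow> F0 y = ft (h y - u y)"
  proof -
    have "AE y in lebesgue. y \<in> ball 0 1 \<longrightarrow> F0 y = ft (h y - u y)"
      using v1' vh by eventually_elim (auto simp: F0_def)
    then show ?thesis by (simp add: AE_completion_iff)
  qed
  have fp: "green_fixed_point (1 / c) a b (f \<epsilon>) ft u"
  proof
    fix x :: "real^3" assume x: "norm x < 1"
    have cm: "continuous_on (ball 0 1) (\<lambda>y. ft (h y - u y))"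
      by (intro continuous_on_compose2[OF ftc] continuous_intros ucont
          continuous_on_subset[OF smooth3_continuous[OF sh]]) auto
    have m: "(\<lambda>y. indicator (ball 0 1) y *\<^sub>R ft (h y - u y)) \<in> borel_measurable borel"
      using cm by (intro borel_measurable_continuous_on_indicator) auto
    have "I x = (\<integral>y. green x y * (indicator (ball 0 1) y *\<^sub>R ft (h y - u y)) \<partial>lborel)"
      unfolding I_def
    proof (rule integral_cong_AE)
      show "(\<lambda>y. green x y * (indicator (ball 0 1) y *\<^sub>R ft (h y - u y))) \<in> borel_measurable lborel"
        using borel_measurable_times[OF green_borel m] by simp
      show "AE y in lborel. indicator (ball 0 1) y * (green x y * F0 y) =
          green x y * (indicator (ball 0 1) y *\<^sub>R ft (h y - u y))"
        using F0u by eventually_elim (auto simp: indicator_def)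
    qed measurable
    also have "\<dots> = (\<integral>y. indicator (ball 0 1) y * (green x y * ft (a + b * ((norm y)\<^sup>2 - 1) / 2 - u y)) \<partial>lborel)"
      by (simp add: h_def mult.left_commute)
    finally show "u x = 1 / c * (\<integral>y. indicator (ball 0 1) y * (green x y * ft (a + b * ((norm y)\<^sup>2 - 1) / 2 - u y)) \<partial>lborel)"
      by (simp add: u_def)
  qed (use c b_pos ftc ftanti ftpos ftle ucont in auto)
  obtain G where G: "strict_mono_on {0..<1} G" "\<And>x. norm x < 1 \<Longrightarrow> h x - u x = G (norm x)"
    using green_fixed_point.radial_increasing[OF fp] unfolding green_fixed_point.h_def[OF fp] h_def
    by metis
  have "AE x in lebesgue. x \<in> ball 0 1 \<longrightarrow> v x = G (norm x)"
    using vh by eventually_elim (auto simp: G(2))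
  then show ?thesis using G(1) by blast
qed

end
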